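(* There exist $\varepsilon_4^*>0$ and $N_0\in\mathbb N$ ($N_0$ independent of $\varepsilon$) such that for all $\varepsilon\in[0,\varepsilon_4^*]$ and $N\ge N_0$ the operator $\tilde{\mathcal L}_{\varepsilon,N}:=\Pi_N\tilde{\mathcal L}_\varepsilon$ has a unique fixed point $h^*_{\varepsilon,N}\in B_K$. Further, there exist $C_K>0$ and $\gamma\in(0,1)$ such that for all such $\varepsilon$ and $N$, all $h^0\in B_K$ and all $n\in\mathbb N$, $$\|\tilde{\mathcal L}_{\varepsilon,N}^{\,n}(h^0)-h^*_{\varepsilon,N}\|_{W^{1,1}}\le C_K\gamma^n;$$ that is, with $h^0_N:=h^0$ and $h^{m}_N:=\Pi_N\mathcal L_{T_{\varepsilon,h_N^{m-1}}}h_N^{m-1}$ for $m\ge1$, $$\|\Pi_N\mathcal L_{T_{\varepsilon,h_N^{n-1}}}\circ\cdots\circ\Pi_N\mathcal L_{T_{\varepsilon,h_N^{1}}}\circ\Pi_N\mathcal L_{T_{\varepsilon,h_N^{0}}}h^0-h^*_{\varepsilon,N}\|_{W^{1,1}}\le C_K\gamma^n.$$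
   Context: Function spaces. $\mathbb S^1$ is the circle. $W^{i,1}=W^{i,1}(\mathbb S^1)$ is the Sobolev space with norm $\|f\|_{W^{i,1}}=\|f\|_{L^1}+\sum_{j=1}^i\|f^{(j)}\|_{L^1}$, and $W^{0,1}:=L^1$. $\mathcal D_1=\{f\in L^1: f\ge0,\ \int_{\mathbb S^1}f=1\}$. Dynamics. $T:\mathbb S^1\to\mathbb S^1$ is a $C^5$ uniformly expanding map and $g:\mathbb S^1\times\mathbb S^1\to\mathbb R$ is $C^5$. For $\varepsilon\ge 0$ and $f\in\mathcal D_1$ put $I_{\varepsilon,f}(x)=x+\varepsilon\int g(x,y)f(y)\,dy$ (mod 1) and $T_{\varepsilon,f}=I_{\varepsilon,f}\circ T$. For a map $S$, $\mathcal L_S:L^1\to L^1$ is its transfer operator: $\int\varphi\circ S\cdot\psi\,dx=\int\varphi\cdot\mathcal L_S\psi\,dx$ for $\psi\in L^1$, $\varphi\in L^\infty$. The (nonlinear) self-consistent transfer operator acts on probability densities by $\tilde{\mathcal L}_\varepsilon(h)=\mathcal L_{T_{\varepsilon,h}}h$. Standing constants. Fix a small $\varepsilon_0^*>0$, $\lambda\in(0,1)$ and $C_0>0$ such that all the maps $T_{\varepsilon,f}$ with $\varepsilon\in[0,\varepsilon_0^*]$, $f\in\mathcal D_1$ satisfy $\sup_x 1/|T_{\varepsilon,f}'(x)|\le\lambda$ and $\|T_{\varepsilon,f}\|_{C^5}<C_0$ (all values of $\varepsilon$ considered lie in $[0,\varepsilon_0^*]$). There is then a constant $C_{LY}>0$,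 fixed throughout, with $\|\mathcal L_{T_{\varepsilon,f_n}\circ\cdots\circ T_{\varepsilon,f_1}}h\|_{W^{i,1}}\le\lambda^{in}\|h\|_{W^{i,1}}+C_{LY}\|h\|_{W^{i-1,1}}$ for all such maps, $h\in W^{i,1}$, $i=1,2,3,4$, $n\in\mathbb N$. Fix $K\ge C_{LY}/(1-\lambda^2)$ and let $B_K=\{h\in\mathcal D_1\cap W^{2,1}:\|h\|_{W^{2,1}}\le K\}$. Discretisation. With $e_k(x)=e^{2\pi ikx}$, the Fejér kernel is $K_N=\sum_{|k|\le N-1}(1-|k|/N)e_k$, and $\Pi_Nf(x)=\int_{\mathbb S^1}K_N(x-y)f(y)\,dy$ for $f\in L^1$. $\tilde{\mathcal L}_{\varepsilon,N}^{\,n}$ denotes the $n$-fold iterate of the nonlinear map $\tilde{\mathcal L}_{\varepsilon,N}$. *)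

theory Defs
  imports "HOL-Analysis.Analysis"
begin

(*
  Conventions.  A function on the circle R/Z is a 1-periodic function on the reals; a continuous
  circle map is represented by a lift to the reals, so "mod 1" disappears from the formulas.
  Elements of L^1, L^infinity and W^{i,1} are represented by Borel functions, and equality in these
  spaces is almost-everywhere equality, stated explicitly wherever it matters.
*)

definition circ :: "real measure" where
  "circ = restrict_space lborel {0..<1}"

definition periodic1 :: "(real \<Rightarrow> 'b) \<Rightarrow> bool" where
  "periodic1 f \<longleftrightarrow> (\<forall>x. f (x + 1) = f x)"


subsection \<open>Functions of class C^k\<close>

(* On a finite-dimensional space this is the usual notion: all iterated directional (hence all
   partial) derivatives up to order k exist and are continuous. *)
primrec class_C :: "nat \<Rightarrow> ('a::euclidean_space \<Rightarrow> real) \<Rightarrow> bool" where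
  "class_C 0 f \<longleftrightarrow> continuous_on UNIV f"
| "class_C (Suc k) f \<longleftrightarrow>
     (\<forall>x. f differentiable (at x)) \<and> (\<forall>v. class_C k (\<lambda>x. frechet_derivative f (at x) v))"

definition circle_lift :: "(real \<Rightarrow> real) \<Rightarrow> bool" where
  "circle_lift S \<longleftrightarrow> continuous_on UNIV S \<and> (\<exists>d::int. \<forall>x. S (x + 1) = S x + of_int d)"

definition uniformly_expanding :: "(real \<Rightarrow> real) \<Rightarrow> bool" where
  "uniformly_expanding S \<longleftrightarrow> (\<exists>\<sigma>>1. \<forall>x. \<bar>deriv S x\<bar> \<ge> \<sigma>)"

(* The C^k norm of a circle map.  Its values are points of the circle, so there is no size of the
   map itself to measure and the sum starts with the first derivative. *)
definition C_norm :: "nat \<Rightarrow> (real \<Rightarrow> real) \<Rightarrow> real" where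
  "C_norm k S = (\<Sum>j=1..k. SUP x. \<bar>(deriv ^^ j) S x\<bar>)"


subsection \<open>Lebesgue and Sobolev spaces on the circle\<close>

definition L1 :: "(real \<Rightarrow> real) set" where
  "L1 = {f. periodic1 f \<and> integrable circ f}"

definition L1_norm :: "(real \<Rightarrow> real) \<Rightarrow> real" where
  "L1_norm f = (\<integral>x. \<bar>f x\<bar> \<partial>circ)"

definition Linf :: "(real \<Rightarrow> real) set" where
  "Linf = {\<phi>. periodic1 \<phi> \<and> \<phi> \<in> borel_measurable circ \<and> (\<exists>C. AE x in circ. \<bar>\<phi> x\<bar> \<le> C)}"

definition is_weak_deriv :: "nat \<Rightarrow> (real \<Rightarrow> real) \<Rightarrow> (real \<Rightarrow> real) \<Rightarrow> bool" where
  "is_weak_deriv j f u \<longleftrightarrow> u \<in> L1 \<and>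
     (\<forall>\<phi>. periodic1 \<phi> \<and> (\<forall>k. class_C k \<phi>) \<longrightarrow>
        (\<integral>x. f x * (deriv ^^ j) \<phi> x \<partial>circ) = (-1) ^ j * (\<integral>x. u x * \<phi> x \<partial>circ))"

(* Weak derivatives are unique up to null sets, so the choice of representative is immaterial. *)
definition weak_deriv :: "nat \<Rightarrow> (real \<Rightarrow> real) \<Rightarrow> (real \<Rightarrow> real)" where
  "weak_deriv j f = (SOME u. is_weak_deriv j f u)"

definition W1 :: "nat \<Rightarrow> (real \<Rightarrow> real) set" where
  "W1 i = {f \<in> L1. \<forall>j\<in>{1..i}. \<exists>u. is_weak_deriv j f u}"

(* Meaningful only for f in W1 i. *)
definition W1_norm :: "nat \<Rightarrow> (real \<Rightarrow> real) \<Rightarrow> real" where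
  "W1_norm i f = L1_norm f + (\<Sum>j=1..i. L1_norm (weak_deriv j f))"

definition D1 :: "(real \<Rightarrow> real) set" where
  "D1 = {f \<in> L1. (AE x in circ. 0 \<le> f x) \<and> (\<integral>x. f x \<partial>circ) = 1}"

definition B :: "real \<Rightarrow> (real \<Rightarrow> real) set" where
  "B K = {h \<in> D1 \<inter> W1 2. W1_norm 2 h \<le> K}"


subsection \<open>Transfer operators\<close>

definition is_transfer :: "(real \<Rightarrow> real) \<Rightarrow> (real \<Rightarrow> real) \<Rightarrow> (real \<Rightarrow> real) \<Rightarrow> bool" where
  "is_transfer S \<psi> u \<longleftrightarrow> u \<in> L1 \<and>
     (\<forall>\<phi>\<in>Linf. (\<integral>x. \<phi> (S x) * \<psi> x \<partial>circ) = (\<integral>x. \<phi> x * u x \<partial>circ))"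

(* The duality relation determines the result up to null sets. *)
definition transfer_op :: "(real \<Rightarrow> real) \<Rightarrow> (real \<Rightarrow> real) \<Rightarrow> (real \<Rightarrow> real)" where
  "transfer_op S \<psi> = (SOME u. is_transfer S \<psi> u)"

definition coupling :: "(real \<times> real \<Rightarrow> real) \<Rightarrow> real \<Rightarrow> (real \<Rightarrow> real) \<Rightarrow> real \<Rightarrow> real" where
  "coupling g \<epsilon> f x = x + \<epsilon> * (\<integral>y. g (x, y) * f y \<partial>circ)"

definition coupled_map ::
  "(real \<Rightarrow> real) \<Rightarrow> (real \<times> real \<Rightarrow> real) \<Rightarrow> real \<Rightarrow> (real \<Rightarrow> real) \<Rightarrow> real \<Rightarrow> real" where
  "coupled_map T g \<epsilon> f = coupling g \<epsilon> f \<circ> T"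

definition self_consistent_op ::
  "(real \<Rightarrow> real) \<Rightarrow> (real \<times> real \<Rightarrow> real) \<Rightarrow> real \<Rightarrow> (real \<Rightarrow> real) \<Rightarrow> (real \<Rightarrow> real)" where
  "self_consistent_op T g \<epsilon> h = transfer_op (coupled_map T g \<epsilon> h) h"

(* For fs = [f1, ..., fn] this is T_{eps,fn} o ... o T_{eps,f1}. *)
definition coupled_comp ::
  "(real \<Rightarrow> real) \<Rightarrow> (real \<times> real \<Rightarrow> real) \<Rightarrow> real \<Rightarrow> (real \<Rightarrow> real) list \<Rightarrow> real \<Rightarrow> real" where
  "coupled_comp T g \<epsilon> fs = fold (\<lambda>f S. coupled_map T g \<epsilon> f \<circ> S) fs id"

(* The Lasota-Yorke inequalities with constant C.  An inequality between Sobolev norms includes the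
   assertion that the left-hand side is finite, i.e. membership in the space. *)
definition Lasota_Yorke ::
  "(real \<Rightarrow> real) \<Rightarrow> (real \<times> real \<Rightarrow> real) \<Rightarrow> real \<Rightarrow> real \<Rightarrow> real \<Rightarrow> bool" where
  "Lasota_Yorke T g \<epsilon>\<^sub>0 lam C \<longleftrightarrow>
     (\<forall>\<epsilon>\<in>{0..\<epsilon>\<^sub>0}. \<forall>fs. set fs \<subseteq> D1 \<longrightarrow> (\<forall>i\<in>{1..4}. \<forall>h\<in>W1 i.
        transfer_op (coupled_comp T g \<epsilon> fs) h \<in> W1 i \<and>
        W1_norm i (transfer_op (coupled_comp T g \<epsilon> fs) h)
          \<le> lam ^ (i * length fs) * W1_norm i h + C * W1_norm (i - 1) h))"


subsection \<open>Fejer discretisation\<close>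

definition e_char :: "int \<Rightarrow> real \<Rightarrow> complex" where
  "e_char k x = exp (2 * of_real pi * \<i> * of_int k * of_real x)"

definition fejer_kernel :: "nat \<Rightarrow> real \<Rightarrow> complex" where
  "fejer_kernel N x =
     (\<Sum>k | \<bar>k\<bar> \<le> int N - 1. of_real (1 - of_int \<bar>k\<bar> / of_nat N) * e_char k x)"

(* The kernel is real-valued (the terms k and -k are conjugate), so Re only changes the type. *)
lemma fejer_kernel_real: "fejer_kernel N x \<in> \<real>"
proof -
  let ?A = "{k::int. \<bar>k\<bar> \<le> int N - 1}"
  let ?t = "\<lambda>k::int. of_real (1 - of_int \<bar>k\<bar> / of_nat N) * e_char k x"
  have "cnj (fejer_kernel N x) = (\<Sum>k\<in>?A. ?t (- k))"
    by (simp add: fejer_kernel_def e_char_def exp_cnj)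
  also have "\<dots> = (\<Sum>k\<in>?A. ?t k)"
    by (rule sum.reindex_bij_witness[of _ uminus uminus]) auto
  finally show ?thesis
    by (simp add: Reals_cnj_iff fejer_kernel_def)
qed

definition fejer_proj :: "nat \<Rightarrow> (real \<Rightarrow> real) \<Rightarrow> (real \<Rightarrow> real)" where
  "fejer_proj N f x = (\<integral>y. Re (fejer_kernel N (x - y)) * f y \<partial>circ)"

definition discrete_op ::
  "(real \<Rightarrow> real) \<Rightarrow> (real \<times> real \<Rightarrow> real) \<Rightarrow> real \<Rightarrow> nat \<Rightarrow> (real \<Rightarrow> real) \<Rightarrow> (real \<Rightarrow> real)" where
  "discrete_op T g \<epsilon> N h = fejer_proj N (self_consistent_op T g \<epsilon> h)"

end

theory Submission
  imports Defs
begin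

text \<open>
  Write \<open>F h = \<Pi>\<^sub>N L\<^sub>h h\<close>, where \<open>L\<^sub>h\<close> is the transfer operator of the map that the density
  \<open>h\<close> produces.  The proof shows that on a suitable set of densities some iterate of \<open>F\<close>
  contracts the \<open>W\<^sup>1\<^sup>,\<^sup>1\<close> distance by a factor \<open>1/2\<close>, uniformly in small \<open>\<epsilon>\<close> and large \<open>N\<close>
  (lemma \<open>F_contracts\<close>).

  The ball \<open>B K\<close> need not be invariant, because one Lasota-Yorke step bounds the \<open>W\<^sup>2\<^sup>,\<^sup>1\<close> norm by the
  \<open>W\<^sup>1\<^sup>,\<^sup>1\<close> norm and not by a constant.  It lies in a larger set \<open>inv_ball\<close>, cut out by one bound for each of
  the two norms, which is invariant; contraction is proved there.

  For two orbits in this set, the difference evolves by the linear cocycle of the operators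
  \<open>\<Pi>\<^sub>N L\<^sub>h\<close> along the first orbit, up to terms \<open>\<Pi>\<^sub>N (L\<^sub>h - L\<^sub>k) k\<close> that are bounded by
  \<open>\<epsilon>\<close> times the distance (\<open>LL_Lipschitz\<close>; a derivative is lost, which is why the orbit must be bounded in
  \<open>W\<^sup>2\<^sup>,\<^sup>1\<close>).  The linear cocycle contracts functions of zero mean (\<open>cocycle_mixing\<close>): for
  finitely many steps it is close, as a map from \<open>W\<^sup>1\<^sup>,\<^sup>1\<close> to \<open>L\<^sup>1\<close>, to the powers of the transfer operator of
  \<open>T\<close>, which make the \<open>L\<^sup>1\<close> norm small (\<open>LT_mixing\<close>), and further Lasota-Yorke steps turn a small \<open>L\<^sup>1\<close>
  norm into a small Sobolev norm.  Mixing of \<open>T\<close> is Doeblin's argument (\<open>doeblin_smooth\<close>): a zero-mean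
  function of controlled variation is large positive on one interval and large negative on another,
  and the expanding iterate spreads both over the whole circle, where they cancel in part.

  The fixed point is the limit of the orbit of the constant density (\<open>F_fixed_point\<close>).  It lies in \<open>B K\<close>
  itself because of the Lasota-Yorke inequality for long compositions, applied to the constant
  function: it gives a bound by nearly \<open>C_LY\<close>, and \<open>C_LY < K\<close> (\<open>fixed_point_norm\<close>).

  The regularity and perturbation estimates for transfer operators are obtained by duality against smooth
  test functions (\<open>L1_norm_dual\<close>).  In this way neither inverse branches of the maps nor absolutely continuous
  representatives of Sobolev functions enter.
\<close>

section \<open>Periodic functions and integration on the circle\<close>

lemma space_circ [simp]: "space circ = {0..<1}"
  by (simp add: circ_def space_restrict_space)

lemma measurable_circ:
  fixes f :: "real \<Rightarrow> 'b::topological_space"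
  shows "f \<in> borel_measurable borel \<Longrightarrow> f \<in> borel_measurable circ"
  unfolding circ_def by (intro measurable_restrict_space1) simp

lemma emeasure_circ: "emeasure circ (space circ) = 1"
  by (simp add: circ_def emeasure_restrict_space space_restrict_space)

interpretation circ: finite_measure circ
  by (rule finite_measureI) (simp only: emeasure_circ, simp)

lemma measure_circ [simp]: "measure circ {0..<1} = 1"
  using emeasure_circ by (simp add: measure_def)

lemma integral_circ:
  fixes f :: "real \<Rightarrow> real"
  shows "(\<integral>x. f x \<partial>circ) = (\<integral>x. indicator {0..<1} x * f x \<partial>lborel)"
  unfolding circ_def by (subst integral_restrict_space) auto

lemma AE_circ: "(AE x in circ. P x) \<longleftrightarrow> (AE x in lborel. x \<in> {0..<1} \<longrightarrow> P x)"
  unfolding circ_def by (subst AE_restrict_space_iff) auto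

lemma integral_circ_const [simp]: "(\<integral>x. c \<partial>circ) = (c::real)"
  by (simp add: measure_circ)

lemma periodic1_of_nat: "periodic1 f \<Longrightarrow> f (x + of_nat n) = f x"
proof (induction n)
  case (Suc n)
  have "f (x + of_nat (Suc n)) = f ((x + of_nat n) + 1)" by (simp add: algebra_simps)
  then show ?case using Suc by (simp add: periodic1_def)
qed simp

lemma periodic1_of_int:
  assumes "periodic1 f" shows "f (x + of_int k) = f x"
proof (cases "k \<ge> 0")
  case True
  then show ?thesis using periodic1_of_nat[OF assms, of x "nat k"] by simp
next
  case False
  then show ?thesis using periodic1_of_nat[OF assms, of "x + of_int k" "nat (-k)"] by simp
qed

lemma periodic1_frac: "periodic1 f \<Longrightarrow> f (frac x) = f x"
  using periodic1_of_int[of f x "- \<lfloor>x\<rfloor>"] by (simp add: frac_def)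

lemma measurable_frac_circ [measurable]: "frac \<in> measurable borel circ"
  unfolding circ_def
proof (rule measurable_restrict_space2)
  show "frac \<in> space borel \<rightarrow> {0..<1::real}" by (auto simp: frac_lt_1)
  have "(\<lambda>x::real. x - real_of_int \<lfloor>x\<rfloor>) \<in> borel_measurable borel" by measurable
  then show "(frac :: real \<Rightarrow> real) \<in> borel \<rightarrow>\<^sub>M lborel" by (simp add: frac_def[abs_def])
qed

lemma periodic1_borel:
  fixes f :: "real \<Rightarrow> real"
  assumes "periodic1 f" "f \<in> borel_measurable circ"
  shows "f \<in> borel_measurable borel"
proof -
  have "(\<lambda>x. f (frac x)) \<in> borel_measurable borel"
    using assms(2) by measurable
  then show ?thesis by (simp add: periodic1_frac[OF assms(1)])
qed

lemma periodic1_cont_bounded: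
  fixes f :: "real \<Rightarrow> real"
  assumes "periodic1 f" "continuous_on UNIV f"
  obtains b where "b \<ge> 0" "\<And>x. \<bar>f x\<bar> \<le> b"
proof -
  have "compact (f ` {0..1})"
    using assms(2) by (intro compact_continuous_image) (auto intro: continuous_on_subset)
  then obtain b where b: "\<And>x. x \<in> {0..1} \<Longrightarrow> \<bar>f x\<bar> \<le> b"
    by (meson bounded_real compact_imp_bounded image_eqI)
  have "\<bar>f x\<bar> \<le> b" for x
    using b[of "frac x"] periodic1_frac[OF assms(1), of x] by (auto simp: frac_lt_1 less_imp_le)
  moreover have "b \<ge> 0" using b[of 0] by auto
  ultimately show ?thesis using that by blast
qed

lemma integrable_circ_bounded:
  fixes f :: "real \<Rightarrow> real"
  assumes "f \<in> borel_measurable circ" "\<And>x. \<bar>f x\<bar> \<le> b"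
  shows "integrable circ f"
  using assms by (intro circ.integrable_const_bound[of _ b]) auto

lemma L1D: "f \<in> L1 \<Longrightarrow> periodic1 f" "f \<in> L1 \<Longrightarrow> integrable circ f"
  "f \<in> L1 \<Longrightarrow> f \<in> borel_measurable circ" "f \<in> L1 \<Longrightarrow> f \<in> borel_measurable borel"
  by (auto simp: L1_def intro: periodic1_borel)

lemma L1_bounded:
  assumes "periodic1 f" "f \<in> borel_measurable borel" "\<And>x. \<bar>f x\<bar> \<le> b"
  shows "f \<in> L1"
  unfolding L1_def using assms(1) integrable_circ_bounded[OF measurable_circ[OF assms(2)] assms(3)] by blast

lemma L1_cont: "periodic1 f \<Longrightarrow> continuous_on UNIV f \<Longrightarrow> f \<in> L1"
  by (metis L1_bounded borel_measurable_continuous_onI periodic1_cont_bounded)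

lemma L1_const [simp]: "(\<lambda>x. c) \<in> L1"
  by (rule L1_cont) (auto simp: periodic1_def)

lemma L1_add: "f \<in> L1 \<Longrightarrow> h \<in> L1 \<Longrightarrow> (\<lambda>x. f x + h x) \<in> L1"
  and L1_diff: "f \<in> L1 \<Longrightarrow> h \<in> L1 \<Longrightarrow> (\<lambda>x. f x - h x) \<in> L1"
  and L1_cmult: "f \<in> L1 \<Longrightarrow> (\<lambda>x. c * f x) \<in> L1"
  and L1_minus: "f \<in> L1 \<Longrightarrow> (\<lambda>x. - f x) \<in> L1"
  and L1_abs: "f \<in> L1 \<Longrightarrow> (\<lambda>x. \<bar>f x\<bar>) \<in> L1"
  by (auto simp: L1_def periodic1_def)

lemma integrable_mult_bounded:
  fixes f a :: "real \<Rightarrow> real"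
  assumes "integrable circ f" "a \<in> borel_measurable circ" "AE x in circ. \<bar>a x\<bar> \<le> b"
  shows "integrable circ (\<lambda>x. a x * f x)"
proof (rule Bochner_Integration.integrable_bound[where f="\<lambda>x. b * f x"])
  show "integrable circ (\<lambda>x. b * f x)" using assms(1) by simp
  show "(\<lambda>x. a x * f x) \<in> borel_measurable circ" using assms by auto
  show "AE x in circ. norm (a x * f x) \<le> norm (b * f x)"
    using assms(3) by eventually_elim (auto simp: abs_mult intro!: mult_right_mono)
qed

lemma L1_mult:
  assumes "f \<in> L1" "periodic1 a" "a \<in> borel_measurable borel" "\<And>x. \<bar>a x\<bar> \<le> b"
  shows "(\<lambda>x. a x * f x) \<in> L1"
  using assms integrable_mult_bounded[of f a b] measurable_circ[OF assms(3)] by (auto simp: L1_def periodic1_def)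

lemma L1_mult_cont:
  assumes "f \<in> L1" "periodic1 a" "continuous_on UNIV a"
  shows "(\<lambda>x. a x * f x) \<in> L1"
  by (rule periodic1_cont_bounded[OF assms(2,3)], rule L1_mult)
     (use assms in \<open>auto intro: borel_measurable_continuous_onI\<close>)

lemma abs_integral_mult_le:
  fixes f a :: "real \<Rightarrow> real"
  assumes "f \<in> L1" "a \<in> borel_measurable circ" "AE x in circ. \<bar>a x\<bar> \<le> b"
  shows "\<bar>\<integral>x. a x * f x \<partial>circ\<bar> \<le> b * L1_norm f"
proof -
  have i: "integrable circ (\<lambda>x. a x * f x)"
    using assms by (intro integrable_mult_bounded[of f a b]) (auto simp: L1D)
  have "\<bar>\<integral>x. a x * f x \<partial>circ\<bar> \<le> (\<integral>x. \<bar>a x * f x\<bar> \<partial>circ)"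
    by (rule integral_abs_bound)
  also have "\<dots> \<le> (\<integral>x. b * \<bar>f x\<bar> \<partial>circ)"
  proof (rule integral_mono_AE)
    show "integrable circ (\<lambda>x. \<bar>a x * f x\<bar>)" using i by simp
    show "integrable circ (\<lambda>x. b * \<bar>f x\<bar>)" using assms(1) by (simp add: L1D)
    show "AE x in circ. \<bar>a x * f x\<bar> \<le> b * \<bar>f x\<bar>"
      using assms(3) by eventually_elim (auto simp: abs_mult intro!: mult_right_mono)
  qed
  finally show ?thesis by (simp add: L1_norm_def)
qed

lemma L1_norm_nonneg [simp]: "0 \<le> L1_norm f"
  by (simp add: L1_norm_def)

lemma L1_norm_triangle: "f \<in> L1 \<Longrightarrow> h \<in> L1 \<Longrightarrow> L1_norm (\<lambda>x. f x + h x) \<le> L1_norm f + L1_norm h"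
proof -
  assume "f \<in> L1" "h \<in> L1"
  then have "integrable circ (\<lambda>x. \<bar>f x\<bar>)" "integrable circ (\<lambda>x. \<bar>h x\<bar>)" "integrable circ (\<lambda>x. \<bar>f x + h x\<bar>)"
    by (auto simp: L1D)
  then have "(\<integral>x. \<bar>f x + h x\<bar> \<partial>circ) \<le> (\<integral>x. \<bar>f x\<bar> + \<bar>h x\<bar> \<partial>circ)"
    by (intro integral_mono Bochner_Integration.integrable_add) auto
  also have "\<dots> = (\<integral>x. \<bar>f x\<bar> \<partial>circ) + (\<integral>x. \<bar>h x\<bar> \<partial>circ)"
    by (rule Bochner_Integration.integral_add) fact+
  finally show ?thesis unfolding L1_norm_def .
qed

lemma L1_norm_triangle_diff: "f \<in> L1 \<Longrightarrow> h \<in> L1 \<Longrightarrow> L1_norm (\<lambda>x. f x - h x) \<le> L1_norm f + L1_norm h"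
  using L1_norm_triangle[of f "\<lambda>x. - h x"] by (simp add: L1_minus) (simp add: L1_norm_def)

lemma L1_norm_cmult: "L1_norm (\<lambda>x. c * f x) = \<bar>c\<bar> * L1_norm f"
  by (simp add: L1_norm_def abs_mult)

lemma L1_norm_uminus: "L1_norm (\<lambda>x. - f x) = L1_norm f"
  by (simp add: L1_norm_def)

lemma L1_norm_const [simp]: "L1_norm (\<lambda>x. c) = \<bar>c\<bar>"
  by (simp add: L1_norm_def)

lemma abs_integral_le_L1_norm: "\<bar>\<integral>x. f x \<partial>circ\<bar> \<le> L1_norm f"
  unfolding L1_norm_def by (rule integral_abs_bound)

lemma L1_norm_cong_AE:
  assumes "f \<in> L1" "h \<in> L1" "AE x in circ. f x = h x"
  shows "L1_norm f = L1_norm h"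
  unfolding L1_norm_def
proof (rule integral_cong_AE)
  have [measurable]: "f \<in> borel_measurable circ" "h \<in> borel_measurable circ" using assms by (auto simp: L1D)
  show "(\<lambda>x. \<bar>f x\<bar>) \<in> borel_measurable circ" "(\<lambda>x. \<bar>h x\<bar>) \<in> borel_measurable circ" by measurable
qed (use assms(3) in auto)

lemma integral_mult_cong_AE:
  fixes f h a :: "real \<Rightarrow> real"
  assumes "f \<in> L1" "h \<in> L1" "AE x in circ. f x = h x" "a \<in> borel_measurable circ"
  shows "(\<integral>x. a x * f x \<partial>circ) = (\<integral>x. a x * h x \<partial>circ)"
proof (rule integral_cong_AE)
  have [measurable]: "f \<in> borel_measurable circ" "h \<in> borel_measurable circ" using assms by (auto simp: L1D)
  note [measurable] = assms(4)
  show "(\<lambda>x. a x * f x) \<in> borel_measurable circ" "(\<lambda>x. a x * h x) \<in> borel_measurable circ" by measurable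
qed (use assms(3) in auto)

lemma L1_norm_mult_le:
  assumes "f \<in> L1" "periodic1 a" "a \<in> borel_measurable borel" "\<And>x. \<bar>a x\<bar> \<le> b"
  shows "L1_norm (\<lambda>x. a x * f x) \<le> b * L1_norm f"
proof -
  have "L1_norm (\<lambda>x. a x * f x) \<le> (\<integral>x. b * \<bar>f x\<bar> \<partial>circ)"
    unfolding L1_norm_def
    using L1D(2)[OF L1_abs[OF L1_mult[OF assms]]] assms
    by (intro integral_mono) (auto simp: L1D abs_mult intro!: mult_right_mono)
  then show ?thesis by (simp add: L1_norm_def)
qed

lemma L1_norm_eq_0:
  assumes "f \<in> L1" "L1_norm f \<le> 0"
  shows "AE x in circ. f x = 0"
proof -
  have "(\<integral>x. \<bar>f x\<bar> \<partial>circ) = 0"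
    using antisym[OF assms(2) L1_norm_nonneg[of f]] by (simp add: L1_norm_def)
  then have "AE x in circ. \<bar>f x\<bar> = 0"
    using assms by (subst (asm) integral_nonneg_eq_0_iff_AE) (auto simp: L1D)
  then show ?thesis by simp
qed

lemma integral_circ_FTC:
  fixes F f :: "real \<Rightarrow> real"
  assumes "\<And>x. (F has_real_derivative f x) (at x)" "continuous_on UNIV f" "0 \<le> a" "a \<le> b" "b \<le> 1"
  shows "(\<integral>x. indicator {a..b} x * f x \<partial>circ) = F b - F a"
proof -
  have c: "continuous_on {a..b} f" and
    d: "(F has_vector_derivative f x) (at x within {a..b})" for x
    using assms(1)[of x] has_vector_derivative_at_within
    by (auto simp: has_real_derivative_iff_has_vector_derivative intro: continuous_on_subset[OF assms(2)])
  have f: "f \<in> borel_measurable borel" using assms(2) by (rule borel_measurable_continuous_onI)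
  have "(\<integral>x. indicator {a..b} x * f x \<partial>circ) = (\<integral>x. indicator {a..b} x *\<^sub>R f x \<partial>lborel)"
    unfolding integral_circ
  proof (rule integral_cong_AE)
    have "AE x in lborel. x \<noteq> (1::real)" by (rule AE_lborel_singleton)
    then show "AE x in lborel. indicator {0..<1} x * (indicator {a..b} x * f x) = indicator {a..b} x *\<^sub>R f x"
      by eventually_elim (use assms(3-5) in \<open>auto split: split_indicator\<close>)
  qed (use f in measurable)
  also have "\<dots> = F b - F a"
    by (rule integral_FTC_atLeastAtMost[OF assms(4) d c])
  finally show ?thesis .
qed

lemma integral_circ_FTC_full:
  fixes F f :: "real \<Rightarrow> real"
  assumes "\<And>x. (F has_real_derivative f x) (at x)" "continuous_on UNIV f"
  shows "(\<integral>x. f x \<partial>circ) = F 1 - F 0"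
proof -
  have "(\<integral>x. f x \<partial>circ) = (\<integral>x. indicator {0..1} x * f x \<partial>circ)"
    by (rule Bochner_Integration.integral_cong) auto
  then show ?thesis using integral_circ_FTC[OF assms, of 0 1] by simp
qed

text \<open>The derivative is a parameter so that it can be a simple expression where one is known.\<close>

definition per_C1 :: "(real \<Rightarrow> real) \<Rightarrow> (real \<Rightarrow> real) \<Rightarrow> bool" where
  "per_C1 f f' \<longleftrightarrow> periodic1 f \<and> (\<forall>x. (f has_real_derivative f' x) (at x)) \<and> continuous_on UNIV f'"

lemma per_C1D:
  assumes "per_C1 f f'"
  shows "periodic1 f" "(f has_real_derivative f' x) (at x)" "continuous_on UNIV f'"
    "continuous_on UNIV f" "periodic1 f'" "f \<in> borel_measurable borel" "f' \<in> borel_measurable borel"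
proof -
  show 1: "periodic1 f" "(f has_real_derivative f' x) (at x)" "continuous_on UNIV f'" for x
    using assms by (auto simp: per_C1_def)
  show 2: "continuous_on UNIV f"
    using 1(2) by (meson DERIV_isCont continuous_at_imp_continuous_on)
  show "periodic1 f'"
    unfolding periodic1_def
  proof
    fix x
    have "((\<lambda>x. f (x + 1)) has_real_derivative f' (x + 1)) (at x)"
      using DERIV_shift[of f "f' (x+1)" x 1] 1(2) by simp
    then show "f' (x + 1) = f' x"
      using 1(1,2) DERIV_unique by (simp add: periodic1_def) blast
  qed
  show "f \<in> borel_measurable borel" "f' \<in> borel_measurable borel"
    using 1(3) 2 by (auto intro: borel_measurable_continuous_onI)
qed

lemma per_C1_mult:
  assumes "per_C1 a a'" "per_C1 b b'"
  shows "per_C1 (\<lambda>x. a x * b x) (\<lambda>x. a x * b' x + a' x * b x)"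
  using assms per_C1D(1,3,4)[OF assms(1)] per_C1D(1,3,4)[OF assms(2)]
  by (auto simp: per_C1_def periodic1_def intro!: derivative_eq_intros continuous_intros)

lemma per_C1_integral_0:
  assumes "per_C1 f f'"
  shows "(\<integral>x. f' x \<partial>circ) = 0"
  using integral_circ_FTC_full[of f f'] per_C1D(1-3)[OF assms] by (auto simp: periodic1_def dest: spec[of _ 0])

lemma per_C1_by_parts:
  assumes "per_C1 a a'" "per_C1 b b'"
  shows "(\<integral>x. a x * b' x \<partial>circ) = - (\<integral>x. a' x * b x \<partial>circ)"
proof -
  have L: "(\<lambda>x. a x * b' x) \<in> L1" "(\<lambda>x. a' x * b x) \<in> L1"
    using per_C1D(1,3-5)[OF assms(1)] per_C1D(1,3-5)[OF assms(2)]
    by (auto intro!: L1_mult_cont intro: L1_cont)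
  show ?thesis
    using per_C1_integral_0[OF per_C1_mult[OF assms]] L by (simp add: L1D)
qed

lemma per_C1_primitive:
  assumes "periodic1 f" "continuous_on UNIV f" "(\<integral>x. f x \<partial>circ) = 0"
  obtains F where "per_C1 F f" "F 0 = 0"
proof -
  obtain F0 where F0: "\<And>x. (F0 has_real_derivative f x) (at x)"
  proof -
    have "\<exists>F. \<forall>x. x \<in> UNIV \<longrightarrow> (F has_vector_derivative f x) (at x)"
      using einterval_antiderivative[of "-\<infinity>" "\<infinity>" f] assms(2)
      by (auto simp: continuous_on_eq_continuous_at)
    then show ?thesis using that by (auto simp: has_real_derivative_iff_has_vector_derivative)
  qed
  define F where "F = (\<lambda>x. F0 x - F0 0)"
  have F: "(F has_real_derivative f x) (at x)" for x
    unfolding F_def by (auto intro!: derivative_eq_intros F0)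
  have "F (x + 1) - F x = F 1 - F 0" for x
  proof -
    have d: "((\<lambda>x. F (x + 1) - F x) has_real_derivative 0) (at x)" for x
      using DERIV_diff[OF _ F[of x], of "\<lambda>x. F (x+1)" "f x"] F[of "x+1"] assms(1)
      by (auto simp: periodic1_def DERIV_shift)
    then show ?thesis using DERIV_isconst_all[of "\<lambda>x. F (x+1) - F x" x 0] by auto
  qed
  moreover have "F 1 = F 0" using integral_circ_FTC_full[OF F assms(2)] assms(3) by simp
  ultimately have "periodic1 F" unfolding periodic1_def by (metis eq_iff_diff_eq_0)
  then have "per_C1 F f" using F assms by (auto simp: per_C1_def)
  moreover have "F 0 = 0" by (simp add: F_def)
  ultimately show ?thesis using that by blast
qed

lemma DERIV_bound_Lipschitz:
  fixes F f :: "real \<Rightarrow> real"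
  assumes "\<And>x. (F has_real_derivative f x) (at x)" "\<And>x. \<bar>f x\<bar> \<le> b"
  shows "\<bar>F x - F y\<bar> \<le> b * \<bar>x - y\<bar>"
proof -
  have "norm (F x - F y) \<le> b * norm (x - y)"
    by (rule field_differentiable_bound[where S=UNIV and f'=f])
       (use assms in \<open>auto simp: has_field_derivative_at_within\<close>)
  then show ?thesis by simp
qed

section \<open>Trigonometric polynomials and the Fejer operator\<close>

definition smooth_per :: "(real \<Rightarrow> real) \<Rightarrow> bool" where
  "smooth_per \<phi> \<longleftrightarrow> periodic1 \<phi> \<and> (\<forall>k. class_C k \<phi>)"

lemma frechet_derivative_real:
  fixes f :: "real \<Rightarrow> real"
  assumes "(f has_real_derivative d) (at x)"
  shows "frechet_derivative f (at x) = (\<lambda>v. d * v)"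
  using assms frechet_derivative_at[of f "\<lambda>v. d * v" x] by (simp add: has_field_derivative_def)

lemma class_C_Suc_real:
  fixes f :: "real \<Rightarrow> real"
  assumes "class_C (Suc k) f"
  shows "(f has_real_derivative deriv f x) (at x)" "class_C k (deriv f)"
proof -
  have D: "(f has_real_derivative deriv f x) (at x)" for x
    using assms DERIV_deriv_iff_real_differentiable by (auto simp: differentiable_def)
  show "(f has_real_derivative deriv f x) (at x)" by (rule D)
  have "class_C k (\<lambda>x. frechet_derivative f (at x) 1)" using assms by auto
  then show "class_C k (deriv f)" using frechet_derivative_real[OF D] by simp
qed

lemma class_C_continuous: "class_C k f \<Longrightarrow> continuous_on UNIV f"
  by (cases k) (auto simp: differentiable_imp_continuous_on differentiable_on_def intro!: differentiable_imp_continuous_on)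

lemma smooth_per_per_C1: "smooth_per \<phi> \<Longrightarrow> per_C1 \<phi> (deriv \<phi>)"
  using class_C_Suc_real[of 0 \<phi>] class_C_Suc_real[of 1 \<phi>]
  by (auto simp: smooth_per_def per_C1_def simp del: class_C.simps intro: class_C_continuous)

lemma smooth_per_deriv: "smooth_per \<phi> \<Longrightarrow> smooth_per (deriv \<phi>)"
  unfolding smooth_per_def
  using class_C_Suc_real(2) per_C1D(5)[OF smooth_per_per_C1, unfolded smooth_per_def] by blast

definition freqs :: "nat \<Rightarrow> int set" where
  "freqs N = {k. \<bar>k\<bar> \<le> int N - 1}"

lemma finite_freqs [simp]: "finite (freqs N)"
proof -
  have "freqs N \<subseteq> {- int N..int N}" by (auto simp: freqs_def)
  then show ?thesis by (rule finite_subset) simp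
qed

definition trig :: "nat \<Rightarrow> (int \<Rightarrow> real) \<Rightarrow> (int \<Rightarrow> real) \<Rightarrow> real \<Rightarrow> real" where
  "trig N a b x = (\<Sum>k\<in>freqs N. a k * cos (2 * pi * of_int k * x) + b k * sin (2 * pi * of_int k * x))"

lemma cos_periodic1 [simp]: "cos (2 * pi * of_int k * (x + 1)) = cos (2 * pi * of_int k * x)"
  and sin_periodic1 [simp]: "sin (2 * pi * of_int k * (x + 1)) = sin (2 * pi * of_int k * x)"
proof -
  have "2 * pi * of_int k * (x + 1) = 2 * pi * of_int k * x + 2 * pi * of_int k"
    by (simp add: algebra_simps)
  then show "cos (2 * pi * of_int k * (x + 1)) = cos (2 * pi * of_int k * x)"
    "sin (2 * pi * of_int k * (x + 1)) = sin (2 * pi * of_int k * x)"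
    by (simp_all only: cos_add sin_add cos_int_2pin sin_int_2pin mult_1_right mult_zero_right diff_zero add_0_right)
qed

lemma periodic1_trig: "periodic1 (trig N a b)"
  by (simp add: periodic1_def trig_def)

lemma trig_DERIV:
  "(trig N a b has_real_derivative trig N (\<lambda>k. 2 * pi * of_int k * b k) (\<lambda>k. - (2 * pi * of_int k * a k)) x) (at x)"
  unfolding trig_def[abs_def]
  by (auto intro!: derivative_eq_intros sum.cong simp: algebra_simps)

lemma trig_cont: "continuous_on UNIV (trig N a b)"
  unfolding trig_def[abs_def] by (intro continuous_intros)

lemma trig_cmult: "trig N a b x * v = trig N (\<lambda>k. a k * v) (\<lambda>k. b k * v) x"
  unfolding trig_def sum_distrib_right by (intro sum.cong) (auto simp: algebra_simps)

lemma class_C_trig: "class_C k (trig N a b)"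
proof (induction k arbitrary: a b)
  case (Suc k)
  have "trig N a b differentiable at x" for x
    using trig_DERIV[of N a b x] by (auto simp: differentiable_def has_field_derivative_def)
  moreover have "class_C k (\<lambda>x. frechet_derivative (trig N a b) (at x) v)" for v
    unfolding frechet_derivative_real[OF trig_DERIV] trig_cmult using Suc .
  ultimately show ?case by simp
qed (simp add: trig_cont)

lemma smooth_per_trig: "smooth_per (trig N a b)"
  by (simp add: smooth_per_def periodic1_trig class_C_trig)

lemma per_C1_trig:
  "per_C1 (trig N a b) (trig N (\<lambda>k. 2 * pi * of_int k * b k) (\<lambda>k. - (2 * pi * of_int k * a k)))"
  by (simp add: per_C1_def periodic1_trig trig_cont trig_DERIV)

lemma trig_abs_le: "\<bar>trig N a b x\<bar> \<le> (\<Sum>k\<in>freqs N. \<bar>a k\<bar> + \<bar>b k\<bar>)"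
  unfolding trig_def
proof (rule order_trans[OF sum_abs sum_mono])
  fix k
  have "\<bar>a k * cos (2 * pi * of_int k * x)\<bar> \<le> \<bar>a k\<bar> * 1" "\<bar>b k * sin (2 * pi * of_int k * x)\<bar> \<le> \<bar>b k\<bar> * 1"
    unfolding abs_mult by (intro mult_left_mono; simp)+
  then show "\<bar>a k * cos (2 * pi * of_int k * x) + b k * sin (2 * pi * of_int k * x)\<bar> \<le> \<bar>a k\<bar> + \<bar>b k\<bar>"
    by linarith
qed

definition fcos :: "int \<Rightarrow> (real \<Rightarrow> real) \<Rightarrow> real" where
  "fcos k f = (\<integral>y. cos (2 * pi * of_int k * y) * f y \<partial>circ)"

definition fsin :: "int \<Rightarrow> (real \<Rightarrow> real) \<Rightarrow> real" where
  "fsin k f = (\<integral>y. sin (2 * pi * of_int k * y) * f y \<partial>circ)"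

lemma per_C1_cos: "per_C1 (\<lambda>y. cos (2 * pi * of_int k * y)) (\<lambda>y. - (2 * pi * of_int k) * sin (2 * pi * of_int k * y))"
  and per_C1_sin: "per_C1 (\<lambda>y. sin (2 * pi * of_int k * y)) (\<lambda>y. (2 * pi * of_int k) * cos (2 * pi * of_int k * y))"
  unfolding per_C1_def periodic1_def
  by (auto intro!: derivative_eq_intros continuous_intros)

lemma integrable_cos: "f \<in> L1 \<Longrightarrow> integrable circ (\<lambda>y. cos (2 * pi * of_int k * y) * f y)"
  and integrable_sin: "f \<in> L1 \<Longrightarrow> integrable circ (\<lambda>y. sin (2 * pi * of_int k * y) * f y)"
  by (rule L1D(2), rule L1_mult_cont, assumption, simp add: periodic1_def, intro continuous_intros)+

lemma abs_fcos_le: "f \<in> L1 \<Longrightarrow> \<bar>fcos k f\<bar> \<le> L1_norm f"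
  and abs_fsin_le: "f \<in> L1 \<Longrightarrow> \<bar>fsin k f\<bar> \<le> L1_norm f"
  unfolding fcos_def fsin_def
  using abs_integral_mult_le[of f "\<lambda>y. cos (2 * pi * of_int k * y)" 1]
        abs_integral_mult_le[of f "\<lambda>y. sin (2 * pi * of_int k * y)" 1]
        measurable_circ[OF per_C1D(6)[OF per_C1_cos[of k]]] measurable_circ[OF per_C1D(6)[OF per_C1_sin[of k]]]
  by auto

lemma fcos_1: "fcos k (\<lambda>_. 1) = (if k = 0 then 1 else 0)"
  and fsin_1: "fsin k (\<lambda>_. 1) = 0"
  using per_C1_integral_0[OF per_C1_cos[of k]] per_C1_integral_0[OF per_C1_sin[of k]]
  by (auto simp: fcos_def fsin_def)

definition fwt :: "nat \<Rightarrow> int \<Rightarrow> real" where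
  "fwt N k = 1 - of_int \<bar>k\<bar> / of_nat N"

abbreviation kern :: "nat \<Rightarrow> real \<Rightarrow> real" where
  "kern N x \<equiv> Re (fejer_kernel N x)"

lemma kern_eq: "kern N x = (\<Sum>k\<in>freqs N. fwt N k * cos (2 * pi * of_int k * x))"
proof -
  have "Re (e_char k x) = cos (2 * pi * of_int k * x)" for k
    unfolding e_char_def by (simp add: Re_exp)
  moreover have "Re (of_real c * z) = c * Re z" for c z by simp
  ultimately show ?thesis
    unfolding fejer_kernel_def freqs_def fwt_def Re_sum by (simp only:)
qed

lemma kern_trig: "kern N x = trig N (fwt N) (\<lambda>_. 0) x"
  by (simp add: kern_eq trig_def)

lemma fejer_proj_trig:
  assumes "f \<in> L1"
  shows "fejer_proj N f = trig N (\<lambda>k. fwt N k * fcos k f) (\<lambda>k. fwt N k * fsin k f)"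
proof
  fix x
  have "kern N (x - y) * f y = (\<Sum>k\<in>freqs N. fwt N k * cos (2 * pi * of_int k * x) * (cos (2 * pi * of_int k * y) * f y)
      + fwt N k * sin (2 * pi * of_int k * x) * (sin (2 * pi * of_int k * y) * f y))" for y
    unfolding kern_eq sum_distrib_right
    by (intro sum.cong) (auto simp: right_diff_distrib cos_diff algebra_simps)
  then have "fejer_proj N f x = (\<Sum>k\<in>freqs N. fwt N k * cos (2 * pi * of_int k * x) * fcos k f
      + fwt N k * sin (2 * pi * of_int k * x) * fsin k f)"
    unfolding fejer_proj_def fcos_def fsin_def
    using integrable_cos[OF assms] integrable_sin[OF assms]
    by (simp add: Bochner_Integration.integral_sum Bochner_Integration.integral_add)
  then show "fejer_proj N f x = trig N (\<lambda>k. fwt N k * fcos k f) (\<lambda>k. fwt N k * fsin k f) x"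
    by (simp add: trig_def mult_ac)
qed

lemma smooth_per_fejer: "f \<in> L1 \<Longrightarrow> smooth_per (fejer_proj N f)"
  by (simp add: fejer_proj_trig smooth_per_trig)

lemma fejer_cont: "f \<in> L1 \<Longrightarrow> continuous_on UNIV (fejer_proj N f)"
  by (simp add: fejer_proj_trig trig_cont)

lemma fejer_periodic: "f \<in> L1 \<Longrightarrow> periodic1 (fejer_proj N f)"
  by (simp add: fejer_proj_trig periodic1_trig)

lemma fejer_L1: "f \<in> L1 \<Longrightarrow> fejer_proj N f \<in> L1"
  by (auto intro: L1_cont fejer_periodic fejer_cont)

lemma fejer_inner:
  assumes "f \<in> L1" "h \<in> L1"
  shows "(\<integral>x. fejer_proj N f x * h x \<partial>circ) = (\<Sum>k\<in>freqs N. fwt N k * (fcos k f * fcos k h + fsin k f * fsin k h))"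
proof -
  have "fejer_proj N f x * h x = (\<Sum>k\<in>freqs N. fwt N k * fcos k f * (cos (2 * pi * of_int k * x) * h x)
      + fwt N k * fsin k f * (sin (2 * pi * of_int k * x) * h x))" for x
    unfolding fejer_proj_trig[OF assms(1)] trig_def sum_distrib_right
    by (intro sum.cong) (auto simp: algebra_simps)
  then have "(\<integral>x. fejer_proj N f x * h x \<partial>circ) = (\<Sum>k\<in>freqs N. fwt N k * fcos k f * fcos k h + fwt N k * fsin k f * fsin k h)"
    using integrable_cos[OF assms(2)] integrable_sin[OF assms(2)]
    by (simp add: Bochner_Integration.integral_sum Bochner_Integration.integral_add fcos_def[of _ h] fsin_def[of _ h])
  then show ?thesis by (simp add: distrib_left mult.assoc)
qed

text \<open>Expanding the kernel in characters makes the symmetry of the operator a symmetry of a finite sum.\<close>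

lemma fejer_selfadjoint:
  assumes "f \<in> L1" "h \<in> L1"
  shows "(\<integral>x. fejer_proj N f x * h x \<partial>circ) = (\<integral>x. f x * fejer_proj N h x \<partial>circ)"
  using fejer_inner[OF assms] fejer_inner[OF assms(2,1)] by (simp add: mult_ac)

lemma fejer_one:
  assumes "N \<ge> 1"
  shows "fejer_proj N (\<lambda>_. 1) = (\<lambda>_. 1)"
proof
  fix x
  have "0 \<in> freqs N" using assms by (simp add: freqs_def)
  have "fejer_proj N (\<lambda>_. 1) x = (\<Sum>k\<in>freqs N. if k = 0 then 1 else 0)"
    unfolding fejer_proj_trig[OF L1_const] trig_def fcos_1 fsin_1
    by (intro sum.cong) (auto simp: fwt_def)
  then show "fejer_proj N (\<lambda>_. 1) x = 1"
    using \<open>0 \<in> freqs N\<close> by simp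
qed

lemma fejer_integral:
  assumes "N \<ge> 1" "f \<in> L1"
  shows "(\<integral>x. fejer_proj N f x \<partial>circ) = (\<integral>x. f x \<partial>circ)"
  using fejer_selfadjoint[OF assms(2), of "\<lambda>_. 1" N] fejer_one[OF assms(1)] by simp

subsection \<open>The Fejer kernel as an approximate identity\<close>

lemma freqs_Suc: "freqs (Suc (Suc N)) = insert (int N + 1) (insert (- (int N + 1)) (freqs (Suc N)))"
  by (auto simp: freqs_def)

lemma dirichlet_sum: "(\<Sum>k\<in>freqs (Suc N). cos (2 * of_int k * a)) * sin a = sin ((2 * of_nat N + 1) * (a::real))"
proof (induction N)
  case 0
  have "freqs (Suc 0) = {0}" by (auto simp: freqs_def)
  then show ?case by simp
next
  case (Suc N)
  let ?M = "real N + 1"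
  have "(\<Sum>k\<in>freqs (Suc (Suc N)). cos (2 * of_int k * a))
      = 2 * cos (2 * ?M * a) + (\<Sum>k\<in>freqs (Suc N). cos (2 * of_int k * a))"
  proof -
    have 1: "int N + 1 \<notin> insert (- (int N + 1)) (freqs (Suc N))" "- (int N + 1) \<notin> freqs (Suc N)"
      by (auto simp: freqs_def)
    have 2: "cos (2 * of_int (int N + 1) * a) = cos (2 * ?M * a)" "cos (2 * of_int (- (int N + 1)) * a) = cos (2 * ?M * a)"
      using cos_minus[of "2 * ?M * a"] by (simp_all add: algebra_simps)
    show ?thesis
      unfolding freqs_Suc sum.insert[OF finite.insertI[OF finite_freqs] 1(1)] sum.insert[OF finite_freqs 1(2)] 2
      by simp
  qed
  then have "(\<Sum>k\<in>freqs (Suc (Suc N)). cos (2 * of_int k * a)) * sin a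
      = 2 * cos (2 * ?M * a) * sin a + sin ((2 * of_nat N + 1) * a)"
    using Suc by (simp add: algebra_simps)
  also have "2 * cos (2 * ?M * a) * sin a = sin (2 * ?M * a + a) - sin (2 * ?M * a - a)"
    by (simp add: sin_add sin_diff)
  finally show ?case by (simp add: algebra_simps)
qed

text \<open>The closed form of the Fejer kernel, free of denominators; it yields both nonnegativity and the
  \<open>sin\<^sup>2\<close>-moment of the kernel.\<close>

lemma fejer_sum: "(\<Sum>k\<in>freqs N. (of_nat N - of_int \<bar>k\<bar>) * cos (2 * of_int k * a)) * (sin a)\<^sup>2 = (sin (of_nat N * (a::real)))\<^sup>2"
proof (induction N)
  case 0
  have "freqs 0 = {}" by (auto simp: freqs_def)
  then show ?case by simp
next
  case (Suc N)
  have sub: "freqs N \<subseteq> freqs (Suc N)" by (auto simp: freqs_def)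
  have "(\<Sum>k\<in>freqs (Suc N). (of_nat (Suc N) - of_int \<bar>k\<bar>) * cos (2 * of_int k * a))
      = (\<Sum>k\<in>freqs (Suc N). (of_nat N - of_int \<bar>k\<bar>) * cos (2 * of_int k * a)) + (\<Sum>k\<in>freqs (Suc N). cos (2 * of_int k * a))"
    unfolding sum.distrib[symmetric] by (intro sum.cong) (auto simp: algebra_simps)
  also have "(\<Sum>k\<in>freqs (Suc N). (of_nat N - of_int \<bar>k\<bar>) * cos (2 * of_int k * a))
      = (\<Sum>k\<in>freqs N. (of_nat N - of_int \<bar>k\<bar>) * cos (2 * of_int k * a))"
    by (rule sum.mono_neutral_right[OF finite_freqs sub]) (auto simp: freqs_def)
  finally have "(\<Sum>k\<in>freqs (Suc N). (of_nat (Suc N) - of_int \<bar>k\<bar>) * cos (2 * of_int k * a)) * (sin a)\<^sup>2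
     = (sin (of_nat N * a))\<^sup>2 + sin ((2 * of_nat N + 1) * a) * sin a"
    using Suc dirichlet_sum[where N=N and a=a] by (simp add: algebra_simps power2_eq_square)
  also have "sin ((2 * of_nat N + 1) * a) * sin a = (sin (of_nat (Suc N) * a))\<^sup>2 - (sin (of_nat N * a))\<^sup>2"
  proof -
    have *: "(2 * of_nat N + 1) * a = of_nat N * a + (of_nat N * a + a)" "of_nat (Suc N) * a = of_nat N * a + a"
      by (simp_all add: algebra_simps)
    have s: "(cos y)\<^sup>2 = 1 - (sin y)\<^sup>2" for y :: real by (simp add: cos_squared_eq)
    show ?thesis unfolding * sin_add cos_add
      using s[of a] s[of "of_nat N * a"] by algebra
  qed
  finally show ?case by simp
qed

lemma kern_sin2:
  assumes "N \<ge> 1"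
  shows "kern N t * (sin (pi * t))\<^sup>2 = (sin (of_nat N * (pi * t)))\<^sup>2 / N"
proof -
  have "N * kern N t = (\<Sum>k\<in>freqs N. (of_nat N - of_int \<bar>k\<bar>) * cos (2 * of_int k * (pi * t)))"
    unfolding kern_eq sum_distrib_left using assms
    by (intro sum.cong) (auto simp: fwt_def field_simps)
  then have "N * kern N t * (sin (pi * t))\<^sup>2 = (sin (of_nat N * (pi * t)))\<^sup>2"
    using fejer_sum[where N=N and a="pi * t"] by simp
  then show ?thesis using assms by (simp add: field_simps)
qed

lemma kern_nonneg:
  assumes "N \<ge> 1"
  shows "kern N t \<ge> 0"
proof (cases "sin (pi * t) = 0")
  case True
  then obtain i :: int where "t = of_int i" by (auto simp: sin_zero_iff_int2)
  then have "cos (2 * pi * of_int k * t) = 1" for k :: int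
    using cos_int_2pin[of "k * i"] by (simp add: mult_ac)
  moreover have "fwt N k \<ge> 0" if "k \<in> freqs N" for k
    using that assms by (auto simp: fwt_def freqs_def field_simps)
  ultimately show ?thesis by (simp add: kern_eq sum_nonneg)
next
  case False
  have "kern N t * (sin (pi * t))\<^sup>2 \<ge> 0" using kern_sin2[OF assms, of t] by simp
  then show ?thesis using False by (simp add: zero_le_mult_iff)
qed

lemma kern_sin2_le:
  assumes "N \<ge> 1"
  shows "kern N t * (sin (pi * t))\<^sup>2 \<le> 1 / N"
  unfolding kern_sin2[OF assms]
  by (intro divide_right_mono) (auto simp: abs_square_le_1)

lemma kern_shift_props:
  shows "periodic1 (\<lambda>y. kern N (x - y))" "continuous_on UNIV (\<lambda>y. kern N (x - y))"
    "(\<lambda>y. kern N (x - y)) \<in> borel_measurable circ" "integrable circ (\<lambda>y. kern N (x - y))"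
proof -
  show 1: "periodic1 (\<lambda>y. kern N (x - y))"
    unfolding kern_trig periodic1_def
  proof
    fix y show "trig N (fwt N) (\<lambda>_. 0) (x - (y + 1)) = trig N (fwt N) (\<lambda>_. 0) (x - y)"
      using periodic1_of_int[OF periodic1_trig, of N "fwt N" "\<lambda>_. 0" "x - y" "-1"] by (simp add: algebra_simps)
  qed
  show 2: "continuous_on UNIV (\<lambda>y. kern N (x - y))"
    unfolding kern_eq by (intro continuous_intros)
  show "(\<lambda>y. kern N (x - y)) \<in> borel_measurable circ" "integrable circ (\<lambda>y. kern N (x - y))"
    using L1_cont[OF 1 2] by (auto simp: L1D)
qed

lemma integrable_kern: "f \<in> L1 \<Longrightarrow> integrable circ (\<lambda>y. kern N (x - y) * f y)"
  by (rule L1D(2), rule L1_mult_cont[OF _ kern_shift_props(1,2)])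

lemma integral_kern: "N \<ge> 1 \<Longrightarrow> (\<integral>y. kern N (x - y) \<partial>circ) = 1"
  using fejer_one[of N] by (simp add: fejer_proj_def fun_eq_iff)

lemma fejer_nonneg:
  assumes "N \<ge> 1" "AE x in circ. 0 \<le> f x"
  shows "fejer_proj N f x \<ge> 0"
  unfolding fejer_proj_def
  by (rule integral_nonneg_AE) (use assms(2) kern_nonneg[OF assms(1)] in \<open>auto\<close>)

lemma fejer_diff:
  assumes "f \<in> L1" "h \<in> L1"
  shows "fejer_proj N (\<lambda>x. f x - h x) x = fejer_proj N f x - fejer_proj N h x"
  unfolding fejer_proj_def using integrable_kern[OF assms(1), of N x] integrable_kern[OF assms(2), of N x]
  by (simp add: right_diff_distrib)

lemma fejer_cong_AE:
  assumes "f \<in> L1" "h \<in> L1" "AE x in circ. f x = h x"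
  shows "fejer_proj N f = fejer_proj N h"
  unfolding fejer_proj_def
  by (rule ext, rule integral_mult_cong_AE[OF assms kern_shift_props(3)])

lemma fejer_const: "N \<ge> 1 \<Longrightarrow> fejer_proj N (\<lambda>_. c) x = c"
  unfolding fejer_proj_def using integral_kern by simp

lemma fejer_abs_le:
  assumes "N \<ge> 1" "f \<in> L1" "\<And>x. \<bar>f x\<bar> \<le> b"
  shows "\<bar>fejer_proj N f x\<bar> \<le> b"
proof -
  have "\<bar>fejer_proj N f x\<bar> \<le> (\<integral>y. \<bar>kern N (x - y) * f y\<bar> \<partial>circ)"
    unfolding fejer_proj_def by (rule integral_abs_bound)
  also have "\<dots> \<le> (\<integral>y. kern N (x - y) * b \<partial>circ)"
    using integrable_abs[OF integrable_kern[OF assms(2), of N x]] kern_shift_props(4) kern_nonneg[OF assms(1)] assms(3)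
    by (intro integral_mono) (auto simp: abs_mult intro!: mult_left_mono)
  finally show ?thesis using integral_kern[OF assms(1)] by simp
qed

lemma fejer_L1_norm_le:
  assumes "N \<ge> 1" "f \<in> L1"
  shows "L1_norm (fejer_proj N f) \<le> L1_norm f"
proof -
  have "\<bar>fejer_proj N f x\<bar> \<le> fejer_proj N (\<lambda>y. \<bar>f y\<bar>) x" for x
    unfolding fejer_proj_def
    using integral_abs_bound[of circ "\<lambda>y. kern N (x - y) * f y"] kern_nonneg[OF assms(1)]
    by (simp add: abs_mult)
  then have "L1_norm (fejer_proj N f) \<le> (\<integral>x. fejer_proj N (\<lambda>y. \<bar>f y\<bar>) x \<partial>circ)"
    unfolding L1_norm_def using fejer_L1[OF assms(2), of N] fejer_L1[OF L1_abs[OF assms(2)], of N]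
    by (intro integral_mono) (auto simp: L1D)
  also have "\<dots> = L1_norm f"
    using fejer_integral[OF assms(1) L1_abs[OF assms(2)]] by (simp add: L1_norm_def)
  finally show ?thesis .
qed

text \<open>Korovkin's argument: the kernel is nonnegative, has mass one and \<open>sin\<^sup>2\<close>-moment at most \<open>1/N\<close>,
  and oscillation that is not below \<open>e\<close> is paid for by the \<open>sin\<^sup>2\<close> term.\<close>

lemma fejer_approx:
  assumes "N \<ge> 1" "f \<in> L1" "A \<ge> 0" "\<And>y. \<bar>f y - f x\<bar> \<le> e + A * (sin (pi * (x - y)))\<^sup>2"
  shows "\<bar>fejer_proj N f x - f x\<bar> \<le> e + A / N"
proof -
  let ?k = "\<lambda>y. kern N (x - y)"
  have L: "(\<lambda>y. f y - f x) \<in> L1" using assms(2) by (intro L1_diff) auto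
  have "fejer_proj N f x - f x = (\<integral>y. ?k y * (f y - f x) \<partial>circ)"
    using fejer_diff[OF assms(2) L1_const[of "f x"]] fejer_const[OF assms(1)]
    by (simp add: fejer_proj_def)
  also have "\<bar>\<dots>\<bar> \<le> (\<integral>y. \<bar>?k y * (f y - f x)\<bar> \<partial>circ)" by (rule integral_abs_bound)
  also have "\<dots> \<le> (\<integral>y. ?k y * e + A / N \<partial>circ)"
  proof (rule integral_mono)
    show "integrable circ (\<lambda>y. \<bar>?k y * (f y - f x)\<bar>)" using integrable_kern[OF L] by simp
    show "integrable circ (\<lambda>y. ?k y * e + A / N)" using kern_shift_props(4) by simp
    fix y
    have "\<bar>?k y * (f y - f x)\<bar> \<le> ?k y * (e + A * (sin (pi * (x - y)))\<^sup>2)"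
      using kern_nonneg[OF assms(1)] assms(4) by (auto simp: abs_mult intro!: mult_left_mono)
    also have "\<dots> = ?k y * e + A * (?k y * (sin (pi * (x - y)))\<^sup>2)" by (simp add: algebra_simps)
    also have "\<dots> \<le> ?k y * e + A * (1 / N)"
      using kern_sin2_le[OF assms(1)] assms(3) by (intro add_left_mono mult_left_mono) auto
    finally show "\<bar>?k y * (f y - f x)\<bar> \<le> ?k y * e + A / N" by simp
  qed
  also have "\<dots> = e + A / N" using integral_kern[OF assms(1)] kern_shift_props(4) by simp
  finally show ?thesis .
qed

lemma sin_pi_ge:
  assumes "\<bar>r\<bar> \<le> 1/2"
  shows "2 * \<bar>r\<bar> \<le> \<bar>sin (pi * r)\<bar>"
proof -
  have main: "2 * t \<le> sin (pi * t)" if t: "0 \<le> t" "t \<le> 1/2" for t :: real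
  proof (rule ccontr)
    assume "\<not> ?thesis"
    then have neg: "sin (pi * t) - 2 * t < 0" by simp
    define \<psi> where "\<psi> = (\<lambda>t. sin (pi * t) - 2 * t)"
    have D: "(\<psi> has_real_derivative (pi * cos (pi * s) - 2)) (at s)" for s
      unfolding \<psi>_def by (auto intro!: derivative_eq_intros)
    have t0: "0 < t" "t < 1/2" using neg t by (cases "t = 0"; cases "t = 1/2"; force)+
    obtain z1 where z1: "0 < z1" "z1 < t" "\<psi> t - \<psi> 0 = (t - 0) * (pi * cos (pi * z1) - 2)"
      using MVT2[of 0 t \<psi> "\<lambda>s. pi * cos (pi * s) - 2"] D t0 by auto
    obtain z2 where z2: "t < z2" "z2 < 1/2" "\<psi> (1/2) - \<psi> t = (1/2 - t) * (pi * cos (pi * z2) - 2)"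
      using MVT2[of t "1/2" \<psi> "\<lambda>s. pi * cos (pi * s) - 2"] D t0 by auto
    have "pi * cos (pi * z1) - 2 < 0" using z1(3) neg t0 by (auto simp: \<psi>_def mult_less_0_iff)
    moreover have "pi * cos (pi * z2) - 2 > 0"
    proof -
      have "(1/2 - t) * (pi * cos (pi * z2) - 2) > 0" using z2(3) neg by (simp add: \<psi>_def)
      then show ?thesis using t0 by (simp add: zero_less_mult_iff)
    qed
    moreover have "cos (pi * z2) \<le> cos (pi * z1)"
      using z1 z2 t0 by (intro cos_monotone_0_pi_le) (auto intro!: mult_left_mono simp: mult_le_cancel_left1)
    moreover have "pi * cos (pi * z2) \<le> pi * cos (pi * z1)"
      using \<open>cos (pi * z2) \<le> cos (pi * z1)\<close> by (rule mult_left_mono) simp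
    ultimately show False by linarith
  qed
  show ?thesis
  proof (cases "r \<ge> 0")
    case True then show ?thesis using main[of r] assms by auto
  next
    case False then show ?thesis using main[of "-r"] assms by auto
  qed
qed

lemma abs_sin_pi_shift: "\<bar>sin (pi * (x + of_int k))\<bar> = \<bar>sin (pi * x)\<bar>"
proof -
  have "cos (2 * (pi * (x + of_int k))) = cos (2 * (pi * x))"
    using periodic1_of_int[of "\<lambda>x. cos (2 * pi * of_int 1 * x)" x k] cos_periodic1[of 1]
    by (simp add: periodic1_def mult.assoc)
  then have "(sin (pi * (x + of_int k)))\<^sup>2 = (sin (pi * x))\<^sup>2" by (simp add: cos_double_sin)
  then show ?thesis by (simp add: power2_eq_iff abs_eq_iff)
qed

lemma half_shift:
  obtains k :: int where "\<bar>x - y - of_int k\<bar> \<le> (1/2::real)"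
  using of_int_round_abs_le[of "x - y"] by (metis abs_minus_commute)

lemma periodic_Lipschitz_sin:
  assumes "periodic1 F" "\<And>x y. \<bar>F x - F y\<bar> \<le> b * \<bar>x - y\<bar>" "b \<ge> 0"
  shows "\<bar>F y - F x\<bar> \<le> b / 2 * \<bar>sin (pi * (x - y))\<bar>"
proof -
  obtain k :: int where k: "\<bar>x - y - of_int k\<bar> \<le> 1/2" by (rule half_shift)
  let ?r = "x - y - of_int k"
  have "\<bar>F y - F x\<bar> = \<bar>F x - F (y + of_int k)\<bar>" using periodic1_of_int[OF assms(1)] by simp
  also have "\<dots> \<le> b * \<bar>?r\<bar>" using assms(2)[of x "y + of_int k"] by (simp add: algebra_simps)
  also have "\<dots> \<le> b * (\<bar>sin (pi * ?r)\<bar> / 2)"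
    using sin_pi_ge[OF k] assms(3) by (intro mult_left_mono) auto
  also have "\<bar>sin (pi * ?r)\<bar> = \<bar>sin (pi * (x - y))\<bar>" using abs_sin_pi_shift[of ?r k] by simp
  finally show ?thesis by simp
qed

text \<open>Since its \<open>sin\<^sup>2\<close>-moment is at most \<open>1/N\<close>, the kernel has first moment of order
  \<open>N\<^sup>-\<^sup>1\<^sup>/\<^sup>2\<close>: Cauchy-Schwarz, used here as the arithmetic-geometric mean inequality.\<close>

lemma fejer_Lipschitz:
  assumes "N \<ge> 1" "periodic1 F" "\<And>x y. \<bar>F x - F y\<bar> \<le> b * \<bar>x - y\<bar>" "b \<ge> 0" "F \<in> L1"
  shows "\<bar>fejer_proj N F x - F x\<bar> \<le> b / (2 * sqrt N)"
proof -
  let ?A = "b * sqrt N / 4"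
  have N: "sqrt N > 0" using assms(1) by simp
  have NN: "real N = sqrt N * sqrt N" by simp
  have "\<bar>F y - F x\<bar> \<le> b / (4 * sqrt N) + ?A * (sin (pi * (x - y)))\<^sup>2" for y
  proof -
    let ?s = "\<bar>sin (pi * (x - y))\<bar>"
    have "1 / (2 * r) + r * s\<^sup>2 / 2 - s = (1 - r * s)\<^sup>2 / (2 * r)" if "r > 0" for r s :: real
      using that by (simp add: field_simps power2_eq_square)
    from this[OF N, of ?s] have "?s \<le> 1 / (2 * sqrt N) + sqrt N * ?s\<^sup>2 / 2"
      using N by (smt (verit) zero_le_divide_iff zero_le_power2)
    then have "b / 2 * ?s \<le> b / 2 * (1 / (2 * sqrt N) + sqrt N * ?s\<^sup>2 / 2)"
      using assms(4) by (intro mult_left_mono) auto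
    then show ?thesis
      using periodic_Lipschitz_sin[OF assms(2,3,4), of y x] by (simp add: distrib_left)
  qed
  from fejer_approx[OF assms(1,5) _ this] have "\<bar>fejer_proj N F x - F x\<bar> \<le> b / (4 * sqrt N) + ?A / N"
    using assms(4) by simp
  also have "?A / N = b / (4 * sqrt N)"
  proof -
    have "b * r / 4 / (r * r) = b / (4 * r)" if "r > 0" for r :: real using that by (simp add: field_simps)
    from this[OF N] show ?thesis by simp
  qed
  finally show ?thesis by (simp add: field_simps)
qed

text \<open>Uniform continuity supplies the \<open>e\<close> for nearby points; all other pairs of points have
  \<open>sin\<^sup>2\<close> bounded below.\<close>

lemma fejer_uniform:
  assumes "periodic1 f" "continuous_on UNIV f" "e > 0"
  obtains N0 where "N0 \<ge> 1" "\<And>N x. N \<ge> N0 \<Longrightarrow> \<bar>fejer_proj N f x - f x\<bar> \<le> e"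
proof -
  obtain b where b: "b \<ge> 0" "\<And>x. \<bar>f x\<bar> \<le> b" using periodic1_cont_bounded[OF assms(1,2)] by blast
  have "uniformly_continuous_on {-1..2} f"
    by (rule compact_uniformly_continuous) (use assms(2) continuous_on_subset in auto)
  then obtain d where d: "d > 0" "\<And>x y. x \<in> {-1..2} \<Longrightarrow> y \<in> {-1..2} \<Longrightarrow> \<bar>y - x\<bar> < d \<Longrightarrow> \<bar>f y - f x\<bar> < e/2"
    unfolding uniformly_continuous_on_def dist_real_def using assms(3) by (metis half_gt_zero)
  define A where "A = 2 * b / (4 * d\<^sup>2)"
  have A: "A \<ge> 0" using b d by (simp add: A_def)
  have key: "\<bar>f y - f x\<bar> \<le> e/2 + A * (sin (pi * (x - y)))\<^sup>2" for x y
  proof -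
    obtain k :: int where k: "\<bar>x - y - of_int k\<bar> \<le> 1/2" by (rule half_shift)
    let ?r = "x - y - of_int k"
    have s: "\<bar>sin (pi * ?r)\<bar> = \<bar>sin (pi * (x - y))\<bar>" using abs_sin_pi_shift[of ?r k] by simp
    show ?thesis
    proof (cases "\<bar>?r\<bar> < d")
      case True
      let ?x = "frac x" and ?y = "frac x - ?r"
      have "f ?y = f y"
        using periodic1_of_int[OF assms(1), of y "k - \<lfloor>x\<rfloor>"] by (simp add: frac_def algebra_simps)
      moreover have "f ?x = f x" by (rule periodic1_frac[OF assms(1)])
      moreover have "?x \<in> {-1..2}" "?y \<in> {-1..2}" using k frac_lt_1[of x] frac_ge_0[of x]
        unfolding abs_le_iff atLeastAtMost_iff by linarith+
      ultimately have "\<bar>f y - f x\<bar> < e/2" using d(2)[of ?x ?y] True by (simp add: abs_minus_commute)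
      then show ?thesis using A by (simp add: add_increasing2 less_imp_le)
    next
      case False
      have "2 * d \<le> \<bar>sin (pi * (x - y))\<bar>" using sin_pi_ge[OF k] False s by simp
      then have "(2 * d)\<^sup>2 \<le> \<bar>sin (pi * (x - y))\<bar>\<^sup>2" using d by (intro power_mono) auto
      then have "A * (4 * d\<^sup>2) \<le> A * (sin (pi * (x - y)))\<^sup>2"
        using A by (intro mult_left_mono) (auto simp: power_mult_distrib)
      moreover have "A * (4 * d\<^sup>2) = 2 * b" using d by (simp add: A_def)
      moreover have "\<bar>f y - f x\<bar> \<le> 2 * b" using b(2)[of x] b(2)[of y] by linarith
      ultimately show ?thesis using assms(3) by linarith
    qed
  qed
  obtain N0 :: nat where N0: "N0 \<ge> 1" "A / N0 \<le> e/2"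
  proof -
    obtain m :: nat where m: "2 * A / e < m" using reals_Archimedean2 by blast
    have "0 \<le> 2 * A / e" using A assms(3) by simp
    then have "m \<ge> 1" using m by (cases m) auto
    moreover have "A / real m \<le> e / 2"
      using m assms(3) \<open>m \<ge> 1\<close> by (simp add: field_simps)
    ultimately show ?thesis using that[of m] by simp
  qed
  show ?thesis
  proof (rule that[OF N0(1)])
    fix N x assume N: "N \<ge> N0"
    have "\<bar>fejer_proj N f x - f x\<bar> \<le> e/2 + A / N"
      by (rule fejer_approx[OF _ _ A key]) (use N N0(1) L1_cont[OF assms(1,2)] in auto)
    also have "A / N \<le> A / N0" using N N0(1) A by (intro divide_left_mono) auto
    finally show "\<bar>fejer_proj N f x - f x\<bar> \<le> e" using N0(2) by linarith
  qed
qed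

lemma smooth_per_cos: "smooth_per (\<lambda>y. cos (2 * pi * of_int k * y))"
  and smooth_per_sin: "smooth_per (\<lambda>y. sin (2 * pi * of_int k * y))"
proof -
  let ?d = "\<lambda>j. if j = k then 1 else (0::real)"
  have "k \<in> freqs (nat \<bar>k\<bar> + 1)" by (auto simp: freqs_def)
  then have "trig (nat \<bar>k\<bar> + 1) ?d (\<lambda>_. 0) = (\<lambda>y. cos (2 * pi * of_int k * y))"
    "trig (nat \<bar>k\<bar> + 1) (\<lambda>_. 0) ?d = (\<lambda>y. sin (2 * pi * of_int k * y))"
    by (auto simp: trig_def fun_eq_iff if_distrib[of "\<lambda>c. c * _"] cong: if_cong)
  then show "smooth_per (\<lambda>y. cos (2 * pi * of_int k * y))" "smooth_per (\<lambda>y. sin (2 * pi * of_int k * y))"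
    using smooth_per_trig by metis+
qed

lemma per_C1_deriv: "per_C1 f f' \<Longrightarrow> deriv f = f'"
  using per_C1D(2) by (blast intro: DERIV_imp_deriv)

text \<open>The operator commutes with differentiation; the weak derivative is tested against characters.\<close>

lemma fejer_weak_deriv:
  assumes "f \<in> L1" "is_weak_deriv 1 f u"
  shows "per_C1 (fejer_proj N f) (fejer_proj N u)"
proof -
  have u: "u \<in> L1" and W: "smooth_per \<phi> \<Longrightarrow> (\<integral>x. f x * deriv \<phi> x \<partial>circ) = - (\<integral>x. u x * \<phi> x \<partial>circ)" for \<phi>
    using assms(2) by (auto simp: is_weak_deriv_def smooth_per_def)
  have c: "fcos k u = 2 * pi * of_int k * fsin k f" for k
  proof -
    have "fcos k u = - (\<integral>x. f x * (- (2 * pi * of_int k) * sin (2 * pi * of_int k * x)) \<partial>circ)"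
      using W[OF smooth_per_cos[of k]] unfolding per_C1_deriv[OF per_C1_cos] by (simp add: fcos_def mult.commute)
    also have "\<dots> = - (\<integral>x. - (2 * pi * of_int k) * (sin (2 * pi * of_int k * x) * f x) \<partial>circ)"
      by (simp add: mult_ac)
    finally show ?thesis by (simp add: fsin_def)
  qed
  have s: "fsin k u = - (2 * pi * of_int k * fcos k f)" for k
  proof -
    have "fsin k u = - (\<integral>x. f x * ((2 * pi * of_int k) * cos (2 * pi * of_int k * x)) \<partial>circ)"
      using W[OF smooth_per_sin[of k]] unfolding per_C1_deriv[OF per_C1_sin] by (simp add: fsin_def mult.commute)
    also have "\<dots> = - (\<integral>x. (2 * pi * of_int k) * (cos (2 * pi * of_int k * x) * f x) \<partial>circ)"
      by (simp add: mult_ac)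
    finally show ?thesis by (simp add: fcos_def)
  qed
  show ?thesis
    using per_C1_trig[of N "\<lambda>k. fwt N k * fcos k f" "\<lambda>k. fwt N k * fsin k f"]
    unfolding fejer_proj_trig[OF assms(1)] fejer_proj_trig[OF u] c s
    by (simp add: mult_ac)
qed

section \<open>Duality with smooth test functions\<close>

text \<open>A measurable function is an a.e. limit of continuous ones.  Truncating these to \<open>[-1, 1]\<close> keeps the bound,
  damping them near the integers makes them continuous and periodic, and their Fejer means, which
  obey the same bound, make them smooth.\<close>

lemma smooth_approx_measurable:
  fixes \<phi> :: "real \<Rightarrow> real"
  assumes "\<phi> \<in> borel_measurable borel" "\<And>x. \<bar>\<phi> x\<bar> \<le> 1"
  obtains \<psi> :: "nat \<Rightarrow> real \<Rightarrow> real"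
  where "\<And>n. smooth_per (\<psi> n)" "\<And>n x. \<bar>\<psi> n x\<bar> \<le> 1" "AE x in circ. (\<lambda>n. \<psi> n x) \<longlonglongrightarrow> \<phi> x"
proof -
  have "\<phi> \<in> borel_measurable (lebesgue_on UNIV)"
    using assms(1) by (simp add: borel_measurable_if_D measurable_completion)
  then have "\<phi> measurable_on UNIV" by (simp add: measurable_on_iff_borel_measurable)
  then obtain Z g where Z: "negligible Z" and g: "\<And>n::nat. continuous_on UNIV (g n)"
    and lim: "\<And>x. x \<notin> Z \<Longrightarrow> (\<lambda>n. g n x) \<longlonglongrightarrow> \<phi> x"
    by (auto simp: measurable_on_def)
  define c :: "nat \<Rightarrow> real \<Rightarrow> real" where "c n x = max (-1) (min 1 (g n x))" for n x
  \<comment> \<open>The damping factor vanishes at the integers, where \<open>frac\<close> jumps, and is eventually one elsewhere.\<close>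
  define H where "H n x = min 1 (real n * \<bar>sin (pi * x)\<bar>) * c n (frac x)" for n x
  have c_le: "\<bar>c n x\<bar> \<le> 1" for n x by (auto simp: c_def)
  have c_cont: "isCont (c n) x" for n x
    using g[of n] unfolding c_def
    by (intro continuous_intros) (auto simp: continuous_on_eq_continuous_at)
  have H_le: "\<bar>H n x\<bar> \<le> real n * \<bar>sin (pi * x)\<bar>" "\<bar>H n x\<bar> \<le> 1" for n x
  proof -
    have m: "0 \<le> min 1 (real n * \<bar>sin (pi * x)\<bar>)" by simp
    have "\<bar>H n x\<bar> \<le> min 1 (real n * \<bar>sin (pi * x)\<bar>) * 1"
      unfolding H_def abs_mult using c_le m by (intro mult_mono) auto
    then show "\<bar>H n x\<bar> \<le> real n * \<bar>sin (pi * x)\<bar>" "\<bar>H n x\<bar> \<le> 1" by auto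
  qed
  have H_per: "periodic1 (H n)" for n
    unfolding periodic1_def H_def
    using abs_sin_pi_shift[of _ 1] by (simp add: frac_def)
  have H_cont: "continuous_on UNIV (H n)" for n
    unfolding continuous_on_eq_continuous_at[OF open_UNIV]
  proof
    fix x :: real
    show "isCont (H n) x"
    proof (cases "x \<in> \<int>")
      case False
      have "isCont (\<lambda>x. c n (frac x)) x"
        using continuous_frac[OF False] c_cont by (rule isCont_o2)
      then show ?thesis unfolding H_def by (intro continuous_intros)
    next
      case True
      then have s: "sin (pi * x) = 0" by (auto simp: Ints_def sin_zero_iff_int2)
      then have "H n x = 0" using H_le(1)[of n x] by simp
      moreover have "(H n \<longlongrightarrow> 0) (at x)"
      proof (rule Lim_null_comparison)
        show "\<forall>\<^sub>F y in at x. norm (H n y) \<le> real n * \<bar>sin (pi * y)\<bar>" using H_le(1) by simp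
        have "((\<lambda>y. real n * \<bar>sin (pi * y)\<bar>) \<longlongrightarrow> real n * \<bar>sin (pi * x)\<bar>) (at x)"
          by (intro tendsto_intros)
        then show "((\<lambda>y. real n * \<bar>sin (pi * y)\<bar>) \<longlongrightarrow> 0) (at x)" using s by simp
      qed
      ultimately show ?thesis by (simp add: isCont_def)
    qed
  qed
  have "\<exists>N\<ge>1. \<forall>x. \<bar>fejer_proj N (H n) x - H n x\<bar> \<le> inverse (Suc n)" for n
    by (rule fejer_uniform[OF H_per H_cont, of "inverse (Suc n)"]) auto
  then obtain N where N: "\<And>n. N n \<ge> 1" "\<And>n x. \<bar>fejer_proj (N n) (H n) x - H n x\<bar> \<le> inverse (Suc n)"
    by metis
  define \<psi> where "\<psi> n = fejer_proj (N n) (H n)" for n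
  have HL: "H n \<in> L1" for n using H_per H_cont by (rule L1_cont)
  show ?thesis
  proof
    show "smooth_per (\<psi> n)" for n unfolding \<psi>_def using HL by (rule smooth_per_fejer)
    show "\<bar>\<psi> n x\<bar> \<le> 1" for n x
      unfolding \<psi>_def by (rule fejer_abs_le[OF N(1) HL H_le(2)])
    have "AE x in lebesgue. x \<notin> Z" using Z by (simp add: AE_not_in negligible_iff_null_sets)
    then have Zae: "AE x in lborel. x \<notin> Z" by (rule AE_completion_iff[THEN iffD1])
    have "AE x in lborel. x \<noteq> (0::real)" by (rule AE_lborel_singleton)
    with Zae show "AE x in circ. (\<lambda>n. \<psi> n x) \<longlonglongrightarrow> \<phi> x"
      unfolding AE_circ
    proof (eventually_elim, intro impI)
      fix x :: real assume x: "x \<notin> Z" "x \<noteq> 0" "x \<in> {0..<1}"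
      have fr: "frac x = x" using x by (simp add: frac_eq)
      have "(\<lambda>n. c n x) \<longlonglongrightarrow> max (-1) (min 1 (\<phi> x))"
        unfolding c_def by (intro tendsto_intros lim x)
      moreover have "max (-1) (min 1 (\<phi> x)) = \<phi> x" using assms(2)[of x] by (auto simp: abs_le_iff)
      ultimately have c: "(\<lambda>n. c n x) \<longlonglongrightarrow> \<phi> x" by simp
      have s: "sin (pi * x) > 0" using x by (intro sin_gt_zero) auto
      obtain m :: nat where m: "1 / sin (pi * x) < m" using reals_Archimedean2 by blast
      have "\<forall>\<^sub>F n in sequentially. H n x = c n x"
      proof (rule eventually_sequentiallyI[of m])
        fix n assume "m \<le> n"
        then have "1 / sin (pi * x) \<le> n" using m by linarith
        then have "1 \<le> real n * \<bar>sin (pi * x)\<bar>" using s by (simp add: field_simps)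
        then show "H n x = c n x" by (simp add: H_def fr)
      qed
      then have H: "(\<lambda>n. H n x) \<longlonglongrightarrow> \<phi> x" using c by (simp add: filterlim_cong)
      have "(\<lambda>n. \<psi> n x - H n x) \<longlonglongrightarrow> 0"
        by (rule Lim_null_comparison[OF _ LIMSEQ_inverse_real_of_nat]) (use N(2) in \<open>simp add: \<psi>_def\<close>)
      from tendsto_add[OF this H] show "(\<lambda>n. \<psi> n x) \<longlonglongrightarrow> \<phi> x" by simp
    qed
  qed
qed

text \<open>Approximate \<open>sgn \<circ> u\<close> by smooth test functions.\<close>

lemma L1_norm_dual:
  assumes u: "u \<in> L1"
    and A: "\<And>\<phi>. smooth_per \<phi> \<Longrightarrow> (\<And>x. \<bar>\<phi> x\<bar> \<le> 1) \<Longrightarrow> (\<integral>x. \<phi> x * u x \<partial>circ) \<le> A"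
  shows "L1_norm u \<le> A"
proof -
  have m: "(\<lambda>x. sgn (u x)) \<in> borel_measurable borel" using L1D(4)[OF u] by measurable
  obtain \<psi> where \<psi>: "\<And>n. smooth_per (\<psi> n)" "\<And>n x. \<bar>\<psi> n x\<bar> \<le> 1"
    "AE x in circ. (\<lambda>n. \<psi> n x) \<longlonglongrightarrow> sgn (u x)"
    using smooth_approx_measurable[OF m] abs_sgn_eq[of "u _"] by (metis order_refl zero_le_one)
  have "(\<lambda>n. \<integral>x. \<psi> n x * u x \<partial>circ) \<longlonglongrightarrow> (\<integral>x. sgn (u x) * u x \<partial>circ)"
  proof (rule integral_dominated_convergence[where w="\<lambda>x. \<bar>u x\<bar>"])
    have [measurable]: "u \<in> borel_measurable circ" using u by (rule L1D)
    have [measurable]: "\<psi> n \<in> borel_measurable circ" for n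
      using per_C1D(6)[OF smooth_per_per_C1[OF \<psi>(1)]] by (rule measurable_circ)
    show "(\<lambda>x. sgn (u x) * u x) \<in> borel_measurable circ" "(\<lambda>x. \<psi> n x * u x) \<in> borel_measurable circ" for n
      by measurable
    show "integrable circ (\<lambda>x. \<bar>u x\<bar>)" using u by (simp add: L1D)
    show "AE x in circ. (\<lambda>n. \<psi> n x * u x) \<longlonglongrightarrow> sgn (u x) * u x"
      using \<psi>(3) by eventually_elim (intro tendsto_intros)
    show "AE x in circ. norm (\<psi> n x * u x) \<le> \<bar>u x\<bar>" for n
      using \<psi>(2)[of n] by (auto simp: abs_mult intro!: mult_left_le_one_le)
  qed
  then have "(\<integral>x. sgn (u x) * u x \<partial>circ) \<le> A"
    by (rule LIMSEQ_le_const2) (use A \<psi> in auto)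
  then show ?thesis by (simp add: L1_norm_def sgn_mult_self_eq mult.commute[of "sgn _"] flip: abs_sgn)
qed

lemma L1_eq_AE_dual:
  assumes "u \<in> L1" "w \<in> L1"
    and "\<And>\<phi>. smooth_per \<phi> \<Longrightarrow> (\<integral>x. \<phi> x * u x \<partial>circ) = (\<integral>x. \<phi> x * w x \<partial>circ)"
  shows "AE x in circ. u x = w x"
proof -
  have L: "(\<lambda>x. u x - w x) \<in> L1" using assms by (intro L1_diff)
  have "L1_norm (\<lambda>x. u x - w x) \<le> 0"
  proof (rule L1_norm_dual[OF L])
    fix \<phi> :: "real \<Rightarrow> real" assume \<phi>: "smooth_per \<phi>"
    have "integrable circ (\<lambda>x. \<phi> x * u x)" "integrable circ (\<lambda>x. \<phi> x * w x)"
      using per_C1D(1,4)[OF smooth_per_per_C1[OF \<phi>]] assms by (auto intro: L1D(2) L1_mult_cont)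
    then show "(\<integral>x. \<phi> x * (u x - w x) \<partial>circ) \<le> 0"
      using assms(3)[OF \<phi>] by (simp add: right_diff_distrib)
  qed
  from L1_norm_eq_0[OF L this] show ?thesis by simp
qed

text \<open>Subtracting its mean gives a test function a periodic primitive; this is how bounds in
  \<open>L\<^sup>\<infinity>\<close> on test functions become Lipschitz bounds.\<close>

lemma test_function_primitive:
  assumes "smooth_per \<phi>" "\<And>x. \<bar>\<phi> x\<bar> \<le> 1"
  obtains P m where "per_C1 P (\<lambda>x. \<phi> x - m)" "P 0 = 0" "\<And>x y. \<bar>P x - P y\<bar> \<le> 2 * \<bar>x - y\<bar>"
proof -
  note Q = per_C1D(1,4)[OF smooth_per_per_C1[OF assms(1)]]
  have \<phi>L: "\<phi> \<in> L1" using Q by (rule L1_cont)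
  define m where "m = (\<integral>x. \<phi> x \<partial>circ)"
  have m: "\<bar>m\<bar> \<le> 1"
    using abs_integral_mult_le[of "\<lambda>_. 1" \<phi> 1] \<phi>L assms(2) by (simp add: m_def L1D)
  obtain P where P: "per_C1 P (\<lambda>x. \<phi> x - m)" "P 0 = 0"
    by (rule per_C1_primitive[of "\<lambda>x. \<phi> x - m"])
       (use Q \<phi>L in \<open>auto simp: periodic1_def m_def L1D intro!: continuous_intros\<close>)
  have "\<bar>P x - P y\<bar> \<le> 2 * \<bar>x - y\<bar>" for x y
  proof (rule DERIV_bound_Lipschitz[OF per_C1D(2)[OF P(1)]])
    show "\<bar>\<phi> x - m\<bar> \<le> 2" for x using assms(2)[of x] m by linarith
  qed
  with P show ?thesis using that by blast
qed

section \<open>Weak derivatives and the Sobolev spaces\<close>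

lemma is_weak_deriv_smooth:
  "is_weak_deriv j f u \<longleftrightarrow> u \<in> L1 \<and>
     (\<forall>\<phi>. smooth_per \<phi> \<longrightarrow> (\<integral>x. f x * (deriv ^^ j) \<phi> x \<partial>circ) = (-1) ^ j * (\<integral>x. u x * \<phi> x \<partial>circ))"
  by (simp add: is_weak_deriv_def smooth_per_def)

lemma is_weak_deriv_1:
  "is_weak_deriv 1 f u \<longleftrightarrow> u \<in> L1 \<and>
     (\<forall>\<phi>. smooth_per \<phi> \<longrightarrow> (\<integral>x. f x * deriv \<phi> x \<partial>circ) = - (\<integral>x. u x * \<phi> x \<partial>circ))"
  by (simp add: is_weak_deriv_def smooth_per_def)

lemma is_weak_deriv_L1: "is_weak_deriv j f u \<Longrightarrow> u \<in> L1"
  by (simp add: is_weak_deriv_def)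

lemma is_weak_deriv_unique:
  assumes "is_weak_deriv j f u" "is_weak_deriv j f w"
  shows "AE x in circ. u x = w x"
proof (rule L1_eq_AE_dual)
  show "u \<in> L1" "w \<in> L1" using assms by (auto simp: is_weak_deriv_def)
  fix \<phi> :: "real \<Rightarrow> real" assume "smooth_per \<phi>"
  then have "(-1) ^ j * (\<integral>x. u x * \<phi> x \<partial>circ) = (-1) ^ j * (\<integral>x. w x * \<phi> x \<partial>circ)"
    using assms unfolding is_weak_deriv_smooth by simp
  then show "(\<integral>x. \<phi> x * u x \<partial>circ) = (\<integral>x. \<phi> x * w x \<partial>circ)" by (simp add: mult.commute)
qed

lemma per_C1_weak_deriv: "per_C1 f f' \<Longrightarrow> is_weak_deriv 1 f f'"
  unfolding is_weak_deriv_1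
  using per_C1_by_parts[OF _ smooth_per_per_C1] per_C1D(3,5) L1_cont by blast

lemma integrable_L1_cont:
  "f \<in> L1 \<Longrightarrow> periodic1 a \<Longrightarrow> continuous_on UNIV a \<Longrightarrow> integrable circ (\<lambda>x. f x * a x)"
  "f \<in> L1 \<Longrightarrow> periodic1 a \<Longrightarrow> continuous_on UNIV a \<Longrightarrow> integrable circ (\<lambda>x. a x * f x)"
  using L1D(2)[OF L1_mult_cont[of f a]] by (simp_all add: mult.commute)

text \<open>Test functions in the definition of a weak derivative are smooth; Fejer means carry the
  identity over to test functions that are merely \<open>C\<^sup>1\<close>.\<close>

lemma weak_deriv_by_parts:
  assumes f: "f \<in> L1" and u: "is_weak_deriv 1 f u" and P: "per_C1 P P'"
  shows "(\<integral>x. f x * P' x \<partial>circ) = - (\<integral>x. u x * P x \<partial>circ)"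
proof -
  have uL: "u \<in> L1" using u by (rule is_weak_deriv_L1)
  have "\<bar>(\<integral>x. f x * P' x \<partial>circ) + (\<integral>x. u x * P x \<partial>circ)\<bar> \<le> e * (L1_norm f + L1_norm u)" if "e > 0" for e
  proof -
    obtain N1 where N1: "N1 \<ge> 1" "\<And>N x. N \<ge> N1 \<Longrightarrow> \<bar>fejer_proj N P x - P x\<bar> \<le> e"
      using fejer_uniform[OF per_C1D(1)[OF P] per_C1D(4)[OF P] \<open>e > 0\<close>] by metis
    obtain N2 where N2: "N2 \<ge> 1" "\<And>N x. N \<ge> N2 \<Longrightarrow> \<bar>fejer_proj N P' x - P' x\<bar> \<le> e"
      using fejer_uniform[OF per_C1D(5)[OF P] per_C1D(3)[OF P] \<open>e > 0\<close>] by metis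
    define N where "N = max N1 N2"
    let ?Q = "fejer_proj N P" and ?Q' = "fejer_proj N P'"
    have PL: "P \<in> L1" "P' \<in> L1" using P by (auto intro!: L1_cont dest: per_C1D)
    have Q: "per_C1 ?Q ?Q'" using fejer_weak_deriv[OF PL(1) per_C1_weak_deriv[OF P]] .
    have Qs: "smooth_per ?Q" using PL(1) by (rule smooth_per_fejer)
    have z: "(\<integral>x. f x * ?Q' x \<partial>circ) + (\<integral>x. u x * ?Q x \<partial>circ) = 0"
    proof -
      have "(\<integral>x. f x * deriv ?Q x \<partial>circ) = - (\<integral>x. u x * ?Q x \<partial>circ)"
        using u Qs unfolding is_weak_deriv_1 by blast
      then show ?thesis unfolding per_C1_deriv[OF Q] by linarith
    qed
    note pP = per_C1D(1,3,4,5)[OF P] and pQ = per_C1D(1,3,4,5)[OF Q]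
    have "(\<integral>x. (P' x - ?Q' x) * f x \<partial>circ) = (\<integral>x. f x * P' x \<partial>circ) - (\<integral>x. f x * ?Q' x \<partial>circ)"
      using integrable_L1_cont(2)[OF f] pP pQ by (simp add: left_diff_distrib mult.commute[of "f _"])
    moreover have "(\<integral>x. (P x - ?Q x) * u x \<partial>circ) = (\<integral>x. u x * P x \<partial>circ) - (\<integral>x. u x * ?Q x \<partial>circ)"
      using integrable_L1_cont(2)[OF uL] pP pQ by (simp add: left_diff_distrib mult.commute[of "u _"])
    moreover have "\<bar>\<integral>x. (P' x - ?Q' x) * f x \<partial>circ\<bar> \<le> e * L1_norm f"
      using N2(2)[of N] pP pQ
      by (intro abs_integral_mult_le f measurable_circ borel_measurable_continuous_onI continuous_intros)
         (auto simp: N_def abs_minus_commute)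
    moreover have "\<bar>\<integral>x. (P x - ?Q x) * u x \<partial>circ\<bar> \<le> e * L1_norm u"
      using N1(2)[of N] pP pQ
      by (intro abs_integral_mult_le uL measurable_circ borel_measurable_continuous_onI continuous_intros)
         (auto simp: N_def abs_minus_commute)
    ultimately show ?thesis using z by (simp add: distrib_left)
  qed
  note * = this
  have "\<bar>(\<integral>x. f x * P' x \<partial>circ) + (\<integral>x. u x * P x \<partial>circ)\<bar> \<le> 0"
  proof (rule field_le_epsilon)
    fix e :: real assume "e > 0"
    let ?L = "L1_norm f + L1_norm u + 1"
    have L: "?L > 0" by (simp add: add_nonneg_pos)
    have "e / ?L * (L1_norm f + L1_norm u) \<le> e / ?L * ?L" using \<open>e > 0\<close> L by (intro mult_left_mono) auto
    also have "\<dots> = e" using L by simp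
    finally show "\<bar>(\<integral>x. f x * P' x \<partial>circ) + (\<integral>x. u x * P x \<partial>circ)\<bar> \<le> 0 + e"
      using *[of "e / ?L"] \<open>e > 0\<close> L by auto
  qed
  then show ?thesis by simp
qed

lemma weak_deriv_mult:
  assumes f: "f \<in> L1" and u: "is_weak_deriv 1 f u" and a: "per_C1 a a'"
  shows "is_weak_deriv 1 (\<lambda>x. a x * f x) (\<lambda>x. a x * u x + a' x * f x)"
  unfolding is_weak_deriv_1
proof (intro conjI allI impI)
  have uL: "u \<in> L1" using u by (rule is_weak_deriv_L1)
  note A = per_C1D(1,3,4,5)[OF a]
  show L: "(\<lambda>x. a x * u x + a' x * f x) \<in> L1"
    using A f uL by (intro L1_add L1_mult_cont)
  fix \<phi> :: "real \<Rightarrow> real" assume "smooth_per \<phi>"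
  then have p: "per_C1 \<phi> (deriv \<phi>)" by (rule smooth_per_per_C1)
  note Q = per_C1D(1,3,4,5)[OF p] and M = per_C1_mult[OF a p]
  have i: "integrable circ (\<lambda>x. f x * (a x * deriv \<phi> x))" "integrable circ (\<lambda>x. f x * (a' x * \<phi> x))"
     "integrable circ (\<lambda>x. u x * (a x * \<phi> x))"
    using A Q f uL by (auto intro!: integrable_L1_cont(1) continuous_intros simp: periodic1_def)
  have "(\<integral>x. f x * (a x * deriv \<phi> x) \<partial>circ) + (\<integral>x. f x * (a' x * \<phi> x) \<partial>circ) = - (\<integral>x. u x * (a x * \<phi> x) \<partial>circ)"
    using weak_deriv_by_parts[OF f u M] i by (simp add: distrib_left)
  then show "(\<integral>x. a x * f x * deriv \<phi> x \<partial>circ) = - (\<integral>x. (a x * u x + a' x * f x) * \<phi> x \<partial>circ)"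
    using i by (simp add: distrib_right distrib_left mult_ac)
qed

lemma weak_deriv_linear:
  assumes "f \<in> L1" "h \<in> L1" "is_weak_deriv 1 f u" "is_weak_deriv 1 h w"
  shows "is_weak_deriv 1 (\<lambda>x. c * f x + d * h x) (\<lambda>x. c * u x + d * w x)"
  unfolding is_weak_deriv_1
proof (intro conjI allI impI)
  have L: "u \<in> L1" "w \<in> L1" using assms by (auto intro: is_weak_deriv_L1)
  then show "(\<lambda>x. c * u x + d * w x) \<in> L1" by (intro L1_add L1_cmult)
  fix \<phi> :: "real \<Rightarrow> real" assume p: "smooth_per \<phi>"
  note Q = per_C1D(1,3,4,5)[OF smooth_per_per_C1[OF p]]
  have 1: "(\<integral>x. f x * deriv \<phi> x \<partial>circ) = - (\<integral>x. u x * \<phi> x \<partial>circ)"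
    "(\<integral>x. h x * deriv \<phi> x \<partial>circ) = - (\<integral>x. w x * \<phi> x \<partial>circ)"
    using assms p by (auto simp: is_weak_deriv_1 simp del: One_nat_def)
  have i: "integrable circ (\<lambda>x. f x * deriv \<phi> x)" "integrable circ (\<lambda>x. h x * deriv \<phi> x)"
    "integrable circ (\<lambda>x. u x * \<phi> x)" "integrable circ (\<lambda>x. w x * \<phi> x)"
    using assms L Q by (auto intro!: integrable_L1_cont(1))
  show "(\<integral>x. (c * f x + d * h x) * deriv \<phi> x \<partial>circ) = - (\<integral>x. (c * u x + d * w x) * \<phi> x \<partial>circ)"
    using i 1 by (simp add: distrib_right mult.assoc)
qed

lemma weak_deriv_cong:
  assumes "f \<in> L1" "h \<in> L1" "AE x in circ. f x = h x"
  shows "is_weak_deriv j f = is_weak_deriv j h"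
proof -
  have "(\<integral>x. f x * (deriv ^^ j) \<phi> x \<partial>circ) = (\<integral>x. h x * (deriv ^^ j) \<phi> x \<partial>circ)" if "smooth_per \<phi>" for \<phi>
  proof -
    have "smooth_per ((deriv ^^ j) \<phi>)" using that by (induction j) (auto intro: smooth_per_deriv)
    then have "(deriv ^^ j) \<phi> \<in> borel_measurable circ"
      using measurable_circ per_C1D(6) smooth_per_per_C1 by blast
    from integral_mult_cong_AE[OF assms this] show ?thesis by (simp add: mult.commute)
  qed
  then show ?thesis unfolding is_weak_deriv_smooth fun_eq_iff by simp
qed

lemma is_weak_deriv_Suc:
  assumes "is_weak_deriv 1 f u"
  shows "is_weak_deriv (Suc j) f w \<longleftrightarrow> is_weak_deriv j u w"
proof -
  have "(\<integral>x. f x * (deriv ^^ Suc j) \<phi> x \<partial>circ) = - (\<integral>x. u x * (deriv ^^ j) \<phi> x \<partial>circ)" if "smooth_per \<phi>" for \<phi>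
  proof -
    have "smooth_per ((deriv ^^ j) \<phi>)" using that by (induction j) (auto intro: smooth_per_deriv)
    then show ?thesis using assms by (auto simp: is_weak_deriv_1 simp del: One_nat_def)
  qed
  then show ?thesis unfolding is_weak_deriv_smooth by (simp del: funpow.simps)
qed

lemma W1_0 [simp]: "W1 0 = L1" "W1_norm 0 = L1_norm"
  by (auto simp: W1_def W1_norm_def)

lemma W1_L1: "f \<in> W1 i \<Longrightarrow> f \<in> L1"
  by (simp add: W1_def)

text \<open>The Sobolev spaces and norms unfold one derivative at a time, so that statements about all of
  them reduce, by induction, to statements about one weak derivative.\<close>

lemma W1_Suc_iff:
  assumes "f \<in> L1" "is_weak_deriv 1 f u"
  shows "f \<in> W1 (Suc i) \<longleftrightarrow> u \<in> W1 i"
proof -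
  have *: "{1..Suc i} = insert 1 (Suc ` {1..i})" by (auto simp: image_iff Suc_le_eq elim: lessE)
  have "(\<forall>j\<in>{1..Suc i}. Q j) \<longleftrightarrow> Q 1 \<and> (\<forall>j\<in>{1..i}. Q (Suc j))" for Q
    unfolding * by blast
  from this[of "\<lambda>j. \<exists>w. is_weak_deriv j f w"]
  have "f \<in> W1 (Suc i) \<longleftrightarrow> (\<forall>j\<in>{1..i}. \<exists>w. is_weak_deriv (Suc j) f w)"
    using assms by (simp add: W1_def del: One_nat_def) blast
  also have "\<dots> \<longleftrightarrow> u \<in> W1 i"
    using is_weak_deriv_L1[OF assms(2)] unfolding is_weak_deriv_Suc[OF assms(2)] W1_def by simp
  finally show ?thesis .
qed

lemma W1_SucE:
  assumes "f \<in> W1 (Suc i)"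
  obtains u where "f \<in> L1" "is_weak_deriv 1 f u" "u \<in> W1 i"
proof -
  obtain u where u: "is_weak_deriv 1 f u" using assms by (force simp: W1_def)
  moreover have "f \<in> L1" using assms by (rule W1_L1)
  ultimately show ?thesis using that W1_Suc_iff assms by blast
qed

lemma W1_norm_Suc:
  assumes "f \<in> L1" "is_weak_deriv 1 f u"
  shows "W1_norm (Suc i) f = L1_norm f + W1_norm i u"
proof -
  have "is_weak_deriv 1 f (weak_deriv 1 f)" unfolding weak_deriv_def by (rule someI[of "is_weak_deriv 1 f", OF assms(2)])
  then have 1: "L1_norm (weak_deriv 1 f) = L1_norm u"
    using assms(2) by (intro L1_norm_cong_AE is_weak_deriv_unique[of 1 f]) (auto intro: is_weak_deriv_L1)
  have 2: "weak_deriv (Suc j) f = weak_deriv j u" for j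
    unfolding weak_deriv_def is_weak_deriv_Suc[OF assms(2)] ..
  have "(\<Sum>j=1..Suc i. L1_norm (weak_deriv j f)) = L1_norm (weak_deriv 1 f) + (\<Sum>j=1..i. L1_norm (weak_deriv (Suc j) f))"
    using sum.atLeast_Suc_atMost[of 1 "Suc i" "\<lambda>j. L1_norm (weak_deriv j f)"]
      sum.shift_bounds_cl_Suc_ivl[of "\<lambda>j. L1_norm (weak_deriv j f)" 1 i] by simp
  then show ?thesis unfolding W1_norm_def 1 2 by simp
qed

lemma W1_norm_nonneg [simp]: "0 \<le> W1_norm i f"
  unfolding W1_norm_def by (intro add_nonneg_nonneg sum_nonneg) auto

lemma L1_norm_le_W1_norm: "L1_norm f \<le> W1_norm i f"
  unfolding W1_norm_def by (simp add: sum_nonneg)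

lemma W1_norm_mono: "W1_norm i f \<le> W1_norm (Suc i) f"
  unfolding W1_norm_def by simp

lemma W1_mono: "f \<in> W1 (Suc i) \<Longrightarrow> f \<in> W1 i"
  by (simp add: W1_def)

lemma W1_linear:
  assumes "f \<in> W1 i" "h \<in> W1 i"
  shows "(\<lambda>x. c * f x + d * h x) \<in> W1 i \<and>
    W1_norm i (\<lambda>x. c * f x + d * h x) \<le> \<bar>c\<bar> * W1_norm i f + \<bar>d\<bar> * W1_norm i h"
  using assms
proof (induction i arbitrary: f h)
  case 0
  then show ?case
    using L1_norm_triangle[of "\<lambda>x. c * f x" "\<lambda>x. d * h x"] by (simp add: L1_add L1_cmult L1_norm_cmult)
next
  case (Suc i)
  obtain u where u: "f \<in> L1" "is_weak_deriv 1 f u" "u \<in> W1 i" using Suc.prems(1) by (rule W1_SucE)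
  obtain w where w: "h \<in> L1" "is_weak_deriv 1 h w" "w \<in> W1 i" using Suc.prems(2) by (rule W1_SucE)
  have L: "(\<lambda>x. c * f x + d * h x) \<in> L1" using u w by (intro L1_add L1_cmult)
  have D: "is_weak_deriv 1 (\<lambda>x. c * f x + d * h x) (\<lambda>x. c * u x + d * w x)"
    using u w by (intro weak_deriv_linear)
  have n: "L1_norm (\<lambda>x. c * f x + d * h x) \<le> \<bar>c\<bar> * L1_norm f + \<bar>d\<bar> * L1_norm h"
    using L1_norm_triangle[of "\<lambda>x. c * f x" "\<lambda>x. d * h x"] u w by (simp add: L1_cmult L1_norm_cmult)
  show ?case
    unfolding W1_Suc_iff[OF L D] W1_norm_Suc[OF L D] W1_norm_Suc[OF u(1,2)] W1_norm_Suc[OF w(1,2)]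
    using Suc.IH[OF u(3) w(3)] n by (auto simp: algebra_simps)
qed

lemma W1_norm_triangle: "f \<in> W1 i \<Longrightarrow> h \<in> W1 i \<Longrightarrow> W1_norm i (\<lambda>x. f x + h x) \<le> W1_norm i f + W1_norm i h"
  using W1_linear[of f i h 1 1] by auto

lemma W1_diff: "f \<in> W1 i \<Longrightarrow> h \<in> W1 i \<Longrightarrow> (\<lambda>x. f x - h x) \<in> W1 i"
  and W1_norm_triangle_diff: "f \<in> W1 i \<Longrightarrow> h \<in> W1 i \<Longrightarrow> W1_norm i (\<lambda>x. f x - h x) \<le> W1_norm i f + W1_norm i h"
  using W1_linear[of f i h 1 "-1"] by auto

lemma W1_cong_AE:
  assumes "f \<in> W1 i" "h \<in> L1" "AE x in circ. f x = h x"
  shows "h \<in> W1 i" "W1_norm i h = W1_norm i f"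
proof -
  note c = weak_deriv_cong[OF W1_L1[OF assms(1)] assms(2,3)]
  show "h \<in> W1 i" using assms(1,2) c by (simp add: W1_def)
  show "W1_norm i h = W1_norm i f"
    unfolding W1_norm_def weak_deriv_def c L1_norm_cong_AE[OF W1_L1[OF assms(1)] assms(2,3)] ..
qed

lemma W1_const: "(\<lambda>_. c) \<in> W1 i \<and> W1_norm i (\<lambda>_. c) = \<bar>c\<bar>"
proof (induction i arbitrary: c)
  case (Suc i)
  have D: "is_weak_deriv 1 (\<lambda>_. c) (\<lambda>_. 0)"
    by (intro per_C1_weak_deriv) (auto simp: per_C1_def periodic1_def)
  show ?case using Suc[of 0] W1_Suc_iff[OF _ D] W1_norm_Suc[OF _ D] by simp
qed simp

lemma fejer_W1:
  assumes "N \<ge> 1" "f \<in> W1 i"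
  shows "fejer_proj N f \<in> W1 i \<and> W1_norm i (fejer_proj N f) \<le> W1_norm i f"
  using assms(2)
proof (induction i arbitrary: f)
  case 0
  then show ?case using fejer_L1_norm_le[OF assms(1)] fejer_L1 by simp
next
  case (Suc i)
  obtain u where u: "f \<in> L1" "is_weak_deriv 1 f u" "u \<in> W1 i" using Suc.prems(1) by (rule W1_SucE)
  have D: "is_weak_deriv 1 (fejer_proj N f) (fejer_proj N u)"
    using fejer_weak_deriv[OF u(1,2)] by (rule per_C1_weak_deriv)
  note L = fejer_L1[OF u(1), of N]
  show ?case
    unfolding W1_Suc_iff[OF L D] W1_norm_Suc[OF L D] W1_norm_Suc[OF u(1,2)]
    using Suc.IH[OF u(3)] fejer_L1_norm_le[OF assms(1) u(1)] by auto
qed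

text \<open>By self-adjointness, testing against \<open>\<phi>\<close> amounts to integrating \<open>f\<close> against \<open>\<Pi>\<^sub>N \<phi> - \<phi>\<close>.  This
  is the derivative of \<open>\<Pi>\<^sub>N P - P\<close> for a Lipschitz primitive \<open>P\<close>, which is uniformly small, and integration
  by parts brings in \<open>u\<close>.\<close>

lemma fejer_rate_L1:
  assumes "N \<ge> 1" "f \<in> L1" "is_weak_deriv 1 f u"
  shows "L1_norm (\<lambda>x. fejer_proj N f x - f x) \<le> 1 / sqrt N * L1_norm u"
proof (rule L1_norm_dual)
  have u: "u \<in> L1" using assms(3) by (rule is_weak_deriv_L1)
  show "(\<lambda>x. fejer_proj N f x - f x) \<in> L1" using assms fejer_L1 by (intro L1_diff)
  fix \<phi> :: "real \<Rightarrow> real" assume \<phi>: "smooth_per \<phi>" "\<And>x. \<bar>\<phi> x\<bar> \<le> 1"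
  note Q = per_C1D(1,4)[OF smooth_per_per_C1[OF \<phi>(1)]]
  have \<phi>L: "\<phi> \<in> L1" using Q by (rule L1_cont)
  obtain P m where P: "per_C1 P (\<lambda>x. \<phi> x - m)" and lip: "\<And>x y. \<bar>P x - P y\<bar> \<le> 2 * \<bar>x - y\<bar>"
    using test_function_primitive[OF \<phi>] by metis
  note PQ = per_C1D(1,3,4,5)[OF P]
  have PL: "P \<in> L1" "(\<lambda>x. \<phi> x - m) \<in> L1" using PQ by (auto intro: L1_cont)
  let ?R = "\<lambda>x. fejer_proj N P x - P x" and ?r = "\<lambda>x. fejer_proj N (\<lambda>x. \<phi> x - m) x - (\<phi> x - m)"
  have R: "per_C1 ?R ?r"
  proof -
    have F: "per_C1 (fejer_proj N P) (fejer_proj N (\<lambda>x. \<phi> x - m))"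
      using fejer_weak_deriv[OF PL(1) per_C1_weak_deriv[OF P]] .
    show ?thesis
      using per_C1D(1-3)[OF F] per_C1D(1-3)[OF P]
      by (auto simp: per_C1_def periodic1_def intro!: derivative_intros continuous_on_diff)
  qed
  have r: "?r x = fejer_proj N \<phi> x - \<phi> x" for x
    using fejer_diff[OF \<phi>L L1_const] fejer_const[OF assms(1)] by simp
  have ii: "integrable circ (\<lambda>x. \<phi> x * fejer_proj N f x)" "integrable circ (\<lambda>x. \<phi> x * f x)"
      "integrable circ (\<lambda>x. f x * fejer_proj N \<phi> x)"
    using Q assms(2) fejer_L1[OF assms(2)] fejer_cont[OF \<phi>L] fejer_periodic[OF \<phi>L]
    by (auto intro: integrable_L1_cont)
  have "(\<integral>x. \<phi> x * (fejer_proj N f x - f x) \<partial>circ) = (\<integral>x. f x * fejer_proj N \<phi> x \<partial>circ) - (\<integral>x. \<phi> x * f x \<partial>circ)"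
    using ii fejer_selfadjoint[OF assms(2) \<phi>L, of N] by (simp add: right_diff_distrib mult.commute)
  also have "\<dots> = (\<integral>x. f x * ?r x \<partial>circ)"
    unfolding r using ii by (simp add: right_diff_distrib mult.commute)
  also have "\<dots> = - (\<integral>x. u x * ?R x \<partial>circ)" by (rule weak_deriv_by_parts[OF assms(2,3) R])
  also have "\<dots> \<le> \<bar>\<integral>x. ?R x * u x \<partial>circ\<bar>" by (simp add: mult.commute)
  also have "\<dots> \<le> 1 / sqrt N * L1_norm u"
  proof (rule abs_integral_mult_le[OF u])
    show "?R \<in> borel_measurable circ" using per_C1D(6)[OF R] by (rule measurable_circ)
    show "AE x in circ. \<bar>?R x\<bar> \<le> 1 / sqrt N"
      using fejer_Lipschitz[OF assms(1) PQ(1) lip _ PL(1)] by simp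
  qed
  finally show "(\<integral>x. \<phi> x * (fejer_proj N f x - f x) \<partial>circ) \<le> 1 / sqrt N * L1_norm u" .
qed

text \<open>In terms of the derivative \<open>u\<close> the estimate has the same constant at every order, so
  that the induction loses nothing.\<close>

lemma fejer_rate_aux:
  assumes "N \<ge> 1" "f \<in> L1" "is_weak_deriv 1 f u" "u \<in> W1 i"
  shows "(\<lambda>x. fejer_proj N f x - f x) \<in> W1 i \<and>
    W1_norm i (\<lambda>x. fejer_proj N f x - f x) \<le> 1 / sqrt N * W1_norm i u"
  using assms(2-4)
proof (induction i arbitrary: f u)
  case 0
  then show ?case using fejer_rate_L1[OF assms(1) 0(1,2)] fejer_L1 by (simp add: L1_diff)
next
  case (Suc i)
  note u = Suc.prems
  obtain v where v: "u \<in> L1" "is_weak_deriv 1 u v" "v \<in> W1 i" using u(3) by (rule W1_SucE)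
  have "is_weak_deriv 1 (fejer_proj N f) (fejer_proj N u)"
    using fejer_weak_deriv[OF u(1,2)] by (rule per_C1_weak_deriv)
  from weak_deriv_linear[OF fejer_L1[OF u(1)] u(1) this u(2), of 1 "-1"]
  have D: "is_weak_deriv 1 (\<lambda>x. fejer_proj N f x - f x) (\<lambda>x. fejer_proj N u x - u x)" by simp
  have L: "(\<lambda>x. fejer_proj N f x - f x) \<in> L1" using u fejer_L1 by (intro L1_diff)
  have "L1_norm (\<lambda>x. fejer_proj N f x - f x) \<le> 1 / sqrt N * L1_norm u"
    by (rule fejer_rate_L1[OF assms(1) u(1,2)])
  then show ?case
    unfolding W1_Suc_iff[OF L D] W1_norm_Suc[OF L D] W1_norm_Suc[OF v(1,2)]
    using Suc.IH[OF v] by (simp add: distrib_left add_divide_distrib)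
qed

lemma fejer_rate:
  assumes "N \<ge> 1" "f \<in> W1 (Suc i)"
  shows "(\<lambda>x. fejer_proj N f x - f x) \<in> W1 i"
    "W1_norm i (\<lambda>x. fejer_proj N f x - f x) \<le> 1 / sqrt N * W1_norm (Suc i) f"
proof -
  obtain u where u: "f \<in> L1" "is_weak_deriv 1 f u" "u \<in> W1 i" using assms(2) by (rule W1_SucE)
  have "1 / sqrt N * W1_norm i u \<le> 1 / sqrt N * W1_norm (Suc i) f"
    by (intro mult_left_mono) (simp_all add: W1_norm_Suc[OF u(1,2)])
  with fejer_rate_aux[OF assms(1) u]
  show "(\<lambda>x. fejer_proj N f x - f x) \<in> W1 i"
    "W1_norm i (\<lambda>x. fejer_proj N f x - f x) \<le> 1 / sqrt N * W1_norm (Suc i) f" by auto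
qed

text \<open>For fixed \<open>N\<close> the range consists of trigonometric polynomials of bounded degree, and their coefficients
  are controlled by the \<open>L\<^sup>1\<close> norm.\<close>

lemma fejer_smoothing:
  obtains b where "b \<ge> 0" "\<And>f. f \<in> L1 \<Longrightarrow> fejer_proj N f \<in> W1 i"
    "\<And>f. f \<in> L1 \<Longrightarrow> W1_norm i (fejer_proj N f) \<le> b * L1_norm f"
    "\<And>f x. f \<in> L1 \<Longrightarrow> \<bar>fejer_proj N f x\<bar> \<le> b * L1_norm f"
proof -
  define c :: "(int \<Rightarrow> real) \<Rightarrow> (int \<Rightarrow> real) \<Rightarrow> real" where "c a b = (\<Sum>k\<in>freqs N. \<bar>a k\<bar> + \<bar>b k\<bar>)" for a b
  have c0: "c a b \<ge> 0" for a b unfolding c_def by (intro sum_nonneg) auto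
  have cD: "c (\<lambda>k. 2 * pi * of_int k * b k) (\<lambda>k. - (2 * pi * of_int k * a k)) \<le> (2 * pi * N) * c a b" for a b
    unfolding c_def sum_distrib_left
  proof (rule sum_mono)
    fix k assume "k \<in> freqs N"
    then have "\<bar>2 * pi * real_of_int k\<bar> \<le> 2 * pi * N" by (auto simp: freqs_def abs_mult)
    then have "\<bar>2 * pi * of_int k\<bar> * (\<bar>a k\<bar> + \<bar>b k\<bar>) \<le> (2 * pi * N) * (\<bar>a k\<bar> + \<bar>b k\<bar>)"
      by (rule mult_right_mono) simp
    then show "\<bar>2 * pi * of_int k * b k\<bar> + \<bar>- (2 * pi * of_int k * a k)\<bar> \<le> (2 * pi * N) * (\<bar>a k\<bar> + \<bar>b k\<bar>)"
      unfolding abs_minus_cancel abs_mult[of _ "a k"] abs_mult[of _ "b k"] by (simp only: distrib_left add.commute)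
  qed
  have L: "trig N a b \<in> L1" for a b by (intro L1_cont periodic1_trig trig_cont)
  have n0: "L1_norm (trig N a b) \<le> c a b" for a b
  proof -
    have "L1_norm (trig N a b) \<le> (\<integral>x. c a b \<partial>circ)"
      unfolding L1_norm_def using L1D(2)[OF L1_abs[OF L]] trig_abs_le by (intro integral_mono) (auto simp: c_def)
    then show ?thesis by simp
  qed
  have "\<exists>q\<ge>0. \<forall>a b. trig N a b \<in> W1 i \<and> W1_norm i (trig N a b) \<le> q * c a b"
  proof (induction i)
    case 0
    show ?case using L n0 by (intro exI[of _ 1]) auto
  next
    case (Suc i)
    then obtain q where q: "q \<ge> 0" "\<And>a b. trig N a b \<in> W1 i" "\<And>a b. W1_norm i (trig N a b) \<le> q * c a b" by blast
    show ?case
    proof (intro exI[of _ "1 + q * (2 * pi * N)"] conjI allI)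
      show "0 \<le> 1 + q * (2 * pi * N)" using q by simp
      fix a b
      note D = per_C1_weak_deriv[OF per_C1_trig[of N a b]]
      show "trig N a b \<in> W1 (Suc i)" unfolding W1_Suc_iff[OF L D] by (rule q)
      have "W1_norm (Suc i) (trig N a b) \<le> c a b + q * ((2 * pi * N) * c a b)"
        unfolding W1_norm_Suc[OF L D]
        by (rule add_mono[OF n0 order_trans[OF q(3) mult_left_mono[OF cD q(1)]]])
      then show "W1_norm (Suc i) (trig N a b) \<le> (1 + q * (2 * pi * N)) * c a b"
        by (simp add: algebra_simps)
    qed
  qed
  then obtain q where q: "q \<ge> 0" "\<And>a b. trig N a b \<in> W1 i" "\<And>a b. W1_norm i (trig N a b) \<le> q * c a b" by blast
  define m where "m = (\<Sum>k\<in>freqs N. 2 * \<bar>fwt N k\<bar>)"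
  have m0: "m \<ge> 0" unfolding m_def by (intro sum_nonneg) auto
  have cm: "c (\<lambda>k. fwt N k * fcos k f) (\<lambda>k. fwt N k * fsin k f) \<le> m * L1_norm f" if "f \<in> L1" for f
    unfolding c_def m_def sum_distrib_right
  proof (rule sum_mono)
    fix k
    have "\<bar>fwt N k\<bar> * (\<bar>fcos k f\<bar> + \<bar>fsin k f\<bar>) \<le> \<bar>fwt N k\<bar> * (2 * L1_norm f)"
      using abs_fcos_le[OF that, of k] abs_fsin_le[OF that, of k] by (intro mult_left_mono) auto
    then show "\<bar>fwt N k * fcos k f\<bar> + \<bar>fwt N k * fsin k f\<bar> \<le> 2 * \<bar>fwt N k\<bar> * L1_norm f"
      by (simp add: abs_mult distrib_left)
  qed
  show ?thesis
  proof (rule that[of "(1 + q) * m"])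
    show "0 \<le> (1 + q) * m" using q m0 by simp
    fix f assume f: "f \<in> L1"
    show "fejer_proj N f \<in> W1 i" unfolding fejer_proj_trig[OF f] by (rule q)
    have 1: "q * c (\<lambda>k. fwt N k * fcos k f) (\<lambda>k. fwt N k * fsin k f) \<le> q * (m * L1_norm f)"
      using cm[OF f] q(1) by (rule mult_left_mono)
    have 2: "0 \<le> m * L1_norm f" "0 \<le> q * (m * L1_norm f)" using m0 q(1) by auto
    have "W1_norm i (fejer_proj N f) \<le> q * (m * L1_norm f)"
      unfolding fejer_proj_trig[OF f] using q(3) 1 order_trans by blast
    also have "\<dots> \<le> (1 + q) * m * L1_norm f" using 2 by (simp add: algebra_simps)
    finally show "W1_norm i (fejer_proj N f) \<le> (1 + q) * m * L1_norm f" .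
    fix x
    have "\<bar>fejer_proj N f x\<bar> \<le> m * L1_norm f"
      unfolding fejer_proj_trig[OF f] using trig_abs_le cm[OF f] unfolding c_def by (rule order_trans)
    also have "\<dots> \<le> (1 + q) * m * L1_norm f" using 2 by (simp add: algebra_simps)
    finally show "\<bar>fejer_proj N f x\<bar> \<le> (1 + q) * m * L1_norm f" .
  qed
qed

section \<open>Transfer operators of circle maps\<close>

definition C1_lift :: "(real \<Rightarrow> real) \<Rightarrow> (real \<Rightarrow> real) \<Rightarrow> bool" where
  "C1_lift S S1 \<longleftrightarrow> (\<exists>d::int. \<forall>x. S (x + 1) = S x + of_int d) \<and>
     (\<forall>x. (S has_real_derivative S1 x) (at x)) \<and> continuous_on UNIV S1 \<and> (\<forall>x. S1 x \<noteq> 0)"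

lemma C1_liftD:
  assumes "C1_lift S S1"
  shows "(S has_real_derivative S1 x) (at x)" "continuous_on UNIV S1" "S1 x \<noteq> 0"
    "continuous_on UNIV S" "S \<in> borel_measurable borel"
proof -
  show 1: "(S has_real_derivative S1 x) (at x)" "continuous_on UNIV S1" "S1 x \<noteq> 0" for x
    using assms by (auto simp: C1_lift_def)
  show "continuous_on UNIV S"
    using 1(1) by (meson DERIV_isCont continuous_at_imp_continuous_on)
  then show "S \<in> borel_measurable borel" by (rule borel_measurable_continuous_onI)
qed

lemma periodic1_comp_lift:
  assumes "C1_lift S S1" "periodic1 \<phi>"
  shows "periodic1 (\<lambda>x. \<phi> (S x))"
proof -
  obtain d :: int where "\<And>x. S (x + 1) = S x + of_int d" using assms(1) by (auto simp: C1_lift_def)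
  then show ?thesis using periodic1_of_int[OF assms(2)] by (simp add: periodic1_def)
qed

lemma AE_lborelE:
  assumes "AE x in lborel. Q x"
  obtains Z where "Z \<in> null_sets lborel" "\<And>x. x \<notin> Z \<Longrightarrow> Q x"
  using assms by (rule AE_E3) (use that in auto)

text \<open>Change of variables: the integral of the indicator of \<open>S\<^sup>-\<^sup>1 Z\<close> against the positive weight \<open>S'\<close>
  is the measure of a part of \<open>Z\<close>.\<close>

lemma AE_comp_increasing:
  fixes S S1 :: "real \<Rightarrow> real"
  assumes "\<And>x. (S has_real_derivative S1 x) (at x)" "continuous_on UNIV S1" "\<And>x. S1 x > 0"
    and Z: "Z \<in> null_sets lborel"
  shows "AE x in circ. S x \<notin> Z"
proof -
  have mS: "S \<in> borel_measurable borel"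
    using assms(1) by (meson DERIV_isCont continuous_at_imp_continuous_on borel_measurable_continuous_onI)
  have mS1: "S1 \<in> borel_measurable borel" using assms(2) by (rule borel_measurable_continuous_onI)
  have Zb: "Z \<in> sets borel" using Z by auto
  let ?f = "\<lambda>x. indicator Z x :: ennreal"
  have "(\<integral>\<^sup>+x. ?f (S x) * S1 x * indicator {0..1} x \<partial>lborel) = (\<integral>\<^sup>+x. ?f x * indicator {S 0..S 1} x \<partial>lborel)"
    by (rule nn_integral_substitution_aux[symmetric])
       (use assms(1,3) Zb continuous_on_subset[OF assms(2)] in \<open>auto simp: less_imp_le\<close>)
  also have "\<dots> \<le> (\<integral>\<^sup>+x. ?f x \<partial>lborel)"
    by (intro nn_integral_mono) (auto split: split_indicator)
  also have "\<dots> = 0" using Z Zb by (simp add: nn_integral_indicator null_setsD1)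
  finally have z: "(\<integral>\<^sup>+x. ?f (S x) * S1 x * indicator {0..1} x \<partial>lborel) = 0" by simp
  have "AE x in lborel. ?f (S x) * S1 x * indicator {0..1} x = 0"
    using z by (subst (asm) nn_integral_0_iff_AE) (use mS mS1 Zb in measurable)
  then show ?thesis
    unfolding AE_circ
    by eventually_elim (use assms(3) in \<open>auto split: split_indicator_asm simp: ennreal_eq_0_iff simp flip: not_less\<close>)
qed

lemma AE_comp_lift_null:
  assumes S: "C1_lift S S1" and Z: "Z \<in> null_sets lborel"
  shows "AE x in circ. S x \<notin> Z"
proof -
  have "(\<forall>x. S1 x > 0) \<or> (\<forall>x. S1 x < 0)"
  proof (rule ccontr)
    assume "\<not> ?thesis"
    then obtain x y where "S1 x < 0" "S1 y > 0"
      using C1_liftD(3)[OF S] by (metis linorder_less_linear)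
    moreover have "connected (range S1)" using C1_liftD(2)[OF S] by (intro connected_continuous_image) auto
    ultimately have "0 \<in> range S1"
      using connectedD_interval[of "range S1" "S1 x" "S1 y" 0] by (auto simp: less_imp_le)
    then show False using C1_liftD(3)[OF S] by auto
  qed
  then show ?thesis
  proof
    assume "\<forall>x. S1 x > 0"
    then show ?thesis using AE_comp_increasing[OF C1_liftD(1,2)[OF S] _ Z] by blast
  next
    assume neg: "\<forall>x. S1 x < 0"
    have "AE x in distr lborel borel uminus. x \<notin> Z" using Z by (simp add: lborel_distr_uminus AE_not_in)
    then have "AE x in lborel. - x \<notin> Z"
      by (subst (asm) AE_distr_iff) (use Z in auto)
    then obtain Z' where Z': "Z' \<in> null_sets lborel" "\<And>x. x \<notin> Z' \<Longrightarrow> - x \<notin> Z"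
      using AE_lborelE by blast
    have "AE x in circ. - S x \<notin> Z'"
      by (rule AE_comp_increasing[of "\<lambda>x. - S x" "\<lambda>x. - S1 x", OF _ _ _ Z'(1)])
         (use C1_liftD(1,2)[OF S] neg in \<open>auto intro!: derivative_eq_intros continuous_intros\<close>)
    then show ?thesis
      by eventually_elim (use Z'(2)[of "- S _"] in simp)
  qed
qed

lemma AE_circ_frac:
  assumes "AE x in circ. Q x"
  shows "AE y in lborel. Q (frac y)"
proof -
  have "AE x in lborel. x \<in> {0..<1} \<longrightarrow> Q x" using assms by (simp only: AE_circ)
  then obtain Z where Z: "Z \<in> null_sets lborel" "\<And>x. x \<notin> Z \<Longrightarrow> x \<in> {0..<1} \<longrightarrow> Q x"
    using AE_lborelE by blast
  have "AE y in lborel. y - of_int k \<notin> Z" for k :: int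
    using AE_not_in[OF null_sets_translation[OF Z(1), of "of_int k"]] by simp
  then have "AE y in lborel. \<forall>k::int. y - of_int k \<notin> Z" by (simp add: AE_all_countable)
  then show ?thesis
  proof eventually_elim
    fix y :: real assume "\<forall>k::int. y - of_int k \<notin> Z"
    then have "frac y \<notin> Z" by (simp add: frac_def)
    then show "Q (frac y)" using Z(2)[of "frac y"] frac_lt_1[of y] by simp
  qed
qed

lemma AE_comp_lift:
  assumes S: "C1_lift S S1" and Q: "AE x in circ. Q x"
  shows "AE x in circ. Q (frac (S x))"
proof -
  obtain Z where Z: "Z \<in> null_sets lborel" "\<And>y. y \<notin> Z \<Longrightarrow> Q (frac y)"
    using AE_circ_frac[OF Q] AE_lborelE by blast
  from AE_comp_lift_null[OF S Z(1)] show ?thesis by eventually_elim (use Z(2) in auto)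
qed

lemma LinfD:
  "\<phi> \<in> Linf \<Longrightarrow> periodic1 \<phi>" "\<phi> \<in> Linf \<Longrightarrow> \<phi> \<in> borel_measurable borel" "\<phi> \<in> Linf \<Longrightarrow> \<phi> \<in> borel_measurable circ"
  by (auto simp: Linf_def intro: periodic1_borel)

lemma Linf_comp_lift:
  assumes S: "C1_lift S S1" and \<phi>: "\<phi> \<in> Linf"
  shows "(\<lambda>x. \<phi> (S x)) \<in> Linf"
proof -
  obtain C where C: "AE x in circ. \<bar>\<phi> x\<bar> \<le> C" using \<phi> by (auto simp: Linf_def)
  have "AE x in circ. \<bar>\<phi> (S x)\<bar> \<le> C"
    using AE_comp_lift[OF S C] by (simp add: periodic1_frac[OF LinfD(1)[OF \<phi>]])
  moreover have "(\<lambda>x. \<phi> (S x)) \<in> borel_measurable circ"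
    by (intro measurable_circ measurable_compose[OF C1_liftD(5)[OF S] LinfD(2)[OF \<phi>]])
  ultimately show ?thesis
    using periodic1_comp_lift[OF S LinfD(1)[OF \<phi>]] by (auto simp: Linf_def)
qed

lemma Linf_bounded:
  assumes "periodic1 \<phi>" "\<phi> \<in> borel_measurable borel" "\<And>x. \<bar>\<phi> x\<bar> \<le> b"
  shows "\<phi> \<in> Linf"
  using assms measurable_circ[OF assms(2)] by (auto simp: Linf_def)

lemma Linf_cont: "periodic1 \<phi> \<Longrightarrow> continuous_on UNIV \<phi> \<Longrightarrow> \<phi> \<in> Linf"
  by (metis Linf_bounded borel_measurable_continuous_onI periodic1_cont_bounded)

lemma integrable_Linf_L1: "\<phi> \<in> Linf \<Longrightarrow> f \<in> L1 \<Longrightarrow> integrable circ (\<lambda>x. \<phi> x * f x)"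
  using integrable_mult_bounded[of f \<phi>] by (auto simp: Linf_def L1D)

lemma is_transferD:
  "is_transfer S \<psi> u \<Longrightarrow> u \<in> L1"
  "is_transfer S \<psi> u \<Longrightarrow> \<phi> \<in> Linf \<Longrightarrow> (\<integral>x. \<phi> (S x) * \<psi> x \<partial>circ) = (\<integral>x. \<phi> x * u x \<partial>circ)"
  by (auto simp: is_transfer_def)

lemma is_transfer_linear:
  assumes S: "C1_lift S S1" and "\<psi> \<in> L1" "\<omega> \<in> L1" "is_transfer S \<psi> u" "is_transfer S \<omega> w"
  shows "is_transfer S (\<lambda>x. c * \<psi> x + d * \<omega> x) (\<lambda>x. c * u x + d * w x)"
  unfolding is_transfer_def
proof (intro conjI ballI)
  have L: "u \<in> L1" "w \<in> L1" using assms by (auto dest: is_transferD)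
  then show "(\<lambda>x. c * u x + d * w x) \<in> L1" by (intro L1_add L1_cmult)
  fix \<phi> assume \<phi>: "\<phi> \<in> Linf"
  have i: "integrable circ (\<lambda>x. \<phi> (S x) * \<psi> x)" "integrable circ (\<lambda>x. \<phi> (S x) * \<omega> x)"
    using integrable_Linf_L1[OF Linf_comp_lift[OF S \<phi>]] assms by auto
  have "(\<integral>x. \<phi> (S x) * (c * \<psi> x + d * \<omega> x) \<partial>circ)
      = (\<integral>x. c * (\<phi> (S x) * \<psi> x) + d * (\<phi> (S x) * \<omega> x) \<partial>circ)" by (simp add: algebra_simps)
  also have "\<dots> = c * (\<integral>x. \<phi> x * u x \<partial>circ) + d * (\<integral>x. \<phi> x * w x \<partial>circ)"
    using i is_transferD(2)[OF assms(4) \<phi>] is_transferD(2)[OF assms(5) \<phi>] by simp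
  also have "\<dots> = (\<integral>x. c * (\<phi> x * u x) + d * (\<phi> x * w x) \<partial>circ)"
    using integrable_Linf_L1[OF \<phi>] L by simp
  also have "\<dots> = (\<integral>x. \<phi> x * (c * u x + d * w x) \<partial>circ)" by (simp add: algebra_simps)
  finally show "(\<integral>x. \<phi> (S x) * (c * \<psi> x + d * \<omega> x) \<partial>circ) = (\<integral>x. \<phi> x * (c * u x + d * w x) \<partial>circ)" .
qed

text \<open>Push the measure with density \<open>\<psi>\<close> forward; it stays absolutely continuous because the map is
  nonsingular, and its Radon-Nikodym density is the transferred function.\<close>

lemma is_transfer_exists_nonneg:
  assumes S: "C1_lift S S1" and \<psi>: "\<psi> \<in> L1" "\<And>x. \<psi> x \<ge> 0"
  shows "\<exists>u. is_transfer S \<psi> u"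
proof -
  define M where "M = density circ (\<lambda>x. ennreal (\<psi> x))"
  define F where "F x = frac (S x)" for x
  have F[measurable]: "F \<in> measurable circ circ"
  proof -
    have "S \<in> measurable circ borel" using C1_liftD(5)[OF S] by (rule measurable_circ)
    then show ?thesis unfolding F_def by measurable
  qed
  note \<psi>m[measurable] = L1D(3)[OF \<psi>(1)]
  have setsM: "sets M = sets circ" "space M = space circ" by (simp_all add: M_def)
  have FM[measurable]: "F \<in> measurable M circ" using F by (simp add: M_def cong: measurable_cong_sets)
  define N where "N = distr M circ F"
  have setsN: "sets N = sets circ" by (simp add: N_def)
  have ac: "absolutely_continuous circ N"
    unfolding absolutely_continuous_def
  proof
    fix A assume A: "A \<in> null_sets circ"
    then have As: "A \<in> sets circ" by auto
    have "AE x in circ. x \<notin> A" using A by (rule AE_not_in)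
    then have "AE x in circ. F x \<notin> A" using AE_comp_lift[OF S] by (simp add: F_def)
    then have "AE x in M. F x \<notin> A" unfolding M_def by (subst AE_density) auto
    then have "AE x in N. x \<notin> A" unfolding N_def
    proof (subst AE_distr_iff)
      show "{x \<in> space circ. x \<notin> A} \<in> sets circ"
        using sets.compl_sets[OF As] by (simp only: set_diff_eq)
    qed auto
    then show "A \<in> null_sets N" using As setsN by (subst AE_iff_null_sets) auto
  qed
  obtain f where f: "f \<in> borel_measurable circ" "density circ f = N"
    using circ.Radon_Nikodym[OF ac setsN] by auto
  have finN: "(\<integral>\<^sup>+x. f x \<partial>circ) \<noteq> \<infinity>"
  proof -
    have "(\<integral>\<^sup>+x. f x \<partial>circ) = emeasure N (space circ)"
      unfolding f(2)[symmetric] using f(1)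
      by (subst emeasure_density) (auto intro!: nn_integral_cong simp del: space_circ)
    also have "\<dots> = emeasure M (space circ)"
    proof -
      have "F -` space circ \<inter> space M = space circ" using measurable_space[OF F] by (auto simp: setsM)
      then show ?thesis unfolding N_def by (subst emeasure_distr) (auto simp del: space_circ)
    qed
    also have "\<dots> = (\<integral>\<^sup>+x. \<psi> x \<partial>circ)"
      unfolding M_def by (subst emeasure_density) (auto intro!: nn_integral_cong simp del: space_circ)
    also have "\<dots> < \<infinity>" using L1D(2)[OF \<psi>(1)] \<psi>(2) by (simp add: integrable_iff_bounded)
    finally show ?thesis by simp
  qed
  define v where "v x = enn2real (f x)" for x
  have fv: "AE x in circ. f x = ennreal (v x)"
    using nn_integral_PInf_AE[OF f(1) finN] by eventually_elim (simp add: v_def top.not_eq_extremum)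
  have vm[measurable]: "v \<in> borel_measurable circ"
    unfolding v_def by (rule borel_measurable_enn2real[OF f(1)])
  have v_int: "integrable circ v"
  proof (rule integrableI_bounded[OF vm])
    have "(\<integral>\<^sup>+x. ennreal (norm (v x)) \<partial>circ) = (\<integral>\<^sup>+x. f x \<partial>circ)"
      using fv by (intro nn_integral_cong_AE) (auto simp: v_def)
    then show "(\<integral>\<^sup>+x. ennreal (norm (v x)) \<partial>circ) < \<infinity>"
      using finN by (simp add: top.not_eq_extremum)
  qed
  have N_v: "N = density circ (\<lambda>x. ennreal (v x))"
    unfolding f(2)[symmetric] by (rule density_cong[OF f(1) _ fv]) simp
  define u where "u x = v (frac x)" for x
  have uv: "u x = v x" if "x \<in> space circ" for x using that by (simp add: u_def frac_eq)
  show ?thesis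
  proof (intro exI[of _ u], unfold is_transfer_def, intro conjI ballI)
    have "integrable circ u" using v_int uv by (subst Bochner_Integration.integrable_cong) auto
    moreover have "periodic1 u" by (simp add: u_def periodic1_def frac_def)
    ultimately show "u \<in> L1" by (simp add: L1_def)
    fix \<phi> assume \<phi>: "\<phi> \<in> Linf"
    note \<phi>m[measurable] = LinfD(3)[OF \<phi>]
    have "(\<integral>x. \<phi> (S x) * \<psi> x \<partial>circ) = (\<integral>x. \<psi> x *\<^sub>R \<phi> (F x) \<partial>circ)"
      by (simp add: F_def periodic1_frac[OF LinfD(1)[OF \<phi>]] mult.commute)
    also have "\<dots> = (\<integral>x. \<phi> (F x) \<partial>M)"
      unfolding M_def using \<psi>(2) by (intro integral_density[symmetric]) auto
    also have "\<dots> = (\<integral>x. \<phi> x \<partial>N)" unfolding N_def by (intro integral_distr[symmetric]) auto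
    also have "\<dots> = (\<integral>x. v x *\<^sub>R \<phi> x \<partial>circ)"
      unfolding N_v by (intro integral_density \<phi>m vm) (simp add: v_def)
    also have "\<dots> = (\<integral>x. \<phi> x * u x \<partial>circ)"
      by (rule Bochner_Integration.integral_cong) (auto simp: uv)
    finally show "(\<integral>x. \<phi> (S x) * \<psi> x \<partial>circ) = (\<integral>x. \<phi> x * u x \<partial>circ)" .
  qed
qed

lemma is_transfer_exists:
  assumes S: "C1_lift S S1" and \<psi>: "\<psi> \<in> L1"
  shows "\<exists>u. is_transfer S \<psi> u"
proof -
  let ?p = "\<lambda>x. (\<bar>\<psi> x\<bar> + \<psi> x) / 2" and ?n = "\<lambda>x. (\<bar>\<psi> x\<bar> - \<psi> x) / 2"
  have L: "?p \<in> L1" "?n \<in> L1"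
    using L1_cmult[OF L1_add[OF L1_abs[OF \<psi>] \<psi>], of "1/2"] L1_cmult[OF L1_diff[OF L1_abs[OF \<psi>] \<psi>], of "1/2"] by auto
  obtain u w where "is_transfer S ?p u" "is_transfer S ?n w"
    using is_transfer_exists_nonneg[OF S L(1)] is_transfer_exists_nonneg[OF S L(2)] by fastforce
  from is_transfer_linear[OF S L this, of 1 "-1"] have "is_transfer S (\<lambda>x. 1 * ?p x + -1 * ?n x) (\<lambda>x. 1 * u x + -1 * w x)" .
  moreover have "(\<lambda>x. 1 * ?p x + -1 * ?n x) = \<psi>" by (simp add: fun_eq_iff field_simps)
  ultimately show ?thesis by metis
qed

lemma transfer_op_is_transfer:
  assumes "C1_lift S S1" "\<psi> \<in> L1"
  shows "is_transfer S \<psi> (transfer_op S \<psi>)"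
  unfolding transfer_op_def using is_transfer_exists[OF assms] by (rule someI_ex)

lemma transfer_op_L1: "C1_lift S S1 \<Longrightarrow> \<psi> \<in> L1 \<Longrightarrow> transfer_op S \<psi> \<in> L1"
  using transfer_op_is_transfer is_transferD(1) by blast

lemma smooth_per_Linf: "smooth_per \<phi> \<Longrightarrow> \<phi> \<in> Linf"
  using Linf_cont per_C1D(1,4) smooth_per_per_C1 by blast

lemma is_transfer_unique:
  assumes "is_transfer S \<psi> u" "is_transfer S \<psi> w"
  shows "AE x in circ. u x = w x"
  by (rule L1_eq_AE_dual) (use assms is_transferD smooth_per_Linf in metis)+

lemma is_transfer_L1_norm:
  assumes S: "C1_lift S S1" and "\<psi> \<in> L1" "is_transfer S \<psi> u"
  shows "L1_norm u \<le> L1_norm \<psi>"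
proof (rule L1_norm_dual)
  show "u \<in> L1" using assms by (auto dest: is_transferD)
  fix \<phi> :: "real \<Rightarrow> real" assume \<phi>: "smooth_per \<phi>" "\<And>x. \<bar>\<phi> x\<bar> \<le> 1"
  have "(\<integral>x. \<phi> x * u x \<partial>circ) = (\<integral>x. \<phi> (S x) * \<psi> x \<partial>circ)"
    using is_transferD(2)[OF assms(3) smooth_per_Linf[OF \<phi>(1)]] by simp
  also have "\<dots> \<le> 1 * L1_norm \<psi>"
    using abs_integral_mult_le[OF assms(2) LinfD(3)[OF Linf_comp_lift[OF S smooth_per_Linf[OF \<phi>(1)]]], of 1] \<phi>(2) by auto
  finally show "(\<integral>x. \<phi> x * u x \<partial>circ) \<le> L1_norm \<psi>" by simp
qed

lemma is_transfer_integral: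
  assumes "is_transfer S \<psi> u"
  shows "(\<integral>x. u x \<partial>circ) = (\<integral>x. \<psi> x \<partial>circ)"
proof -
  have "(\<lambda>_. 1) \<in> Linf" by (rule Linf_bounded[of _ 1]) (auto simp: periodic1_def)
  from is_transferD(2)[OF assms this] show ?thesis by simp
qed

text \<open>Nonnegativity follows from mass: the \<open>L\<^sup>1\<close> norm of \<open>u\<close> is at most one, and one is its integral.\<close>

lemma is_transfer_D1:
  assumes S: "C1_lift S S1" and \<psi>: "\<psi> \<in> D1" and u: "is_transfer S \<psi> u"
  shows "u \<in> D1"
proof -
  have L: "\<psi> \<in> L1" "u \<in> L1" using \<psi> u by (auto simp: D1_def dest: is_transferD)
  have I: "(\<integral>x. u x \<partial>circ) = 1" using is_transfer_integral[OF u] \<psi> by (simp add: D1_def)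
  have "L1_norm \<psi> = (\<integral>x. \<psi> x \<partial>circ)"
    unfolding L1_norm_def
  proof (rule integral_cong_AE)
    show "AE x in circ. \<bar>\<psi> x\<bar> = \<psi> x" using \<psi> by (auto simp: D1_def)
  qed (use L1D(3)[OF L(1)] in measurable)
  then have "L1_norm u \<le> 1" using is_transfer_L1_norm[OF S L(1) u] \<psi> by (simp add: D1_def)
  moreover have "L1_norm (\<lambda>x. \<bar>u x\<bar> - u x) = L1_norm u - 1"
    using L(2) I by (simp add: L1_norm_def L1D)
  ultimately have "L1_norm (\<lambda>x. \<bar>u x\<bar> - u x) \<le> 0" by simp
  from L1_norm_eq_0[OF L1_diff[OF L1_abs[OF L(2)] L(2)] this]
  have "AE x in circ. 0 \<le> u x" by eventually_elim linarith
  then show ?thesis using I L by (simp add: D1_def)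
qed

lemma transfer_op_cong:
  assumes S: "C1_lift S S1" and "\<psi> \<in> L1" "\<omega> \<in> L1" "AE x in circ. \<psi> x = \<omega> x"
  shows "transfer_op S \<psi> = transfer_op S \<omega>"
proof -
  have "(\<integral>x. \<phi> (S x) * \<psi> x \<partial>circ) = (\<integral>x. \<phi> (S x) * \<omega> x \<partial>circ)" if "\<phi> \<in> Linf" for \<phi>
    by (rule integral_mult_cong_AE[OF assms(2-4)]) (rule LinfD(3)[OF Linf_comp_lift[OF S that]])
  then show ?thesis unfolding transfer_op_def is_transfer_def by simp
qed

lemma is_transfer_comp:
  assumes "C1_lift S S1" "is_transfer R \<psi> w" "is_transfer S w u"
  shows "is_transfer (S \<circ> R) \<psi> u"
  unfolding is_transfer_def
proof (intro conjI ballI)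
  show "u \<in> L1" using assms by (auto dest: is_transferD)
  fix \<phi> assume \<phi>: "\<phi> \<in> Linf"
  show "(\<integral>x. \<phi> ((S \<circ> R) x) * \<psi> x \<partial>circ) = (\<integral>x. \<phi> x * u x \<partial>circ)"
    using is_transferD(2)[OF assms(2) Linf_comp_lift[OF assms(1) \<phi>]] is_transferD(2)[OF assms(3) \<phi>] by simp
qed

lemma transfer_op_linear_AE:
  assumes S: "C1_lift S S1" and "\<psi> \<in> L1" "\<omega> \<in> L1"
  shows "AE x in circ. transfer_op S (\<lambda>x. c * \<psi> x + d * \<omega> x) x = c * transfer_op S \<psi> x + d * transfer_op S \<omega> x"
proof (rule is_transfer_unique)
  show "is_transfer S (\<lambda>x. c * \<psi> x + d * \<omega> x) (transfer_op S (\<lambda>x. c * \<psi> x + d * \<omega> x))"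
    using assms by (intro transfer_op_is_transfer[OF S] L1_add L1_cmult)
  show "is_transfer S (\<lambda>x. c * \<psi> x + d * \<omega> x) (\<lambda>x. c * transfer_op S \<psi> x + d * transfer_op S \<omega> x)"
    by (rule is_transfer_linear[OF assms]) (use assms transfer_op_is_transfer in blast)+
qed

section \<open>Regularity of transfer operators and their dependence on the map\<close>

text \<open>The functions \<open>S1\<close>, \<open>S2\<close>, \<open>S3\<close> are the successive derivatives.\<close>

definition expanding_lift ::
  "(real \<Rightarrow> real) \<Rightarrow> (real \<Rightarrow> real) \<Rightarrow> (real \<Rightarrow> real) \<Rightarrow> (real \<Rightarrow> real) \<Rightarrow> real \<Rightarrow> bool" where
  "expanding_lift S S1 S2 S3 c \<longleftrightarrow> (\<exists>d::int. \<forall>x. S (x + 1) = S x + of_int d) \<and>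
     (\<forall>x. (S has_real_derivative S1 x) (at x)) \<and> per_C1 S1 S2 \<and> per_C1 S2 S3 \<and>
     (\<forall>x. 1 \<le> \<bar>S1 x\<bar>) \<and> (\<forall>x. \<bar>S2 x\<bar> \<le> c) \<and> (\<forall>x. \<bar>S3 x\<bar> \<le> c)"

lemma expanding_lift_C1: "expanding_lift S S1 S2 S3 c \<Longrightarrow> C1_lift S S1"
  unfolding expanding_lift_def C1_lift_def by (metis abs_zero not_one_le_zero per_C1D(4))

lemma expanding_liftD:
  assumes "expanding_lift S S1 S2 S3 c"
  shows "(S has_real_derivative S1 x) (at x)" "per_C1 S1 S2" "per_C1 S2 S3"
    "1 \<le> \<bar>S1 x\<bar>" "S1 x \<noteq> 0" "\<bar>S2 x\<bar> \<le> c" "\<bar>S3 x\<bar> \<le> c" "0 \<le> c"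
proof -
  show 1: "(S has_real_derivative S1 x) (at x)" "per_C1 S1 S2" "per_C1 S2 S3"
    "1 \<le> \<bar>S1 x\<bar>" "\<bar>S2 x\<bar> \<le> c" "\<bar>S3 x\<bar> \<le> c" for x
    using assms by (auto simp: expanding_lift_def)
  show "S1 x \<noteq> 0" using 1(4)[of x] by auto
  show "0 \<le> c" using 1(5)[of 0] by linarith
qed

text \<open>The first and second derivative of \<open>1 / S1\<close>.\<close>

abbreviation rec1 :: "(real \<Rightarrow> real) \<Rightarrow> (real \<Rightarrow> real) \<Rightarrow> real \<Rightarrow> real" where
  "rec1 S1 S2 \<equiv> (\<lambda>x. - S2 x / (S1 x)\<^sup>2)"

abbreviation rec2 :: "(real \<Rightarrow> real) \<Rightarrow> (real \<Rightarrow> real) \<Rightarrow> (real \<Rightarrow> real) \<Rightarrow> real \<Rightarrow> real" where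
  "rec2 S1 S2 S3 \<equiv> (\<lambda>x. - S3 x / (S1 x)\<^sup>2 + 2 * (S2 x)\<^sup>2 / (S1 x) ^ 3)"

lemma per_C1_rec:
  assumes "expanding_lift S S1 S2 S3 c"
  shows "per_C1 (\<lambda>x. 1 / S1 x) (rec1 S1 S2)"
  using expanding_liftD(5)[OF assms] per_C1D[OF expanding_liftD(2)[OF assms]]
  unfolding per_C1_def periodic1_def
  by (auto intro!: derivative_eq_intros continuous_intros simp: power2_eq_square field_simps)

lemma per_C1_rec1:
  assumes "expanding_lift S S1 S2 S3 c"
  shows "per_C1 (rec1 S1 S2) (rec2 S1 S2 S3)"
proof -
  note nz = expanding_liftD(5)[OF assms]
  note A = per_C1D[OF expanding_liftD(2)[OF assms]] and A2 = per_C1D[OF expanding_liftD(3)[OF assms]]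
  have "(rec1 S1 S2 has_real_derivative rec2 S1 S2 S3 x) (at x)" for x
    using nz[of x] A(2)[of x] A2(2)[of x]
    by (auto intro!: derivative_eq_intros simp: power2_eq_square power3_eq_cube field_simps)
  then show ?thesis
    using nz A A2 unfolding per_C1_def periodic1_def by (auto intro!: continuous_intros)
qed

lemma rec_bounds:
  assumes "expanding_lift S S1 S2 S3 c"
  shows "\<bar>1 / S1 x\<bar> \<le> 1" "\<bar>rec1 S1 S2 x\<bar> \<le> c" "\<bar>rec2 S1 S2 S3 x\<bar> \<le> c + 2 * c\<^sup>2"
proof -
  note B = expanding_liftD[OF assms]
  show "\<bar>1 / S1 x\<bar> \<le> 1" using B(4)[of x] by (simp add: divide_le_eq)
  have p2: "1 \<le> (S1 x)\<^sup>2" using one_le_power[OF B(4)[of x], of 2] by simp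
  have p3: "1 \<le> \<bar>S1 x\<bar> ^ 3" using B(4)[of x] by (rule one_le_power)
  show "\<bar>rec1 S1 S2 x\<bar> \<le> c"
    using frac_le[of c "\<bar>S2 x\<bar>" 1 "(S1 x)\<^sup>2"] B(6)[of x] B(8) p2 by (simp add: abs_divide)
  have "\<bar>S3 x\<bar> / (S1 x)\<^sup>2 \<le> c"
    using frac_le[of c "\<bar>S3 x\<bar>" 1 "(S1 x)\<^sup>2"] B(7)[of x] B(8) p2 by simp
  moreover have "2 * (S2 x)\<^sup>2 / \<bar>S1 x\<bar> ^ 3 \<le> 2 * c\<^sup>2"
  proof -
    have "(S2 x)\<^sup>2 \<le> c\<^sup>2" using B(6)[of x] B(8) by (simp add: abs_le_square_iff[symmetric])
    then show ?thesis using frac_le[of "2 * c\<^sup>2" "2 * (S2 x)\<^sup>2" 1 "\<bar>S1 x\<bar> ^ 3"] p3 by simp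
  qed
  ultimately show "\<bar>rec2 S1 S2 S3 x\<bar> \<le> c + 2 * c\<^sup>2"
    using abs_triangle_ineq[of "- S3 x / (S1 x)\<^sup>2" "2 * (S2 x)\<^sup>2 / (S1 x) ^ 3"]
    by (simp add: abs_divide power_abs)
qed

definition C2_close where
  "C2_close S S1 S2 R R1 R2 \<eta> \<longleftrightarrow>
     (\<forall>x::real. \<bar>S x - R x\<bar> \<le> \<eta> \<and> \<bar>S1 x - R1 x\<bar> \<le> \<eta> \<and> \<bar>S2 x - R2 x\<bar> \<le> (\<eta>::real))"

lemma rec_close:
  assumes S: "expanding_lift S S1 S2 S3 c" and R: "expanding_lift R R1 R2 R3 c"
    and cl: "C2_close S S1 S2 R R1 R2 \<eta>"
  shows "\<bar>1 / S1 x - 1 / R1 x\<bar> \<le> \<eta>" "\<bar>rec1 S1 S2 x - rec1 R1 R2 x\<bar> \<le> (1 + 2 * c) * \<eta>"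
proof -
  define a b where "a = 1 / S1 x" and "b = 1 / R1 x"
  have ab: "\<bar>a\<bar> \<le> 1" "\<bar>b\<bar> \<le> 1" unfolding a_def b_def by (rule rec_bounds[OF S], rule rec_bounds[OF R])
  have e: "\<bar>S1 x - R1 x\<bar> \<le> \<eta>" "\<bar>S2 x - R2 x\<bar> \<le> \<eta>" using cl by (auto simp: C2_close_def)
  have "a - b = (R1 x - S1 x) * (a * b)"
    using expanding_liftD(5)[OF S, of x] expanding_liftD(5)[OF R, of x] by (simp add: a_def b_def field_simps)
  moreover have "\<bar>R1 x - S1 x\<bar> * (\<bar>a\<bar> * \<bar>b\<bar>) \<le> \<eta> * (1 * 1)"
    using ab e by (intro mult_mono) auto
  ultimately have d: "\<bar>a - b\<bar> \<le> \<eta>" by (simp add: abs_mult)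
  then show "\<bar>1 / S1 x - 1 / R1 x\<bar> \<le> \<eta>" by (simp add: a_def b_def)
  have "rec1 S1 S2 x - rec1 R1 R2 x = - (S2 x - R2 x) * (a * a) - R2 x * ((a - b) * (a + b))"
  proof -
    have "rec1 S1 S2 x = - S2 x * (a * a)" "rec1 R1 R2 x = - R2 x * (b * b)"
      by (simp_all add: a_def b_def power2_eq_square)
    then show ?thesis by (simp add: algebra_simps)
  qed
  moreover have "\<bar>S2 x - R2 x\<bar> * (\<bar>a\<bar> * \<bar>a\<bar>) \<le> \<eta> * (1 * 1)"
    using ab e by (intro mult_mono) auto
  moreover have "\<bar>R2 x\<bar> * (\<bar>a - b\<bar> * \<bar>a + b\<bar>) \<le> c * (\<eta> * 2)"
    using ab d expanding_liftD(6,8)[OF R] by (intro mult_mono) auto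
  ultimately have "\<bar>rec1 S1 S2 x - rec1 R1 R2 x\<bar> \<le> \<eta> + c * (\<eta> * 2)"
    using abs_triangle_ineq4[of "- (S2 x - R2 x) * (a * a)" "R2 x * ((a - b) * (a + b))"]
    unfolding abs_mult abs_minus_cancel by linarith
  then show "\<bar>rec1 S1 S2 x - rec1 R1 R2 x\<bar> \<le> (1 + 2 * c) * \<eta>" by (simp add: algebra_simps)
qed

lemma per_C1_comp_lift:
  assumes S: "C1_lift S S1" and S1: "periodic1 S1" and P: "per_C1 P P'"
  shows "per_C1 (\<lambda>x. P (S x)) (\<lambda>x. P' (S x) * S1 x)"
  unfolding per_C1_def
proof (intro conjI allI)
  show "periodic1 (\<lambda>x. P (S x))" using periodic1_comp_lift[OF S per_C1D(1)[OF P]] .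
  show "((\<lambda>x. P (S x)) has_real_derivative P' (S x) * S1 x) (at x)" for x
    by (rule DERIV_chain2[OF per_C1D(2)[OF P] C1_liftD(1)[OF S]])
  show "continuous_on UNIV (\<lambda>x. P' (S x) * S1 x)"
    using C1_liftD(2,4)[OF S] continuous_on_compose2[OF per_C1D(3)[OF P] C1_liftD(4)[OF S]]
    by (intro continuous_intros) auto
qed

text \<open>The identity behind the regularity and perturbation estimates: writing
  \<open>\<phi>' \<circ> S = (\<phi> \<circ> S)' / S'\<close> moves the derivative onto the function, and no inverse
  branches of the map are ever needed.\<close>

lemma transfer_by_parts:
  assumes S: "expanding_lift S S1 S2 S3 c" and f: "f \<in> L1" and u: "is_weak_deriv 1 f u" and P: "per_C1 P P'"
  shows "(\<integral>x. P' (S x) * f x \<partial>circ) = - (\<integral>x. P (S x) * (1 / S1 x * u x + rec1 S1 S2 x * f x) \<partial>circ)"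
proof -
  note C = expanding_lift_C1[OF S]
  have af: "(\<lambda>x. 1 / S1 x * f x) \<in> L1"
    by (rule L1_mult_cont[OF f per_C1D(1)[OF per_C1_rec[OF S]] per_C1D(4)[OF per_C1_rec[OF S]]])
  have "(\<integral>x. P' (S x) * f x \<partial>circ) = (\<integral>x. (1 / S1 x * f x) * (P' (S x) * S1 x) \<partial>circ)"
    using expanding_liftD(5)[OF S] by (simp add: field_simps)
  also have "\<dots> = - (\<integral>x. (1 / S1 x * u x + rec1 S1 S2 x * f x) * P (S x) \<partial>circ)"
    by (rule weak_deriv_by_parts[OF af weak_deriv_mult[OF f u per_C1_rec[OF S]]
          per_C1_comp_lift[OF C per_C1D(1)[OF expanding_liftD(2)[OF S]] P]])
  finally show ?thesis by (simp add: mult.commute)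
qed

text \<open>In operator form \<open>(L f)' = L ((f / S')')\<close>: the integration by parts above, read with a test function.\<close>

lemma is_transfer_weak_deriv:
  assumes S: "expanding_lift S S1 S2 S3 c" and f: "f \<in> L1" and u: "is_weak_deriv 1 f u"
    and v: "is_transfer S f v" and w: "is_transfer S (\<lambda>x. 1 / S1 x * u x + rec1 S1 S2 x * f x) w"
  shows "is_weak_deriv 1 v w"
  unfolding is_weak_deriv_1
proof (intro conjI allI impI)
  show "w \<in> L1" using w by (rule is_transferD)
  fix \<phi> :: "real \<Rightarrow> real" assume \<phi>: "smooth_per \<phi>"
  have "(\<integral>x. deriv \<phi> x * v x \<partial>circ) = - (\<integral>x. \<phi> x * w x \<partial>circ)"
    using transfer_by_parts[OF S f u smooth_per_per_C1[OF \<phi>]]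
      is_transferD(2)[OF v smooth_per_Linf[OF smooth_per_deriv[OF \<phi>]]]
      is_transferD(2)[OF w smooth_per_Linf[OF \<phi>]] by simp
  then show "(\<integral>x. v x * deriv \<phi> x \<partial>circ) = - (\<integral>x. w x * \<phi> x \<partial>circ)" by (simp add: mult.commute)
qed

lemma weighted_L1_norm:
  assumes "f \<in> L1" "u \<in> L1" "periodic1 a" "continuous_on UNIV a" "periodic1 b" "continuous_on UNIV b"
    "\<And>x. \<bar>a x\<bar> \<le> m" "\<And>x. \<bar>b x\<bar> \<le> m"
  shows "(\<lambda>x. a x * u x + b x * f x) \<in> L1" "L1_norm (\<lambda>x. a x * u x + b x * f x) \<le> m * (L1_norm f + L1_norm u)"
proof -
  have L: "(\<lambda>x. a x * u x) \<in> L1" "(\<lambda>x. b x * f x) \<in> L1" using assms by (auto intro: L1_mult_cont)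
  then show "(\<lambda>x. a x * u x + b x * f x) \<in> L1" by (rule L1_add)
  have "L1_norm (\<lambda>x. a x * u x) \<le> m * L1_norm u" "L1_norm (\<lambda>x. b x * f x) \<le> m * L1_norm f"
    using assms by (auto intro!: L1_norm_mult_le borel_measurable_continuous_onI)
  then show "L1_norm (\<lambda>x. a x * u x + b x * f x) \<le> m * (L1_norm f + L1_norm u)"
    using L1_norm_triangle[OF L] by (simp add: algebra_simps)
qed

lemma rec_difference_L1:
  assumes S: "expanding_lift S S1 S2 S3 c" and R: "expanding_lift R R1 R2 R3 c"
    and cl: "C2_close S S1 S2 R R1 R2 \<eta>" and L: "f \<in> L1" "u \<in> L1"
  shows "(\<lambda>x. (1 / S1 x - 1 / R1 x) * u x + (rec1 S1 S2 x - rec1 R1 R2 x) * f x) \<in> L1"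
    "L1_norm (\<lambda>x. (1 / S1 x - 1 / R1 x) * u x + (rec1 S1 S2 x - rec1 R1 R2 x) * f x)
       \<le> (1 + 2 * c) * \<eta> * (L1_norm f + L1_norm u)"
proof -
  note A = per_C1D(1,3,4,5)[OF per_C1_rec[OF S]] and B = per_C1D(1,3,4,5)[OF per_C1_rec[OF R]]
  have "0 \<le> \<eta>" using cl abs_ge_zero order_trans unfolding C2_close_def by blast
  then have 1: "\<bar>1 / S1 x - 1 / R1 x\<bar> \<le> (1 + 2 * c) * \<eta>" for x
    using rec_close(1)[OF S R cl, of x] expanding_liftD(8)[OF S] by (simp add: algebra_simps add_increasing2)
  have 2: "periodic1 (\<lambda>x. 1 / S1 x - 1 / R1 x)" "continuous_on UNIV (\<lambda>x. 1 / S1 x - 1 / R1 x)"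
    "periodic1 (\<lambda>x. rec1 S1 S2 x - rec1 R1 R2 x)" "continuous_on UNIV (\<lambda>x. rec1 S1 S2 x - rec1 R1 R2 x)"
    using A B by (auto simp only: periodic1_def intro!: continuous_on_diff)
  show "(\<lambda>x. (1 / S1 x - 1 / R1 x) * u x + (rec1 S1 S2 x - rec1 R1 R2 x) * f x) \<in> L1"
    "L1_norm (\<lambda>x. (1 / S1 x - 1 / R1 x) * u x + (rec1 S1 S2 x - rec1 R1 R2 x) * f x)
       \<le> (1 + 2 * c) * \<eta> * (L1_norm f + L1_norm u)"
    by (rule weighted_L1_norm[OF L 2 1 rec_close(2)[OF S R cl]])+
qed

text \<open>Test the difference against \<open>\<phi>\<close>; constants drop out, so \<open>\<phi>\<close> has a periodic
  Lipschitz primitive, and one integration by parts turns the difference of the maps into a factor \<open>\<eta>\<close>.\<close>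

lemma transfer_Lipschitz_L1:
  assumes S: "expanding_lift S S1 S2 S3 c" and R: "expanding_lift R R1 R2 R3 c"
    and cl: "C2_close S S1 S2 R R1 R2 \<eta>"
    and f: "f \<in> L1" and u: "is_weak_deriv 1 f u" and v: "is_transfer S f v" and w: "is_transfer R f w"
  shows "L1_norm (\<lambda>x. v x - w x) \<le> (4 + 6 * c) * \<eta> * (L1_norm f + L1_norm u)"
proof (rule L1_norm_dual)
  have c0: "0 \<le> c" using S by (rule expanding_liftD)
  have \<eta>0: "0 \<le> \<eta>" using cl abs_ge_zero order_trans unfolding C2_close_def by blast
  have vwL: "v \<in> L1" "w \<in> L1" using v w by (auto dest: is_transferD)
  then show vw: "(\<lambda>x. v x - w x) \<in> L1" by (rule L1_diff)
  have uL: "u \<in> L1" using u by (rule is_weak_deriv_L1)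
  fix \<phi> :: "real \<Rightarrow> real" assume \<phi>: "smooth_per \<phi>" "\<And>x. \<bar>\<phi> x\<bar> \<le> 1"
  note Q = per_C1D(1,4)[OF smooth_per_per_C1[OF \<phi>(1)]]
  obtain P m where P: "per_C1 P (\<lambda>x. \<phi> x - m)" "P 0 = 0" and lip: "\<And>x y. \<bar>P x - P y\<bar> \<le> 2 * \<bar>x - y\<bar>"
    using test_function_primitive[OF \<phi>] by metis
  have Pb: "\<bar>P x\<bar> \<le> 2" for x
    using lip[of "frac x" 0] P(2) periodic1_frac[OF per_C1D(1)[OF P(1)], of x] frac_lt_1[of x] by simp
  have PL: "(\<lambda>x. \<phi> x - m) \<in> Linf" using per_C1D(3,5)[OF P(1)] by (intro Linf_cont)
  let ?a = "\<lambda>x. 1 / S1 x" and ?b = "\<lambda>x. 1 / R1 x" and ?a' = "rec1 S1 S2" and ?b' = "rec1 R1 R2"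
  let ?p = "\<lambda>x. ?a x * u x + ?a' x * f x" and ?q = "\<lambda>x. ?b x * u x + ?b' x * f x"
  let ?d = "\<lambda>x. (?a x - ?b x) * u x + (?a' x - ?b' x) * f x"
  note A = per_C1D(1,3,4,5)[OF per_C1_rec[OF S]] and B = per_C1D(1,3,4,5)[OF per_C1_rec[OF R]]
  note rS = rec_bounds[OF S]
  have p: "?p \<in> L1" "L1_norm ?p \<le> (1 + c) * (L1_norm f + L1_norm u)"
  proof -
    have "\<bar>?a x\<bar> \<le> 1 + c" "\<bar>?a' x\<bar> \<le> 1 + c" for x using rS(1)[of x] rS(2)[of x] c0 by linarith+
    then show "?p \<in> L1" "L1_norm ?p \<le> (1 + c) * (L1_norm f + L1_norm u)"
      by (rule weighted_L1_norm[OF f uL A(1,3) A(4,2)])+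
  qed
  have dd: "?d \<in> L1" "L1_norm ?d \<le> (1 + 2 * c) * \<eta> * (L1_norm f + L1_norm u)"
    by (rule rec_difference_L1[OF S R cl f uL])+
  note CS = per_C1D[OF per_C1_comp_lift[OF expanding_lift_C1[OF S] per_C1D(1)[OF expanding_liftD(2)[OF S]] P(1)]]
    and CR = per_C1D[OF per_C1_comp_lift[OF expanding_lift_C1[OF R] per_C1D(1)[OF expanding_liftD(2)[OF R]] P(1)]]
  have iS: "integrable circ (\<lambda>x. P (S x) * ?p x)" "integrable circ (\<lambda>x. P (R x) * ?p x)" "integrable circ (\<lambda>x. P (R x) * ?d x)"
    using CS(1,4) CR(1,4) p(1) dd(1) by (auto intro: integrable_L1_cont)
  have iv: "integrable circ (\<lambda>x. \<phi> x * v x)" "integrable circ (\<lambda>x. \<phi> x * w x)"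
    using Q vwL by (auto intro: integrable_L1_cont)
  have "(\<integral>x. \<phi> x * (v x - w x) \<partial>circ) = (\<integral>x. (\<phi> x - m) * v x \<partial>circ) - (\<integral>x. (\<phi> x - m) * w x \<partial>circ)"
    using iv vwL is_transfer_integral[OF v] is_transfer_integral[OF w]
    by (simp add: left_diff_distrib right_diff_distrib L1D)
  also have "\<dots> = (\<integral>x. (\<phi> (S x) - m) * f x \<partial>circ) - (\<integral>x. (\<phi> (R x) - m) * f x \<partial>circ)"
    using is_transferD(2)[OF v PL] is_transferD(2)[OF w PL] by simp
  also have "\<dots> = - (\<integral>x. P (S x) * ?p x \<partial>circ) + (\<integral>x. P (R x) * ?q x \<partial>circ)"
    using transfer_by_parts[OF S f u P(1)] transfer_by_parts[OF R f u P(1)] by simp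
  also have "(\<integral>x. P (R x) * ?q x \<partial>circ) = (\<integral>x. P (R x) * ?p x - P (R x) * ?d x \<partial>circ)"
    by (intro Bochner_Integration.integral_cong) (auto simp: algebra_simps)
  also have "- (\<integral>x. P (S x) * ?p x \<partial>circ) + (\<integral>x. P (R x) * ?p x - P (R x) * ?d x \<partial>circ)
     = - (\<integral>x. (P (S x) - P (R x)) * ?p x \<partial>circ) - (\<integral>x. P (R x) * ?d x \<partial>circ)"
    using iS by (simp add: left_diff_distrib)
  also have "\<dots> \<le> \<bar>\<integral>x. (P (S x) - P (R x)) * ?p x \<partial>circ\<bar> + \<bar>\<integral>x. P (R x) * ?d x \<partial>circ\<bar>" by linarith
  also have "\<dots> \<le> 2 * \<eta> * L1_norm ?p + 2 * L1_norm ?d"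
  proof (intro add_mono abs_integral_mult_le p(1) dd(1))
    show "(\<lambda>x. P (S x) - P (R x)) \<in> borel_measurable circ" "(\<lambda>x. P (R x)) \<in> borel_measurable circ"
      using CS(6) CR(6) by (auto intro!: measurable_circ borel_measurable_diff)
    have "\<bar>P (S x) - P (R x)\<bar> \<le> 2 * \<eta>" for x
    proof -
      have "\<bar>S x - R x\<bar> \<le> \<eta>" using cl by (auto simp: C2_close_def)
      then show ?thesis by (intro order_trans[OF lip[of "S x" "R x"]]) simp
    qed
    then show "AE x in circ. \<bar>P (S x) - P (R x)\<bar> \<le> 2 * \<eta>" by simp
    show "AE x in circ. \<bar>P (R x)\<bar> \<le> 2" using Pb by simp
  qed
  also have "\<dots> \<le> 2 * \<eta> * ((1 + c) * (L1_norm f + L1_norm u)) + 2 * ((1 + 2 * c) * \<eta> * (L1_norm f + L1_norm u))"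
    using p(2) dd(2) \<eta>0 by (intro add_mono mult_left_mono) auto
  also have "\<dots> = (4 + 6 * c) * \<eta> * (L1_norm f + L1_norm u)" by (simp add: algebra_simps)
  finally show "(\<integral>x. \<phi> x * (v x - w x) \<partial>circ) \<le> (4 + 6 * c) * \<eta> * (L1_norm f + L1_norm u)" .
qed

text \<open>The same estimate one derivative higher, by applying the previous one to the function and to
  the explicit preimage of the derivative of its transfer.\<close>

lemma transfer_Lipschitz_W1:
  assumes S: "expanding_lift S S1 S2 S3 c" and R: "expanding_lift R R1 R2 R3 c"
    and cl: "C2_close S S1 S2 R R1 R2 \<eta>"
    and f: "f \<in> W1 2" and v: "is_transfer S f v" and w: "is_transfer R f w"
  shows "(\<lambda>x. v x - w x) \<in> W1 1"
    "W1_norm 1 (\<lambda>x. v x - w x) \<le> (4 + 6 * c) * (3 + 2 * c + 2 * c\<^sup>2) * \<eta> * W1_norm 2 f"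
proof -
  have c0: "0 \<le> c" using S by (rule expanding_liftD)
  have \<eta>0: "0 \<le> \<eta>" using cl abs_ge_zero order_trans unfolding C2_close_def by blast
  obtain f1 where f1: "f \<in> L1" "is_weak_deriv 1 f f1" "f1 \<in> W1 1"
    using f W1_SucE[of f 1] unfolding numeral_2_eq_2 One_nat_def by blast
  obtain f2 where f2: "f1 \<in> L1" "is_weak_deriv 1 f1 f2" "f2 \<in> L1"
    using f1(3) W1_SucE[of f1 0] unfolding One_nat_def W1_0 by blast
  have nf: "W1_norm 2 f = L1_norm f + (L1_norm f1 + L1_norm f2)"
    unfolding numeral_2_eq_2 W1_norm_Suc[OF f1(1,2)] W1_norm_Suc[OF f2(1,2)] by simp
  have vwL: "v \<in> L1" "w \<in> L1" using v w by (auto dest: is_transferD)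
  let ?a = "\<lambda>x. 1 / S1 x" and ?b = "\<lambda>x. 1 / R1 x" and ?a' = "rec1 S1 S2" and ?b' = "rec1 R1 R2"
    and ?b'' = "rec2 R1 R2 R3"
  let ?p = "\<lambda>x. ?a x * f1 x + ?a' x * f x" and ?q = "\<lambda>x. ?b x * f1 x + ?b' x * f x"
  let ?d = "\<lambda>x. (?a x - ?b x) * f1 x + (?a' x - ?b' x) * f x"
  note A = per_C1D(1,3,4,5)[OF per_C1_rec[OF S]] and B = per_C1D(1,3,4,5)[OF per_C1_rec[OF R]]
    and B' = per_C1D(1,3,4,5)[OF per_C1_rec1[OF R]]
  note rS = rec_bounds[OF S] and rR = rec_bounds[OF R]
  have p: "?p \<in> L1" and q: "?q \<in> L1"
    by (rule L1_add[OF L1_mult_cont[OF f2(1) A(1,3)] L1_mult_cont[OF f1(1) A(4,2)]],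
        rule L1_add[OF L1_mult_cont[OF f2(1) B(1,3)] L1_mult_cont[OF f1(1) B(4,2)]])
  have dd: "?d \<in> L1" "L1_norm ?d \<le> (1 + 2 * c) * \<eta> * (L1_norm f + L1_norm f1)"
    by (rule rec_difference_L1[OF S R cl f1(1) f2(1)])+
  let ?q' = "\<lambda>x. (?b x * f2 x + ?b' x * f1 x) + (?b' x * f1 x + ?b'' x * f x)"
  have q': "is_weak_deriv 1 ?q ?q'"
  proof -
    have L: "(\<lambda>x. ?b x * f1 x) \<in> L1" "(\<lambda>x. ?b' x * f x) \<in> L1"
      by (rule L1_mult_cont[OF f2(1) B(1,3)], rule L1_mult_cont[OF f1(1) B(4,2)])
    from weak_deriv_linear[OF L weak_deriv_mult[OF f2(1,2) per_C1_rec[OF R]] weak_deriv_mult[OF f1(1,2) per_C1_rec1[OF R]], of 1 1]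
    show ?thesis by simp
  qed
  have nq: "L1_norm ?q + L1_norm ?q' \<le> (1 + 2 * c + 2 * c\<^sup>2) * W1_norm 2 f"
  proof -
    have bd: "L1_norm (\<lambda>x. ?b x * h x) \<le> L1_norm h" "L1_norm (\<lambda>x. ?b' x * h x) \<le> c * L1_norm h"
      "L1_norm (\<lambda>x. ?b'' x * h x) \<le> (c + 2 * c\<^sup>2) * L1_norm h"
      "(\<lambda>x. ?b x * h x) \<in> L1" "(\<lambda>x. ?b' x * h x) \<in> L1" "(\<lambda>x. ?b'' x * h x) \<in> L1" if "h \<in> L1" for h
      using L1_norm_mult_le[OF that B(1) borel_measurable_continuous_onI[OF B(3)] rR(1)]
        L1_norm_mult_le[OF that B'(1) borel_measurable_continuous_onI[OF B'(3)] rR(2)]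
        L1_norm_mult_le[OF that B'(4) borel_measurable_continuous_onI[OF B'(2)] rR(3)]
        L1_mult_cont[OF that B(1,3)] L1_mult_cont[OF that B'(1,3)] L1_mult_cont[OF that B'(4,2)] by simp_all
    have "L1_norm ?q \<le> L1_norm f1 + c * L1_norm f"
      using L1_norm_triangle[OF bd(4)[OF f2(1)] bd(5)[OF f1(1)]] bd(1)[OF f2(1)] bd(2)[OF f1(1)] by linarith
    moreover have "L1_norm ?q' \<le> (L1_norm f2 + c * L1_norm f1) + (c * L1_norm f1 + (c + 2 * c\<^sup>2) * L1_norm f)"
      using L1_norm_triangle[OF L1_add[OF bd(4)[OF f2(3)] bd(5)[OF f2(1)]] L1_add[OF bd(5)[OF f2(1)] bd(6)[OF f1(1)]]]
        L1_norm_triangle[OF bd(4)[OF f2(3)] bd(5)[OF f2(1)]] L1_norm_triangle[OF bd(5)[OF f2(1)] bd(6)[OF f1(1)]]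
        bd(1)[OF f2(3)] bd(2)[OF f2(1)] bd(3)[OF f1(1)] by linarith
    moreover have "0 \<le> c * L1_norm f2" "0 \<le> c\<^sup>2 * L1_norm f2" "0 \<le> c\<^sup>2 * L1_norm f1" "0 \<le> L1_norm f" using c0 by simp_all
    moreover have "(1 + 2 * c + 2 * c\<^sup>2) * (L1_norm f + (L1_norm f1 + L1_norm f2)) = L1_norm f + L1_norm f1 + L1_norm f2
        + 2 * (c * L1_norm f) + 2 * (c * L1_norm f1) + 2 * (c * L1_norm f2)
        + 2 * (c\<^sup>2 * L1_norm f) + 2 * (c\<^sup>2 * L1_norm f1) + 2 * (c\<^sup>2 * L1_norm f2)"
      "(c + 2 * c\<^sup>2) * L1_norm f = c * L1_norm f + 2 * (c\<^sup>2 * L1_norm f)"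
      by (simp_all add: algebra_simps)
    ultimately show ?thesis unfolding nf by linarith
  qed
  note CS = expanding_lift_C1[OF S] and CR = expanding_lift_C1[OF R]
  obtain v1 where v1: "is_transfer S ?p v1" using is_transfer_exists[OF CS p] ..
  obtain w1 where w1: "is_transfer R ?q w1" using is_transfer_exists[OF CR q] ..
  obtain z where z: "is_transfer S ?q z" using is_transfer_exists[OF CS q] ..
  have vL: "v1 \<in> L1" "w1 \<in> L1" "z \<in> L1" using v1 w1 z by (auto dest: is_transferD)
  have Dv: "is_weak_deriv 1 v v1" "is_weak_deriv 1 w w1"
    by (rule is_transfer_weak_deriv[OF S f1(1,2) v v1], rule is_transfer_weak_deriv[OF R f1(1,2) w w1])
  from weak_deriv_linear[OF vwL Dv, of 1 "-1"]
  have D: "is_weak_deriv 1 (\<lambda>x. v x - w x) (\<lambda>x. v1 x - w1 x)" by simp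
  have L: "(\<lambda>x. v x - w x) \<in> L1" "(\<lambda>x. v1 x - w1 x) \<in> L1" using vwL vL by (auto intro: L1_diff)
  show "(\<lambda>x. v x - w x) \<in> W1 1" unfolding One_nat_def W1_Suc_iff[OF L(1) D] using L(2) by simp
  have n1: "L1_norm (\<lambda>x. v1 x - z x) \<le> (1 + 2 * c) * \<eta> * (L1_norm f + L1_norm f1)"
  proof -
    have "is_transfer S (\<lambda>x. 1 * ?p x + -1 * ?q x) (\<lambda>x. 1 * v1 x + -1 * z x)"
      by (rule is_transfer_linear[OF CS p q v1 z])
    moreover have "(\<lambda>x. 1 * ?p x + -1 * ?q x) = ?d" by (simp add: fun_eq_iff algebra_simps)
    ultimately have "is_transfer S ?d (\<lambda>x. v1 x - z x)" by simp
    from is_transfer_L1_norm[OF CS dd(1) this] dd(2) show ?thesis by linarith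
  qed
  have n2: "L1_norm (\<lambda>x. z x - w1 x) \<le> (4 + 6 * c) * \<eta> * (L1_norm ?q + L1_norm ?q')"
    by (rule transfer_Lipschitz_L1[OF S R cl q q' z w1])
  have n3: "L1_norm (\<lambda>x. v x - w x) \<le> (4 + 6 * c) * \<eta> * (L1_norm f + L1_norm f1)"
    by (rule transfer_Lipschitz_L1[OF S R cl f1(1,2) v w])
  have n4: "L1_norm (\<lambda>x. v1 x - w1 x) \<le> L1_norm (\<lambda>x. v1 x - z x) + L1_norm (\<lambda>x. z x - w1 x)"
    using L1_norm_triangle[OF L1_diff[OF vL(1,3)] L1_diff[OF vL(3,2)]] by simp
  let ?W = "W1_norm 2 f"
  have W: "L1_norm f + L1_norm f1 \<le> ?W" "0 \<le> ?W" unfolding nf by simp_all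
  let ?A = "(4 + 6 * c) * \<eta>"
  have A0: "0 \<le> ?A" using c0 \<eta>0 by simp
  have "(1 + 2 * c) * \<eta> \<le> ?A" using c0 \<eta>0 by (intro mult_right_mono) auto
  then have m1: "(1 + 2 * c) * \<eta> * (L1_norm f + L1_norm f1) \<le> ?A * ?W"
    by (rule mult_mono[OF _ W(1) A0]) simp
  have m2: "?A * (L1_norm ?q + L1_norm ?q') \<le> ?A * ((1 + 2 * c + 2 * c\<^sup>2) * ?W)" using nq A0 by (rule mult_left_mono)
  have m3: "?A * (L1_norm f + L1_norm f1) \<le> ?A * ?W" using W(1) A0 by (rule mult_left_mono)
  have "W1_norm 1 (\<lambda>x. v x - w x) = L1_norm (\<lambda>x. v x - w x) + L1_norm (\<lambda>x. v1 x - w1 x)"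
    unfolding One_nat_def W1_norm_Suc[OF L(1) D] by simp
  also have "\<dots> \<le> ?A * ?W + (?A * ?W + ?A * ((1 + 2 * c + 2 * c\<^sup>2) * ?W))"
    using n1 n2 n3 n4 m1 m2 m3 by linarith
  also have "\<dots> = (4 + 6 * c) * (3 + 2 * c + 2 * c\<^sup>2) * \<eta> * ?W" by (simp add: algebra_simps)
  finally show "W1_norm 1 (\<lambda>x. v x - w x) \<le> (4 + 6 * c) * (3 + 2 * c + 2 * c\<^sup>2) * \<eta> * ?W" .
qed

section \<open>The mean-field coupling\<close>

definition dfst :: "(real \<times> real \<Rightarrow> real) \<Rightarrow> real \<times> real \<Rightarrow> real" where
  "dfst g p = frechet_derivative g (at p) (1, 0)"

definition biperiodic :: "(real \<times> real \<Rightarrow> real) \<Rightarrow> bool" where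
  "biperiodic g \<longleftrightarrow> (\<forall>x y. g (x + 1, y) = g (x, y) \<and> g (x, y + 1) = g (x, y))"

lemma dfst_DERIV:
  assumes "class_C (Suc k) g"
  shows "((\<lambda>x. g (x, y)) has_real_derivative dfst g (x, y)) (at x)"
proof -
  have "g differentiable (at (x, y))" using assms by simp
  then have D: "(g has_derivative frechet_derivative g (at (x, y))) (at (x, y))"
    by (simp add: frechet_derivative_works)
  have "((\<lambda>x. (x, y)) has_derivative (\<lambda>h. (h, 0))) (at x)" by (auto intro!: derivative_eq_intros)
  from diff_chain_at[OF this D]
  have "((\<lambda>x. g (x, y)) has_derivative (\<lambda>h. frechet_derivative g (at (x, y)) (h, 0))) (at x)"
    by (simp add: o_def)
  moreover have "frechet_derivative g (at (x, y)) (h, 0) = dfst g (x, y) * h" for h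
    using linear_scale[OF has_derivative_linear[OF D], of h "(1, 0)"] by (simp add: dfst_def)
  ultimately show ?thesis by (simp add: has_field_derivative_def)
qed

lemma class_C_dfst: "class_C (Suc k) g \<Longrightarrow> class_C k (dfst g)"
  unfolding dfst_def[abs_def] by simp

lemma biperiodic_dfst:
  assumes "class_C (Suc k) g" "biperiodic g"
  shows "biperiodic (dfst g)"
  unfolding biperiodic_def
proof (intro allI conjI)
  note D = dfst_DERIV[OF assms(1)]
  fix x y
  have "((\<lambda>x. g (x + 1, y)) has_real_derivative dfst g (x + 1, y)) (at x)"
    using DERIV_shift[of "\<lambda>x. g (x, y)" "dfst g (x + 1, y)" x 1] D by simp
  then have "((\<lambda>x. g (x, y)) has_real_derivative dfst g (x + 1, y)) (at x)"
    using assms(2) by (simp add: biperiodic_def)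
  then show "dfst g (x + 1, y) = dfst g (x, y)" using D DERIV_unique by blast
  have "((\<lambda>x. g (x, y)) has_real_derivative dfst g (x, y + 1)) (at x)"
    using D[of "y + 1" x] assms(2) by (simp add: biperiodic_def)
  then show "dfst g (x, y + 1) = dfst g (x, y)" using D DERIV_unique by blast
qed

lemma biperiodic_bounded:
  assumes "biperiodic g" "continuous_on UNIV g"
  obtains b where "\<And>p. \<bar>g p\<bar> \<le> b"
proof -
  have "compact ({0..1} \<times> {0..1::real} :: (real \<times> real) set)" by (intro compact_Times) auto
  then have "compact (g ` ({0..1} \<times> {0..1}))"
    using assms(2) by (intro compact_continuous_image) (auto intro: continuous_on_subset)
  then obtain b where b: "\<And>p. p \<in> {0..1} \<times> {0..1} \<Longrightarrow> \<bar>g p\<bar> \<le> b"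
    by (meson bounded_real compact_imp_bounded image_eqI)
  have "\<bar>g (x, y)\<bar> \<le> b" for x y
  proof -
    have "periodic1 (\<lambda>x. g (x, y))" "periodic1 (\<lambda>y. g (frac x, y))"
      using assms(1) by (auto simp: biperiodic_def periodic1_def)
    from periodic1_frac[OF this(1), of x] periodic1_frac[OF this(2), of y]
    have "g (x, y) = g (frac x, frac y)" by simp
    then show ?thesis using b[of "(frac x, frac y)"] frac_lt_1[of x] frac_lt_1[of y] by simp
  qed
  then show ?thesis using that by (metis surj_pair)
qed

text \<open>For \<open>j = 0\<close> this is the mean field generated by \<open>h\<close>, and in general its \<open>j\<close>-th derivative.\<close>

definition mean_field :: "(real \<times> real \<Rightarrow> real) \<Rightarrow> nat \<Rightarrow> (real \<Rightarrow> real) \<Rightarrow> real \<Rightarrow> real" where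
  "mean_field g j h x = (\<integral>y. (dfst ^^ j) g (x, y) * h y \<partial>circ)"

text \<open>Five derivatives: the estimates on the coupled maps use three derivatives of the mean field, and
  the quadratic remainder in \<open>mean_field_DERIV\<close> costs two more.\<close>

locale smooth_kernel =
  fixes g :: "real \<times> real \<Rightarrow> real"
  assumes g_C5: "class_C 5 g" and g_per: "biperiodic g"
begin

lemma class_C_iter: "j \<le> 5 \<Longrightarrow> class_C (5 - j) ((dfst ^^ j) g) \<and> biperiodic ((dfst ^^ j) g)"
proof (induction j)
  case 0
  show ?case using g_C5 g_per by simp
next
  case (Suc j)
  then have "5 - j = Suc (5 - Suc j)" by simp
  then show ?case using Suc class_C_dfst[of "5 - Suc j" "(dfst ^^ j) g"] biperiodic_dfst[of "5 - Suc j" "(dfst ^^ j) g"]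
    by (simp del: class_C.simps)
qed

lemma iter_DERIV: "j \<le> 4 \<Longrightarrow> ((\<lambda>x. (dfst ^^ j) g (x, y)) has_real_derivative (dfst ^^ Suc j) g (x, y)) (at x)"
  using class_C_iter[of j] dfst_DERIV[of "5 - Suc j" "(dfst ^^ j) g"]
  by (simp del: class_C.simps add: Suc_diff_le[symmetric])

lemma iter_continuous: "j \<le> 5 \<Longrightarrow> continuous_on UNIV ((dfst ^^ j) g)"
  using class_C_iter class_C_continuous by blast

lemma iter_bound:
  obtains b where "b \<ge> 0" "\<And>j p. j \<le> 5 \<Longrightarrow> \<bar>(dfst ^^ j) g p\<bar> \<le> b"
proof -
  have "\<exists>b. \<forall>p. \<bar>(dfst ^^ j) g p\<bar> \<le> b" if "j \<le> 5" for j
    using biperiodic_bounded[of "(dfst ^^ j) g"] class_C_iter[OF that] iter_continuous[OF that] by metis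
  then obtain B where B: "\<And>j p. j \<le> 5 \<Longrightarrow> \<bar>(dfst ^^ j) g p\<bar> \<le> B j" by metis
  define b where "b = Max (B ` {..5::nat})"
  have le: "B j \<le> b" if "j \<le> 5" for j unfolding b_def using that by (intro Max_ge) auto
  have "b \<ge> 0" using B[of 0 "(0,0)"] le[of 0] abs_ge_zero[of "g (0,0)"] by simp
  then show ?thesis using that B le order_trans by blast
qed

lemma section_props:
  assumes "j \<le> 5"
  shows "periodic1 (\<lambda>y. (dfst ^^ j) g (x, y))" "continuous_on UNIV (\<lambda>y. (dfst ^^ j) g (x, y))"
proof -
  show "periodic1 (\<lambda>y. (dfst ^^ j) g (x, y))"
    using class_C_iter[OF assms] by (simp add: periodic1_def biperiodic_def)
  show "continuous_on UNIV (\<lambda>y. (dfst ^^ j) g (x, y))"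
    by (rule continuous_on_compose2[OF iter_continuous[OF assms]]) (auto intro!: continuous_intros)
qed

lemma section_integrable:
  "j \<le> 5 \<Longrightarrow> h \<in> L1 \<Longrightarrow> integrable circ (\<lambda>y. (dfst ^^ j) g (x, y) * h y)"
  using section_props by (intro integrable_L1_cont)

lemma mean_field_periodic: "j \<le> 5 \<Longrightarrow> periodic1 (mean_field g j h)"
  using class_C_iter by (auto simp: mean_field_def periodic1_def biperiodic_def)

lemma mean_field_diff: "j \<le> 5 \<Longrightarrow> h \<in> L1 \<Longrightarrow> k \<in> L1 \<Longrightarrow> mean_field g j h x - mean_field g j k x = mean_field g j (\<lambda>y. h y - k y) x"
  unfolding mean_field_def using section_integrable[of j h x] section_integrable[of j k x]
  by (simp add: right_diff_distrib)

lemma mean_field_bound: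
  assumes "\<And>j p. j \<le> 5 \<Longrightarrow> \<bar>(dfst ^^ j) g p\<bar> \<le> b" "j \<le> 5" "h \<in> L1"
  shows "\<bar>mean_field g j h x\<bar> \<le> b * L1_norm h"
  unfolding mean_field_def using section_props[OF assms(2)] assms
  by (intro abs_integral_mult_le) (auto intro!: measurable_circ borel_measurable_continuous_onI)

text \<open>Differentiation under the integral, with a quadratic remainder in place of dominated convergence.\<close>

lemma mean_field_DERIV:
  assumes "j \<le> 3" "h \<in> L1"
  shows "(mean_field g j h has_real_derivative mean_field g (Suc j) h x) (at x)"
proof -
  obtain b where b: "b \<ge> 0" "\<And>j p. j \<le> 5 \<Longrightarrow> \<bar>(dfst ^^ j) g p\<bar> \<le> b"
    using iter_bound by blast
  have quad: "\<bar>(dfst ^^ j) g (x + t, y) - (dfst ^^ j) g (x, y) - t * (dfst ^^ Suc j) g (x, y)\<bar> \<le> b * \<bar>t\<bar> * \<bar>t\<bar>" for t y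
  proof -
    define \<phi> where "\<phi> s = (dfst ^^ j) g (s, y) - s * (dfst ^^ Suc j) g (x, y)" for s
    have D: "(\<phi> has_field_derivative ((dfst ^^ Suc j) g (s, y) - (dfst ^^ Suc j) g (x, y))) (at s within cball x \<bar>t\<bar>)" for s
    proof -
      have lin: "((\<lambda>s. s * q) has_real_derivative 1 * q) (at s)" for q :: real
        by (rule DERIV_cmult_right[OF DERIV_ident])
      have j4: "j \<le> 4" using assms(1) by simp
      show ?thesis
        unfolding \<phi>_def
        by (rule has_field_derivative_at_within, rule DERIV_diff[OF iter_DERIV[OF j4] lin, unfolded mult_1])
    qed
    have "norm (\<phi> (x + t) - \<phi> x) \<le> b * \<bar>t\<bar> * norm (x + t - x)"
    proof (rule field_differentiable_bound[OF convex_cball D])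
      fix s assume s: "s \<in> cball x \<bar>t\<bar>"
      have "\<bar>(dfst ^^ Suc j) g (s, y) - (dfst ^^ Suc j) g (x, y)\<bar> \<le> b * \<bar>s - x\<bar>"
        using assms(1) by (intro DERIV_bound_Lipschitz[OF iter_DERIV] b(2)) auto
      also have "\<dots> \<le> b * \<bar>t\<bar>" using s b(1) by (intro mult_left_mono) (auto simp: dist_real_def)
      finally show "norm ((dfst ^^ Suc j) g (s, y) - (dfst ^^ Suc j) g (x, y)) \<le> b * \<bar>t\<bar>" by simp
    qed (auto simp: dist_real_def)
    then show ?thesis by (simp add: \<phi>_def algebra_simps del: funpow.simps)
  qed
  have "((\<lambda>t. (mean_field g j h (x + t) - mean_field g j h x) / t) \<longlongrightarrow> mean_field g (Suc j) h x) (at 0)"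
  proof (rule LIM_zero_cancel, rule Lim_null_comparison)
    show "((\<lambda>t. b * L1_norm h * \<bar>t\<bar>) \<longlongrightarrow> 0) (at 0)"
      by (auto intro!: tendsto_eq_intros)
    have "norm ((mean_field g j h (x + t) - mean_field g j h x) / t - mean_field g (Suc j) h x) \<le> b * L1_norm h * \<bar>t\<bar>" if "t \<noteq> 0" for t
    proof -
      have ints: "integrable circ (\<lambda>y. (dfst ^^ j) g (x + t, y) * h y)" "integrable circ (\<lambda>y. (dfst ^^ j) g (x, y) * h y)"
        "integrable circ (\<lambda>y. (dfst ^^ Suc j) g (x, y) * h y)"
        using assms by (intro section_integrable; simp)+
      let ?r = "\<lambda>y. (dfst ^^ j) g (x + t, y) - (dfst ^^ j) g (x, y) - t * (dfst ^^ Suc j) g (x, y)"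
      have "mean_field g j h (x + t) - mean_field g j h x - t * mean_field g (Suc j) h x = (\<integral>y. ?r y * h y \<partial>circ)"
        unfolding mean_field_def using ints by (simp add: left_diff_distrib mult.assoc del: funpow.simps)
      moreover have "\<bar>\<integral>y. ?r y * h y \<partial>circ\<bar> \<le> b * \<bar>t\<bar> * \<bar>t\<bar> * L1_norm h"
        using quad assms section_props(2)[of j] section_props(2)[of "Suc j"]
        by (intro abs_integral_mult_le assms(2))
           (auto intro!: measurable_circ borel_measurable_continuous_onI continuous_intros simp del: funpow.simps)
      ultimately have *: "\<bar>mean_field g j h (x + t) - mean_field g j h x - t * mean_field g (Suc j) h x\<bar> \<le> b * \<bar>t\<bar> * \<bar>t\<bar> * L1_norm h" by simp
      have "(mean_field g j h (x + t) - mean_field g j h x) / t - mean_field g (Suc j) h x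
          = (mean_field g j h (x + t) - mean_field g j h x - t * mean_field g (Suc j) h x) / t" using that by (simp add: field_simps)
      also have "norm \<dots> \<le> b * \<bar>t\<bar> * \<bar>t\<bar> * L1_norm h / \<bar>t\<bar>"
        unfolding real_norm_def abs_divide using * by (rule divide_right_mono) simp
      also have "\<dots> = b * L1_norm h * \<bar>t\<bar>" using that by (simp add: field_simps)
      finally show ?thesis .
    qed
    then show "\<forall>\<^sub>F t in at 0. norm ((mean_field g j h (x + t) - mean_field g j h x) / t - mean_field g (Suc j) h x) \<le> b * L1_norm h * \<bar>t\<bar>"
      by (auto simp: eventually_at_filter)
  qed
  then show ?thesis by (simp add: DERIV_def)
qed

end

section \<open>The family of coupled maps\<close>

text \<open>The first three derivatives of the coupled map, in terms of those of \<open>T\<close>.\<close>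

definition coup1 where
  "coup1 T T1 g \<epsilon> h x = T1 x * (1 + \<epsilon> * mean_field g 1 h (T x))" for T T1 :: "real \<Rightarrow> real"

definition coup2 where
  "coup2 T T1 T2 g \<epsilon> h x = T2 x * (1 + \<epsilon> * mean_field g 1 h (T x)) + \<epsilon> * (T1 x)\<^sup>2 * mean_field g 2 h (T x)"
  for T T1 T2 :: "real \<Rightarrow> real"

definition coup3 where
  "coup3 T T1 T2 T3 g \<epsilon> h x = T3 x * (1 + \<epsilon> * mean_field g 1 h (T x)) + 3 * \<epsilon> * T1 x * T2 x * mean_field g 2 h (T x)
     + \<epsilon> * (T1 x) ^ 3 * mean_field g 3 h (T x)"
  for T T1 T2 T3 :: "real \<Rightarrow> real"

locale coupled_family = smooth_kernel +
  fixes T :: "real \<Rightarrow> real" and \<epsilon>\<^sub>0 lam C_LY :: real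
  assumes T_lift: "circle_lift T" and T_C5: "class_C 5 T"
    and eps0: "0 < \<epsilon>\<^sub>0" and lam: "0 < lam" "lam < 1"
    and expanding: "\<And>\<epsilon> f x. \<epsilon> \<in> {0..\<epsilon>\<^sub>0} \<Longrightarrow> f \<in> D1 \<Longrightarrow>
          deriv (coupled_map T g \<epsilon> f) x \<noteq> 0 \<and> 1 / \<bar>deriv (coupled_map T g \<epsilon> f) x\<bar> \<le> lam"
    and LY: "0 < C_LY" "Lasota_Yorke T g \<epsilon>\<^sub>0 lam C_LY"
begin

abbreviation cmap :: "real \<Rightarrow> (real \<Rightarrow> real) \<Rightarrow> real \<Rightarrow> real" where
  "cmap \<equiv> coupled_map T g"

definition T1 where "T1 = deriv T"
definition T2 where "T2 = deriv T1"
definition T3 where "T3 = deriv T2"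

lemma T_derivs: "(T has_real_derivative T1 x) (at x)" "per_C1 T1 T2" "per_C1 T2 T3"
proof -
  have c: "class_C (Suc 4) T" "class_C (Suc 3) T1" "class_C (Suc 2) T2" "class_C (Suc 1) T3"
  proof -
    show 0: "class_C (Suc 4) T" using T_C5 by (simp del: class_C.simps)
    show 1: "class_C (Suc 3) T1" unfolding T1_def using class_C_Suc_real(2)[OF 0] by (simp del: class_C.simps)
    show 2: "class_C (Suc 2) T2" unfolding T2_def using class_C_Suc_real(2)[OF 1] by (simp del: class_C.simps)
    show "class_C (Suc 1) T3" unfolding T3_def using class_C_Suc_real(2)[OF 2] by (simp del: class_C.simps add: numeral_2_eq_2)
  qed
  show D: "(T has_real_derivative T1 x) (at x)" for x unfolding T1_def by (rule class_C_Suc_real(1)[OF c(1)])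
  obtain d :: int where d: "\<And>x. T (x + 1) = T x + of_int d" using T_lift by (auto simp: circle_lift_def)
  have "periodic1 T1"
    unfolding periodic1_def
  proof
    fix x
    have "((\<lambda>x. T (x + 1)) has_real_derivative T1 (x + 1)) (at x)"
      using DERIV_shift[of T "T1 (x+1)" x 1] D by simp
    moreover have "((\<lambda>x. T (x + 1)) has_real_derivative T1 x) (at x)"
      unfolding d using D[of x] by (auto intro!: derivative_eq_intros)
    ultimately show "T1 (x + 1) = T1 x" by (rule DERIV_unique)
  qed
  then show 1: "per_C1 T1 T2"
    unfolding per_C1_def T2_def using class_C_Suc_real(1)[OF c(2)] class_C_continuous[OF c(3)] by (simp add: T2_def)
  show "per_C1 T2 T3"
    unfolding per_C1_def using class_C_Suc_real(1)[OF c(3)] class_C_continuous[OF c(4)] per_C1D(5)[OF 1] by (simp add: T3_def)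
qed

lemma cmap_eq: "cmap \<epsilon> h x = T x + \<epsilon> * mean_field g 0 h (T x)"
  by (simp add: coupled_map_def coupling_def mean_field_def)

lemma cmap_0: "cmap 0 h = T" "cmap \<epsilon> (\<lambda>_. 0) = T"
  by (auto simp: fun_eq_iff cmap_eq mean_field_def)

lemma mean_field_comp_DERIV:
  assumes "j \<le> 3" "h \<in> L1"
  shows "((\<lambda>x. mean_field g j h (T x)) has_real_derivative mean_field g (Suc j) h (T x) * T1 x) (at x)"
  by (rule DERIV_chain2[OF mean_field_DERIV[OF assms] T_derivs(1)])

lemma cmap_derivs:
  assumes "h \<in> L1"
  shows "(cmap \<epsilon> h has_real_derivative coup1 T T1 g \<epsilon> h x) (at x)"
    "per_C1 (coup1 T T1 g \<epsilon> h) (coup2 T T1 T2 g \<epsilon> h)"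
    "per_C1 (coup2 T T1 T2 g \<epsilon> h) (coup3 T T1 T2 T3 g \<epsilon> h)"
    "\<exists>d::int. \<forall>x. cmap \<epsilon> h (x + 1) = cmap \<epsilon> h x + of_int d"
proof -
  obtain d :: int where d: "\<And>x. T (x + 1) = T x + of_int d" using T_lift by (auto simp: circle_lift_def)
  have GT: "mean_field g j h (T (x + 1)) = mean_field g j h (T x)" if "j \<le> 5" for j x
    unfolding d using periodic1_of_int[OF mean_field_periodic[OF that]] by simp
  show "\<exists>d::int. \<forall>x. cmap \<epsilon> h (x + 1) = cmap \<epsilon> h x + of_int d"
    using GT[of 0] d by (intro exI[of _ d]) (simp add: cmap_eq)
  note G = mean_field_comp_DERIV[OF _ assms, of 0, simplified] mean_field_comp_DERIV[OF _ assms, of 1, simplified]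
    mean_field_comp_DERIV[OF _ assms, of 2, simplified] mean_field_comp_DERIV[OF _ assms, of 3, simplified]
  note n = numeral_2_eq_2 numeral_3_eq_3
  note TT = per_C1D[OF T_derivs(2)] per_C1D[OF T_derivs(3)]
  have cG: "continuous_on UNIV (\<lambda>x. mean_field g j h (T x))" if "j \<le> 3" for j
    using mean_field_comp_DERIV[OF that assms] by (meson DERIV_isCont continuous_at_imp_continuous_on)
  show "(cmap \<epsilon> h has_real_derivative coup1 T T1 g \<epsilon> h x) (at x)" for x
  proof -
    have "((\<lambda>x. T x + \<epsilon> * mean_field g 0 h (T x)) has_real_derivative T1 x + \<epsilon> * (mean_field g 1 h (T x) * T1 x)) (at x)"
      using G(1)[of x] T_derivs(1)[of x] by (auto intro!: derivative_eq_intros)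
    then show ?thesis by (simp add: coup1_def cmap_eq[abs_def] algebra_simps)
  qed
  have D1: "(coup1 T T1 g \<epsilon> h has_real_derivative coup2 T T1 T2 g \<epsilon> h x) (at x)" for x
    unfolding coup1_def coup2_def
    using mean_field_comp_DERIV[OF _ assms, of 1 x] TT(2)[of x]
    by (auto intro!: derivative_eq_intros simp: n power2_eq_square algebra_simps)
  have D2: "(coup2 T T1 T2 g \<epsilon> h has_real_derivative coup3 T T1 T2 T3 g \<epsilon> h x) (at x)" for x
    unfolding coup2_def coup3_def
    using mean_field_comp_DERIV[OF _ assms, of 1 x] mean_field_comp_DERIV[OF _ assms, of 2 x] TT(2)[of x] TT(9)[of x]
    by (auto intro!: derivative_eq_intros simp: n power2_eq_square power3_eq_cube algebra_simps)
  have c3: "continuous_on UNIV (coup3 T T1 T2 T3 g \<epsilon> h)"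
    unfolding coup3_def[abs_def] using TT cG by (intro continuous_intros) auto
  have c2: "continuous_on UNIV (coup2 T T1 T2 g \<epsilon> h)"
    using D2 by (meson DERIV_isCont continuous_at_imp_continuous_on)
  have p1: "periodic1 (coup1 T T1 g \<epsilon> h)" "periodic1 (coup2 T T1 T2 g \<epsilon> h)"
    using TT GT[of 1] GT[of 2] by (auto simp: periodic1_def coup1_def coup2_def)
  show "per_C1 (coup1 T T1 g \<epsilon> h) (coup2 T T1 T2 g \<epsilon> h)" using p1 D1 c2 by (simp add: per_C1_def)
  show "per_C1 (coup2 T T1 T2 g \<epsilon> h) (coup3 T T1 T2 T3 g \<epsilon> h)" using p1 D2 c3 by (simp add: per_C1_def)
qed

text \<open>The zero function is admitted next to densities because it makes the uncoupled map a member of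
  the family for every \<open>\<epsilon>\<close>.\<close>

definition Dens :: "(real \<Rightarrow> real) set" where
  "Dens = insert (\<lambda>_. 0) D1"

lemma const_D1: "(\<lambda>_. 1) \<in> D1"
  by (simp add: D1_def)

lemma D1_norm: "h \<in> D1 \<Longrightarrow> L1_norm h = 1"
proof -
  assume h: "h \<in> D1"
  then have "h \<in> L1" by (simp add: D1_def)
  then have "L1_norm h = (\<integral>x. h x \<partial>circ)"
    unfolding L1_norm_def using h L1D(3)
    by (intro integral_cong_AE) (auto simp: D1_def intro: borel_measurable_abs)
  then show ?thesis using h by (simp add: D1_def)
qed

lemma Dens_L1: "h \<in> Dens \<Longrightarrow> h \<in> L1" "h \<in> Dens \<Longrightarrow> L1_norm h \<le> 1"
  using D1_norm by (auto simp: Dens_def D1_def)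

lemma D1_Dens: "h \<in> D1 \<Longrightarrow> h \<in> Dens" and zero_Dens: "(\<lambda>_. 0) \<in> Dens"
  by (auto simp: Dens_def)

lemma coup1_ge:
  assumes "\<epsilon> \<in> {0..\<epsilon>\<^sub>0}" "h \<in> Dens"
  shows "1 / lam \<le> \<bar>coup1 T T1 g \<epsilon> h x\<bar>"
proof -
  have main: "1 / lam \<le> \<bar>coup1 T T1 g \<epsilon> h x\<bar>" if "\<epsilon> \<in> {0..\<epsilon>\<^sub>0}" "h \<in> D1" for \<epsilon> h
  proof -
    have "h \<in> L1" using that by (simp add: D1_def)
    then have "deriv (cmap \<epsilon> h) x = coup1 T T1 g \<epsilon> h x" using cmap_derivs(1) by (intro DERIV_imp_deriv)
    then have "coup1 T T1 g \<epsilon> h x \<noteq> 0" "1 / \<bar>coup1 T T1 g \<epsilon> h x\<bar> \<le> lam" using expanding[OF that, of x] by auto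
    then show ?thesis using lam by (simp add: field_simps)
  qed
  show ?thesis
  proof (cases "h \<in> D1")
    case True then show ?thesis using main assms by blast
  next
    case False
    then have "h = (\<lambda>_. 0)" using assms by (simp add: Dens_def)
    then have "coup1 T T1 g \<epsilon> h x = coup1 T T1 g 0 (\<lambda>_. 1) x" by (simp add: coup1_def mean_field_def)
    then show ?thesis using main[of 0 "\<lambda>_. 1"] const_D1 eps0 by simp
  qed
qed

text \<open>Two maps of the family differ by \<open>\<epsilon>\<close> times the mean field of \<open>h - k\<close>; this linearity is the source
  of the factor \<open>\<epsilon> \<parallel>h - k\<parallel>\<close> in all perturbation estimates.\<close>

lemma family_regular:
  obtains c M where "c \<ge> 0" "M \<ge> 0"
    "\<And>\<epsilon> h. \<epsilon> \<in> {0..\<epsilon>\<^sub>0} \<Longrightarrow> h \<in> Dens \<Longrightarrow>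
       expanding_lift (cmap \<epsilon> h) (coup1 T T1 g \<epsilon> h) (coup2 T T1 T2 g \<epsilon> h) (coup3 T T1 T2 T3 g \<epsilon> h) c"
    "\<And>\<epsilon> h k. \<epsilon> \<in> {0..\<epsilon>\<^sub>0} \<Longrightarrow> h \<in> Dens \<Longrightarrow> k \<in> Dens \<Longrightarrow>
       C2_close (cmap \<epsilon> h) (coup1 T T1 g \<epsilon> h) (coup2 T T1 T2 g \<epsilon> h)
                (cmap \<epsilon> k) (coup1 T T1 g \<epsilon> k) (coup2 T T1 T2 g \<epsilon> k) (M * \<epsilon> * L1_norm (\<lambda>x. h x - k x))"
proof -
  obtain b where b: "b \<ge> 0" "\<And>j p. j \<le> 5 \<Longrightarrow> \<bar>(dfst ^^ j) g p\<bar> \<le> b"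
    using iter_bound by blast
  note Gb = mean_field_bound[OF b(2)]
  obtain t where t: "t \<ge> 0" "\<And>x. \<bar>T1 x\<bar> \<le> t" "\<And>x. \<bar>T2 x\<bar> \<le> t" "\<And>x. \<bar>T3 x\<bar> \<le> t"
  proof -
    obtain t1 where t1: "t1 \<ge> 0" "\<And>x. \<bar>T1 x\<bar> \<le> t1" using periodic1_cont_bounded[OF per_C1D(1,4)[OF T_derivs(2)]] by blast
    obtain t2 where t2: "t2 \<ge> 0" "\<And>x. \<bar>T2 x\<bar> \<le> t2" using periodic1_cont_bounded[OF per_C1D(1,4)[OF T_derivs(3)]] by blast
    obtain t3 where t3: "t3 \<ge> 0" "\<And>x. \<bar>T3 x\<bar> \<le> t3" using periodic1_cont_bounded[OF per_C1D(5,3)[OF T_derivs(3)]] by blast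
    show ?thesis
    proof (rule that[of "t1 + t2 + t3"])
      show "\<bar>T1 x\<bar> \<le> t1 + t2 + t3" "\<bar>T2 x\<bar> \<le> t1 + t2 + t3" "\<bar>T3 x\<bar> \<le> t1 + t2 + t3" for x
        using t1(1) t2(1) t3(1) t1(2)[of x] t2(2)[of x] t3(2)[of x] by linarith+
    qed (use t1 t2 t3 in auto)
  qed
  define e where "e = \<epsilon>\<^sub>0 * b"
  have e0: "e \<ge> 0" using eps0 b by (simp add: e_def)
  define c where "c = t * (1 + e) + 3 * (t * t * e) + t ^ 3 * e"
  define M where "M = b * (1 + t + t\<^sup>2)"
  have c0: "c \<ge> 0" unfolding c_def using t e0 by simp
  have M0: "M \<ge> 0" unfolding M_def using t b by simp
  show ?thesis
  proof (rule that[OF c0 M0])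
    fix \<epsilon> h assume \<epsilon>: "\<epsilon> \<in> {0..\<epsilon>\<^sub>0}" and h: "h \<in> Dens"
    note hL = Dens_L1(1)[OF h]
    have G: "\<bar>\<epsilon> * mean_field g j h y\<bar> \<le> e" if "j \<le> 5" for j y
    proof -
      have "\<bar>mean_field g j h y\<bar> \<le> b * L1_norm h" by (rule Gb[OF _ that hL])
      also have "\<dots> \<le> b * 1" using Dens_L1(2)[OF h] b(1) by (rule mult_left_mono)
      finally have "\<bar>\<epsilon>\<bar> * \<bar>mean_field g j h y\<bar> \<le> \<epsilon>\<^sub>0 * b" using \<epsilon> b by (intro mult_mono) auto
      then show ?thesis by (simp add: abs_mult e_def)
    qed
    have G1: "\<bar>1 + \<epsilon> * mean_field g 1 h y\<bar> \<le> 1 + e" for y using G[of 1 y] by simp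
    have s2: "\<bar>coup2 T T1 T2 g \<epsilon> h x\<bar> \<le> c" for x
    proof -
      have "\<bar>T2 x * (1 + \<epsilon> * mean_field g 1 h (T x))\<bar> \<le> t * (1 + e)"
        unfolding abs_mult[of "T2 x"] using t G1 by (intro mult_mono) auto
      moreover have "\<bar>T1 x * T1 x * (\<epsilon> * mean_field g 2 h (T x))\<bar> \<le> t * t * e"
        unfolding abs_mult[of "T1 x * T1 x"] abs_mult[of "T1 x"] using t G[of 2] by (intro mult_mono) auto
      moreover have "0 \<le> t * t * e" "0 \<le> t ^ 3 * e" using t e0 by auto
      moreover have "coup2 T T1 T2 g \<epsilon> h x = T2 x * (1 + \<epsilon> * mean_field g 1 h (T x)) + T1 x * T1 x * (\<epsilon> * mean_field g 2 h (T x))"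
        by (simp add: coup2_def power2_eq_square)
      ultimately show ?thesis unfolding c_def by linarith
    qed
    have s3: "\<bar>coup3 T T1 T2 T3 g \<epsilon> h x\<bar> \<le> c" for x
    proof -
      have "\<bar>T3 x * (1 + \<epsilon> * mean_field g 1 h (T x))\<bar> \<le> t * (1 + e)"
        unfolding abs_mult[of "T3 x"] using t G1 by (intro mult_mono) auto
      moreover have "\<bar>T1 x * T2 x * (\<epsilon> * mean_field g 2 h (T x))\<bar> \<le> t * t * e"
        unfolding abs_mult[of "T1 x * T2 x"] abs_mult[of "T1 x"] using t G[of 2] by (intro mult_mono) auto
      moreover have "\<bar>T1 x ^ 3 * (\<epsilon> * mean_field g 3 h (T x))\<bar> \<le> t ^ 3 * e"
        unfolding abs_mult[of "T1 x ^ 3"] power_abs using t G[of 3] by (intro mult_mono power_mono) auto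
      moreover have "coup3 T T1 T2 T3 g \<epsilon> h x = T3 x * (1 + \<epsilon> * mean_field g 1 h (T x))
          + 3 * (T1 x * T2 x * (\<epsilon> * mean_field g 2 h (T x))) + T1 x ^ 3 * (\<epsilon> * mean_field g 3 h (T x))"
        by (simp add: coup3_def)
      ultimately show ?thesis unfolding c_def by linarith
    qed
    have "1 \<le> 1 / lam" using lam by simp
    then have s1: "1 \<le> \<bar>coup1 T T1 g \<epsilon> h x\<bar>" for x using coup1_ge[OF \<epsilon> h, of x] by linarith
    show "expanding_lift (cmap \<epsilon> h) (coup1 T T1 g \<epsilon> h) (coup2 T T1 T2 g \<epsilon> h) (coup3 T T1 T2 T3 g \<epsilon> h) c"
      unfolding expanding_lift_def using cmap_derivs[OF hL] s1 s2 s3 by blast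
  next
    fix \<epsilon> h k assume \<epsilon>: "\<epsilon> \<in> {0..\<epsilon>\<^sub>0}" and h: "h \<in> Dens" and k: "k \<in> Dens"
    let ?n = "L1_norm (\<lambda>x. h x - k x)"
    note L = Dens_L1(1)[OF h] Dens_L1(1)[OF k]
    define q where "q = b * ?n"
    have q0: "q \<ge> 0" using b by (simp add: q_def)
    have \<epsilon>0: "\<epsilon> \<ge> 0" using \<epsilon> by simp
    have G: "\<bar>mean_field g j h y - mean_field g j k y\<bar> \<le> q" if "j \<le> 5" for j y
      unfolding mean_field_diff[OF that L] q_def by (rule Gb[OF _ that L1_diff[OF L]])
    have Mq: "M * \<epsilon> * ?n = \<epsilon> * q + \<epsilon> * (t * q) + \<epsilon> * (t * t * q)"
      by (simp add: M_def q_def power2_eq_square algebra_simps)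
    have p: "0 \<le> \<epsilon> * q" "0 \<le> \<epsilon> * (t * q)" "0 \<le> \<epsilon> * (t * t * q)" using t q0 \<epsilon>0 by auto
    show "C2_close (cmap \<epsilon> h) (coup1 T T1 g \<epsilon> h) (coup2 T T1 T2 g \<epsilon> h)
                (cmap \<epsilon> k) (coup1 T T1 g \<epsilon> k) (coup2 T T1 T2 g \<epsilon> k) (M * \<epsilon> * ?n)"
      unfolding C2_close_def Mq
    proof (intro allI conjI)
      fix x
      let ?d = "\<lambda>j. mean_field g j h (T x) - mean_field g j k (T x)"
      have 0: "\<bar>\<epsilon> * ?d 0\<bar> \<le> \<epsilon> * q" unfolding abs_mult using G[of 0] \<epsilon>0 by (intro mult_mono) auto
      have 1: "\<bar>\<epsilon> * (T1 x * ?d 1)\<bar> \<le> \<epsilon> * (t * q)" "\<bar>\<epsilon> * (T2 x * ?d 1)\<bar> \<le> \<epsilon> * (t * q)"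
        unfolding abs_mult using G[of 1] \<epsilon>0 t q0 by (intro mult_mono; auto)+
      have 2: "\<bar>\<epsilon> * (T1 x * T1 x * ?d 2)\<bar> \<le> \<epsilon> * (t * t * q)"
        unfolding abs_mult using G[of 2] \<epsilon>0 t q0 by (intro mult_mono) auto
      have "cmap \<epsilon> h x - cmap \<epsilon> k x = \<epsilon> * ?d 0" by (simp add: cmap_eq algebra_simps)
      then show "\<bar>cmap \<epsilon> h x - cmap \<epsilon> k x\<bar> \<le> \<epsilon> * q + \<epsilon> * (t * q) + \<epsilon> * (t * t * q)" using 0 p by linarith
      have "coup1 T T1 g \<epsilon> h x - coup1 T T1 g \<epsilon> k x = \<epsilon> * (T1 x * ?d 1)" by (simp add: coup1_def algebra_simps)
      then show "\<bar>coup1 T T1 g \<epsilon> h x - coup1 T T1 g \<epsilon> k x\<bar> \<le> \<epsilon> * q + \<epsilon> * (t * q) + \<epsilon> * (t * t * q)" using 1 p by linarith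
      have "coup2 T T1 T2 g \<epsilon> h x - coup2 T T1 T2 g \<epsilon> k x = \<epsilon> * (T2 x * ?d 1) + \<epsilon> * (T1 x * T1 x * ?d 2)"
        by (simp add: coup2_def power2_eq_square algebra_simps)
      then show "\<bar>coup2 T T1 T2 g \<epsilon> h x - coup2 T T1 T2 g \<epsilon> k x\<bar> \<le> \<epsilon> * q + \<epsilon> * (t * q) + \<epsilon> * (t * t * q)"
        using 1 2 p by linarith
    qed
  qed
qed

abbreviation LL :: "real \<Rightarrow> (real \<Rightarrow> real) \<Rightarrow> (real \<Rightarrow> real) \<Rightarrow> real \<Rightarrow> real" where
  "LL \<epsilon> h \<equiv> transfer_op (cmap \<epsilon> h)"

lemma cmap_lift:
  assumes "\<epsilon> \<in> {0..\<epsilon>\<^sub>0}" "h \<in> Dens"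
  shows "C1_lift (cmap \<epsilon> h) (coup1 T T1 g \<epsilon> h)"
  by (rule family_regular) (use assms expanding_lift_C1 in blast)

lemma LL_Lipschitz:
  obtains A where "A \<ge> 0"
    "\<And>\<epsilon> h k f. \<epsilon> \<in> {0..\<epsilon>\<^sub>0} \<Longrightarrow> h \<in> Dens \<Longrightarrow> k \<in> Dens \<Longrightarrow> f \<in> W1 1 \<Longrightarrow>
       L1_norm (\<lambda>x. LL \<epsilon> h f x - LL \<epsilon> k f x) \<le> A * \<epsilon> * L1_norm (\<lambda>x. h x - k x) * W1_norm 1 f"
    "\<And>\<epsilon> h k f. \<epsilon> \<in> {0..\<epsilon>\<^sub>0} \<Longrightarrow> h \<in> Dens \<Longrightarrow> k \<in> Dens \<Longrightarrow> f \<in> W1 2 \<Longrightarrow>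
       (\<lambda>x. LL \<epsilon> h f x - LL \<epsilon> k f x) \<in> W1 1 \<and>
       W1_norm 1 (\<lambda>x. LL \<epsilon> h f x - LL \<epsilon> k f x) \<le> A * \<epsilon> * L1_norm (\<lambda>x. h x - k x) * W1_norm 2 f"
proof -
  obtain c M where cM: "c \<ge> 0" "M \<ge> 0"
    and reg: "\<And>\<epsilon> h. \<epsilon> \<in> {0..\<epsilon>\<^sub>0} \<Longrightarrow> h \<in> Dens \<Longrightarrow>
       expanding_lift (cmap \<epsilon> h) (coup1 T T1 g \<epsilon> h) (coup2 T T1 T2 g \<epsilon> h) (coup3 T T1 T2 T3 g \<epsilon> h) c"
    and cl: "\<And>\<epsilon> h k. \<epsilon> \<in> {0..\<epsilon>\<^sub>0} \<Longrightarrow> h \<in> Dens \<Longrightarrow> k \<in> Dens \<Longrightarrow>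
       C2_close (cmap \<epsilon> h) (coup1 T T1 g \<epsilon> h) (coup2 T T1 T2 g \<epsilon> h)
                (cmap \<epsilon> k) (coup1 T T1 g \<epsilon> k) (coup2 T T1 T2 g \<epsilon> k) (M * \<epsilon> * L1_norm (\<lambda>x. h x - k x))"
    by (rule family_regular) blast
  define a where "a = 4 + 6 * c"
  define s where "s = 3 + 2 * c + 2 * c\<^sup>2"
  have as: "a \<ge> 0" "s \<ge> 1" using cM(1) by (auto simp: a_def s_def)
  show ?thesis
  proof (rule that[of "a * s * M"])
    show "0 \<le> a * s * M" using as cM by simp
    fix \<epsilon> h k f assume *: "\<epsilon> \<in> {0..\<epsilon>\<^sub>0}" "h \<in> Dens" "k \<in> Dens"
    note R = reg[OF *(1,2)] reg[OF *(1,3)] cl[OF *]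
    note C = expanding_lift_C1[OF R(1)] expanding_lift_C1[OF R(2)]
    let ?n = "L1_norm (\<lambda>x. h x - k x)"
    { assume f: "f \<in> W1 1"
      then obtain u where u: "f \<in> L1" "is_weak_deriv 1 f u" unfolding One_nat_def by (rule W1_SucE) auto
      have n: "W1_norm 1 f = L1_norm f + L1_norm u" unfolding One_nat_def W1_norm_Suc[OF u] by simp
      have "L1_norm (\<lambda>x. LL \<epsilon> h f x - LL \<epsilon> k f x) \<le> a * (M * \<epsilon> * ?n) * W1_norm 1 f"
        unfolding n a_def
        by (rule transfer_Lipschitz_L1[OF R u transfer_op_is_transfer[OF C(1) u(1)] transfer_op_is_transfer[OF C(2) u(1)]])
      also have "\<dots> = a * 1 * (M * \<epsilon> * ?n * W1_norm 1 f)" by simp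
      also have "\<dots> \<le> a * s * (M * \<epsilon> * ?n * W1_norm 1 f)"
        using as cM *(1) by (intro mult_right_mono mult_left_mono mult_nonneg_nonneg) auto
      finally show "L1_norm (\<lambda>x. LL \<epsilon> h f x - LL \<epsilon> k f x) \<le> a * s * M * \<epsilon> * ?n * W1_norm 1 f"
        by (simp add: mult.assoc) }
    { assume f: "f \<in> W1 2"
      then have fL: "f \<in> L1" by (rule W1_L1)
      note tr = transfer_op_is_transfer[OF C(1) fL] transfer_op_is_transfer[OF C(2) fL]
      show "(\<lambda>x. LL \<epsilon> h f x - LL \<epsilon> k f x) \<in> W1 1 \<and>
       W1_norm 1 (\<lambda>x. LL \<epsilon> h f x - LL \<epsilon> k f x) \<le> a * s * M * \<epsilon> * ?n * W1_norm 2 f"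
        using transfer_Lipschitz_W1[OF R f tr] by (simp add: a_def s_def mult.assoc) }
  qed
qed

end

section \<open>Mixing of the uncoupled map\<close>

lemma affine_recursion:
  fixes a :: "nat \<Rightarrow> real"
  assumes "\<And>n. a (Suc n) \<le> r * a n + b" "0 \<le> r" "r < 1" "0 \<le> b"
  shows "a n \<le> r ^ n * a 0 + b / (1 - r)"
proof (induction n)
  case 0
  then show ?case using assms by simp
next
  case (Suc n)
  have "a (Suc n) \<le> r * (r ^ n * a 0 + b / (1 - r)) + b"
    using assms(1)[of n] mult_left_mono[OF Suc assms(2)] by linarith
  also have "\<dots> = r ^ Suc n * a 0 + b / (1 - r)" using assms(3) by (simp add: field_simps)
  finally show ?case .
qed

lemma measure_circ_Ico:
  assumes "0 \<le> p" "p \<le> q" "q \<le> 1"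
  shows "(\<integral>x. indicator {p..<q} x \<partial>circ) = q - (p::real)"
proof -
  have "indicator {0..<1} x * indicator {p..<q} x = (indicator {p..<q} x :: real)" for x
    using assms by (auto split: split_indicator)
  then have "(\<integral>x. indicator {p..<q} x \<partial>circ) = (\<integral>x. (indicator {p..<q} x :: real) \<partial>lborel)"
    unfolding integral_circ by (simp only:)
  then show ?thesis using assms by simp
qed

definition grid :: "nat \<Rightarrow> nat \<Rightarrow> real set" where
  "grid m i = {real i / real m ..< real (Suc i) / real m}"

lemma grid_sum:
  assumes "m \<ge> 1" "x \<in> {0..<1}"
  shows "(\<Sum>i<m. indicator (grid m i) x) = (1::real)"
proof -
  define j where "j = nat \<lfloor>real m * x\<rfloor>"
  have "0 \<le> real m * x" "real m * x < m" using assms by auto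
  then have j: "j < m" and fl: "real j \<le> real m * x" "real m * x < real j + 1"
    unfolding j_def by linarith+
  have "x \<in> grid m i \<longleftrightarrow> i = j" for i
  proof
    assume "x \<in> grid m i"
    then have "real i \<le> real m * x" "real m * x < real i + 1" using assms by (auto simp: grid_def field_simps)
    then show "i = j" using fl by linarith
  next
    assume "i = j" then show "x \<in> grid m i" using fl assms by (auto simp: grid_def field_simps)
  qed
  then have "(\<Sum>i<m. indicator (grid m i) x) = (\<Sum>i<m. if i = j then 1 else (0::real))"
    by (intro sum.cong) (auto split: split_indicator)
  then show ?thesis using j by simp
qed

lemma grid_subset: "m \<ge> 1 \<Longrightarrow> i < m \<Longrightarrow> grid m i \<subseteq> {0..<1}"
proof
  fix x assume "m \<ge> 1" "i < m" "x \<in> grid m i"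
  then have "0 \<le> real i / m" "real (Suc i) / m \<le> 1" "real i / m \<le> x" "x < real (Suc i) / m"
    by (auto simp: grid_def)
  then show "x \<in> {0..<1}" unfolding atLeastLessThan_iff by linarith
qed

lemma integral_grid_sum:
  fixes f :: "real \<Rightarrow> real"
  assumes "m \<ge> 1" "integrable circ f"
  shows "(\<integral>x. f x \<partial>circ) = (\<Sum>i<m. \<integral>x. indicator (grid m i) x * f x \<partial>circ)"
proof -
  have g: "grid m i \<in> sets borel" for i by (simp add: grid_def)
  have "(\<integral>x. f x \<partial>circ) = (\<integral>x. (\<Sum>i<m. indicator (grid m i) x * f x) \<partial>circ)"
    by (rule Bochner_Integration.integral_cong)
       (simp_all add: grid_sum[OF assms(1)] flip: sum_distrib_right)
  also have "\<dots> = (\<Sum>i<m. \<integral>x. indicator (grid m i) x * f x \<partial>circ)"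
    using g assms(2)
    by (intro Bochner_Integration.integral_sum integrable_mult_bounded[where b=1])
       (auto intro!: measurable_circ split: split_indicator)
  finally show ?thesis .
qed

text \<open>Otherwise the positive part, which has integral \<open>\<parallel>v\<parallel>/2\<close>, would on every grid cell be
  bounded by \<open>\<parallel>v\<parallel>/4\<close> plus the variation over the cell, and adding up gives too little mass.\<close>

lemma large_on_grid_cell:
  assumes v: "per_C1 v v'" and z: "(\<integral>x. v x \<partial>circ) = 0" and m: "m \<ge> 1"
    and pos: "L1_norm v > 0" and var: "L1_norm v' \<le> real m / 8 * L1_norm v"
  obtains i where "i < m" "\<And>x. x \<in> grid m i \<Longrightarrow> v x \<ge> L1_norm v / 4"
proof (rule ccontr)
  define a where "a = L1_norm v"
  assume "\<not> thesis"
  then have "\<forall>i<m. \<exists>x\<in>grid m i. v x < a / 4" using that unfolding a_def by (meson not_le)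
  then obtain \<xi> where \<xi>: "\<And>i. i < m \<Longrightarrow> \<xi> i \<in> grid m i" "\<And>i. i < m \<Longrightarrow> v (\<xi> i) < a / 4" by metis
  note V = per_C1D[OF v]
  have vL: "v \<in> L1" "v' \<in> L1" using V by (auto intro: L1_cont)
  define p where "p x = (\<bar>v x\<bar> + v x) / 2" for x
  have pL: "p \<in> L1" unfolding p_def using L1_cmult[OF L1_add[OF L1_abs[OF vL(1)] vL(1)], of "1/2"] by simp
  define \<omega> where "\<omega> i = (\<integral>x. indicator (grid m i) x * \<bar>v' x\<bar> \<partial>circ)" for i
  have gm: "grid m i \<in> sets borel" for i by (simp add: grid_def)
  have ig: "integrable circ (\<lambda>x. indicator (grid m i) x * f x)" if "integrable circ f" for f :: "real \<Rightarrow> real" and i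
    using gm that by (intro integrable_mult_bounded[where b=1])
       (auto intro!: measurable_circ split: split_indicator)
  have \<omega>0: "\<omega> i \<ge> 0" for i unfolding \<omega>_def by (intro Bochner_Integration.integral_nonneg) auto
  have osc: "v y \<le> v x + \<omega> i" if "x \<in> grid m i" "y \<in> grid m i" "i < m" for x y i
  proof -
    define l r where "l = min x y" and "r = max x y"
    have lr: "0 \<le> l" "l \<le> r" "r \<le> 1" and sub: "{l..r} \<subseteq> grid m i"
    proof -
      have "x \<in> {0..<1}" "y \<in> {0..<1}" using that grid_subset[OF m that(3)] by blast+
      then show "0 \<le> l" "l \<le> r" "r \<le> 1" by (auto simp: l_def r_def)
      show "{l..r} \<subseteq> grid m i" using that by (auto simp: l_def r_def grid_def)
    qed
    have vi: "integrable circ v'" using vL(2) by (rule L1D)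
    have iv: "integrable circ (\<lambda>x. indicator {l..r} x * v' x)"
      using vi by (intro integrable_mult_bounded[where b=1]) (auto intro!: measurable_circ split: split_indicator)
    have "\<bar>v r - v l\<bar> = \<bar>\<integral>x. indicator {l..r} x * v' x \<partial>circ\<bar>"
      using integral_circ_FTC[OF V(2,3) lr] by simp
    also have "\<dots> \<le> (\<integral>x. \<bar>indicator {l..r} x * v' x\<bar> \<partial>circ)" by (rule integral_abs_bound)
    also have "\<dots> \<le> \<omega> i"
      unfolding \<omega>_def using iv vi sub
      by (intro integral_mono integrable_abs ig) (auto split: split_indicator)
    finally have "\<bar>v r - v l\<bar> \<le> \<omega> i" .
    then show ?thesis by (auto simp: l_def r_def min_def max_def split: if_splits)
  qed
  have cell: "(\<integral>x. indicator (grid m i) x * p x \<partial>circ) \<le> (a / 4 + \<omega> i) / m" if "i < m" for i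
  proof -
    have "(\<integral>x. indicator (grid m i) x * p x \<partial>circ) \<le> (\<integral>x. indicator (grid m i) x * (a / 4 + \<omega> i) \<partial>circ)"
    proof (intro integral_mono ig)
      show "integrable circ p" using pL by (rule L1D)
      fix y
      have "p y \<le> a / 4 + \<omega> i" if y: "y \<in> grid m i"
        using osc[OF \<xi>(1)[OF \<open>i < m\<close>] y \<open>i < m\<close>] \<xi>(2)[OF \<open>i < m\<close>] \<omega>0[of i] pos by (auto simp: p_def a_def abs_if)
      then show "indicator (grid m i) y * p y \<le> indicator (grid m i) y * (a / 4 + \<omega> i)" by (auto split: split_indicator)
    qed simp
    also have "\<dots> = (a / 4 + \<omega> i) * (\<integral>x. indicator (grid m i) x \<partial>circ)" by (simp add: mult.commute)
    also have "(\<integral>x. indicator (grid m i) x \<partial>circ) = 1 / m"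
    proof -
      have "real (Suc i) / real m - real i / real m = 1 / real m" by (simp add: add_divide_distrib)
      then show ?thesis unfolding grid_def using that m by (subst measure_circ_Ico) (auto simp: divide_right_mono)
    qed
    finally show ?thesis by simp
  qed
  have "a / 2 = (\<integral>x. p x \<partial>circ)" unfolding p_def a_def L1_norm_def using vL(1) z by (simp add: L1D)
  also have "\<dots> = (\<Sum>i<m. \<integral>x. indicator (grid m i) x * p x \<partial>circ)" by (rule integral_grid_sum[OF m L1D(2)[OF pL]])
  also have "\<dots> \<le> (\<Sum>i<m. (a / 4 + \<omega> i) / m)" by (rule sum_mono) (use cell in auto)
  also have "\<dots> = a / 4 + (\<Sum>i<m. \<omega> i) / m"
    using m by (simp add: sum.distrib add_divide_distrib flip: sum_divide_distrib)
  also have "(\<Sum>i<m. \<omega> i) = L1_norm v'"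
    unfolding \<omega>_def L1_norm_def using vL(2) by (intro integral_grid_sum[OF m, symmetric]) (simp add: L1D)
  also have "a / 4 + L1_norm v' / m \<le> a / 4 + a / 8"
    using var m by (simp add: a_def field_simps)
  finally show False using pos by (simp add: a_def)
qed

text \<open>An interval of length two contains a full period that starts at an integer.\<close>

lemma integral_substitution_covering:
  assumes D: "\<And>x. (S has_real_derivative S1 x) (at x)" and c: "continuous_on UNIV S1" and S1: "\<And>x. S1 x > 0"
    and pq: "0 \<le> p" "p \<le> q" "q \<le> 1" and cover: "S q - S p \<ge> 2"
    and \<eta>: "periodic1 \<eta>" "\<eta> \<in> borel_measurable borel" "\<And>x. 0 \<le> \<eta> x" "\<And>x. \<eta> x \<le> b"
  shows "(\<integral>x. \<eta> x \<partial>circ) \<le> (\<integral>x. indicator {p..q} x * (\<eta> (S x) * S1 x) \<partial>circ)"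
proof -
  define k :: int where "k = \<lceil>S p\<rceil>"
  have k: "S p \<le> k" "real_of_int k + 1 \<le> S q" using cover unfolding k_def by linarith+
  have bd: "integrable lborel (\<lambda>x. indicator {l..r} x * \<eta> x)" for l r
  proof (rule Bochner_Integration.integrable_bound[where f="\<lambda>x. b * indicator {l..r} x"])
    have "0 \<le> b" using \<eta>(3,4) order_trans by blast
    then show "AE x in lborel. norm (indicator {l..r} x * \<eta> x) \<le> norm (b * indicator {l..r} x :: real)"
      using \<eta>(3,4) by (auto split: split_indicator)
    show "integrable lborel (\<lambda>x. b * indicator {l..r} x)"
      by (intro integrable_mult_right integrable_real_indicator) (auto simp: emeasure_lborel_Icc_eq)
  qed (use \<eta>(2) in auto)
  have "set_integrable lborel {S p..S q} \<eta>" using bd by (simp add: set_integrable_def)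
  from integral_substitution(2)[OF this D continuous_on_subset[OF c] less_imp_le[OF S1] pq(2)]
  have sub: "(\<integral>x. \<eta> x * indicator {S p..S q} x \<partial>lborel) = (\<integral>x. \<eta> (S x) * S1 x * indicator {p..q} x \<partial>lborel)" by simp
  have "(\<integral>x. \<eta> x \<partial>circ) = (\<integral>x. indicator {0..1} x * \<eta> x \<partial>lborel)"
    unfolding integral_circ
  proof (rule integral_cong_AE)
    have "AE x in lborel. x \<noteq> (1::real)" by (rule AE_lborel_singleton)
    then show "AE x in lborel. indicator {0..<1} x * \<eta> x = indicator {0..1} x * \<eta> x"
      by eventually_elim (auto split: split_indicator)
  qed (use \<eta>(2) in measurable)
  also have "\<dots> = (\<integral>x. indicator {real_of_int k..real_of_int k + 1} x * \<eta> x \<partial>lborel)"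
    using lborel_integral_real_affine[of 1 "\<lambda>x. indicator {real_of_int k..real_of_int k + 1} x * \<eta> x" "real_of_int k"]
      periodic1_of_int[OF \<eta>(1), of _ k]
    by (simp add: add.commute indicator_def cong: if_cong)
  also have "\<dots> \<le> (\<integral>x. indicator {S p..S q} x * \<eta> x \<partial>lborel)"
    using bd k \<eta>(3) by (intro integral_mono) (auto split: split_indicator)
  also have "\<dots> = (\<integral>x. \<eta> (S x) * S1 x * indicator {p..q} x \<partial>lborel)" using sub by (simp add: mult.commute)
  also have "\<dots> = (\<integral>x. indicator {p..q} x * (\<eta> (S x) * S1 x) \<partial>circ)"
    unfolding integral_circ
  proof (rule integral_cong_AE)
    have "AE x in lborel. x \<noteq> (1::real)" by (rule AE_lborel_singleton)
    then show "AE x in lborel. \<eta> (S x) * S1 x * indicator {p..q} x = indicator {0..<1} x * (indicator {p..q} x * (\<eta> (S x) * S1 x))"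
      by eventually_elim (use pq in \<open>auto split: split_indicator\<close>)
    have [measurable]: "S \<in> borel_measurable borel" "S1 \<in> borel_measurable borel"
      using D c by (auto intro!: borel_measurable_continuous_onI continuous_at_imp_continuous_on DERIV_isCont)
    note [measurable] = \<eta>(2)
    show "(\<lambda>x. \<eta> (S x) * S1 x * indicator {p..q} x) \<in> borel_measurable lborel"
      "(\<lambda>x. indicator {0..<1} x * (indicator {p..q} x * (\<eta> (S x) * S1 x))) \<in> borel_measurable lborel" by measurable
  qed
  finally show ?thesis .
qed

text \<open>Doeblin's argument.  A zero-mean function of controlled variation is large positive on one cell and
  large negative on another; both cells are spread over the whole circle, so a definite proportion of
  the two masses cancels.\<close>

lemma doeblin_smooth:
  assumes D: "\<And>x. (S has_real_derivative S1 x) (at x)" and c: "continuous_on UNIV S1"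
    and S1: "\<And>x. S1 x > 0" "\<And>x. S1 x \<le> d" and m: "m \<ge> 1"
    and cover: "\<And>x. S (x + 1 / real m) - S x \<ge> 2"
    and \<phi>: "periodic1 \<phi>" "\<phi> \<in> borel_measurable borel" "\<And>x. \<bar>\<phi> x\<bar> \<le> 1"
    and v: "per_C1 v v'" and z: "(\<integral>x. v x \<partial>circ) = 0" and var: "L1_norm v' \<le> real m / 8 * L1_norm v"
  shows "(\<integral>x. \<phi> (S x) * v x \<partial>circ) \<le> (1 - 1 / (2 * d)) * L1_norm v"
proof (cases "L1_norm v > 0")
  case False
  then have v0: "L1_norm v = 0" using L1_norm_nonneg[of v] by linarith
  have vL: "v \<in> L1" using per_C1D(1,4)[OF v] by (rule L1_cont)
  have "AE x in circ. v x = 0" using L1_norm_eq_0[OF vL] v0 by simp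
  then have "(\<integral>x. \<phi> (S x) * v x \<partial>circ) = 0" by (intro integral_eq_zero_AE) auto
  then show ?thesis using v0 by simp
next
  case pos: True
  define a where "a = L1_norm v"
  have a: "a > 0" using pos by (simp add: a_def)
  have d: "d > 0" using S1[of 0] by linarith
  note V = per_C1D[OF v]
  have vL: "v \<in> L1" using V by (auto intro: L1_cont)
  have [measurable]: "S \<in> borel_measurable borel" "S1 \<in> borel_measurable borel"
    using D c by (auto intro!: borel_measurable_continuous_onI continuous_at_imp_continuous_on DERIV_isCont)
  note [measurable] = \<phi>(2)
  obtain i where i: "i < m" "\<And>x. x \<in> grid m i \<Longrightarrow> v x \<ge> a / 4"
    using large_on_grid_cell[OF v z m pos var] unfolding a_def by blast
  have v2: "per_C1 (\<lambda>x. - v x) (\<lambda>x. - v' x)"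
    using v by (auto simp: per_C1_def periodic1_def intro!: derivative_eq_intros continuous_intros)
  obtain j where j: "j < m" "\<And>x. x \<in> grid m j \<Longrightarrow> - v x \<ge> a / 4"
    using large_on_grid_cell[OF v2 _ m] pos var z unfolding a_def L1_norm_uminus by auto
  let ?J = "\<lambda>i. {real i / real m..real (Suc i) / real m}"
  have spread: "(\<integral>x. \<eta> x \<partial>circ) \<le> d * (\<integral>x. indicator (?J i) x * \<eta> (S x) \<partial>circ)"
    if i: "i < m" and \<eta>: "periodic1 \<eta>" "\<eta> \<in> borel_measurable borel" "\<And>x. 0 \<le> \<eta> x" "\<And>x. \<eta> x \<le> 2" for \<eta> i
  proof -
    note [measurable] = \<eta>(2)
    have "real (Suc i) / real m = real i / real m + 1 / real m" by (simp add: add_divide_distrib)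
    then have "S (real (Suc i) / real m) - S (real i / real m) \<ge> 2" using cover by simp
    then have "(\<integral>x. \<eta> x \<partial>circ) \<le> (\<integral>x. indicator (?J i) x * (\<eta> (S x) * S1 x) \<partial>circ)"
      using i m by (intro integral_substitution_covering[OF D c S1(1) _ _ _ _ \<eta>]) (auto simp: divide_right_mono)
    also have "\<dots> \<le> (\<integral>x. d * (indicator (?J i) x * \<eta> (S x)) \<partial>circ)"
    proof (rule integral_mono)
      have [simp]: "\<bar>\<eta> x\<bar> \<le> 2" for x using \<eta>(3,4)[of x] by simp
      show "integrable circ (\<lambda>x. indicator (?J i) x * (\<eta> (S x) * S1 x))"
      proof (rule integrable_circ_bounded[where b="2 * d"])
        show "(\<lambda>x. indicator (?J i) x * (\<eta> (S x) * S1 x)) \<in> borel_measurable circ" by (rule measurable_circ) measurable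
        show "\<bar>indicator (?J i) x * (\<eta> (S x) * S1 x)\<bar> \<le> 2 * d" for x
        proof -
          have "\<bar>\<eta> (S x)\<bar> * \<bar>S1 x\<bar> \<le> 2 * d" using S1[of x] by (intro mult_mono) auto
          then show ?thesis using d by (auto split: split_indicator simp: abs_mult)
        qed
      qed
      show "integrable circ (\<lambda>x. d * (indicator (?J i) x * \<eta> (S x)))"
      proof (intro integrable_mult_right integrable_circ_bounded[where b=2])
        show "(\<lambda>x. indicator (?J i) x * \<eta> (S x)) \<in> borel_measurable circ" by (rule measurable_circ) measurable
      qed (auto split: split_indicator)
      show "indicator (?J i) x * (\<eta> (S x) * S1 x) \<le> d * (indicator (?J i) x * \<eta> (S x))" for x
        using mult_left_mono[OF S1(2)[of x] \<eta>(3)[of "S x"]] by (auto split: split_indicator simp: mult.commute)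
    qed
    finally show ?thesis by simp
  qed
  let ?p = "\<lambda>x. 1 - \<phi> x" and ?q = "\<lambda>x. 1 + \<phi> x"
  have \<phi>b: "- 1 \<le> \<phi> x" "\<phi> x \<le> 1" for x using \<phi>(3)[of x] by auto
  have \<phi>L: "\<phi> \<in> L1" by (rule L1_bounded[OF \<phi>])
  have 1: "(\<integral>x. ?p x \<partial>circ) \<le> d * (\<integral>x. indicator (?J i) x * ?p (S x) \<partial>circ)"
    by (rule spread[OF i(1)]) (use \<phi> \<phi>b in \<open>auto simp: periodic1_def\<close>)
  have 2: "(\<integral>x. ?q x \<partial>circ) \<le> d * (\<integral>x. indicator (?J j) x * ?q (S x) \<partial>circ)"
  proof (rule spread[OF j(1)])
    show "0 \<le> ?q x" "?q x \<le> 2" for x using \<phi>b[of x] by linarith+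
  qed (use \<phi> in \<open>auto simp: periodic1_def\<close>)
  have "(\<integral>x. ?p x \<partial>circ) + (\<integral>x. ?q x \<partial>circ) = 2" using \<phi>L by (simp add: L1D)
  with 1 2 have tot: "2 / d \<le> (\<integral>x. indicator (?J i) x * ?p (S x) \<partial>circ) + (\<integral>x. indicator (?J j) x * ?q (S x) \<partial>circ)"
    using d by (simp add: field_simps)
  have int: "integrable circ (\<lambda>x. indicator (?J i) x * ?p (S x))" "integrable circ (\<lambda>x. indicator (?J j) x * ?q (S x))"
  proof -
    have "\<bar>indicator (?J i) x * ?p (S x)\<bar> \<le> 2" "\<bar>indicator (?J j) x * ?q (S x)\<bar> \<le> 2" for x
      using \<phi>b[of "S x"] by (auto split: split_indicator simp: abs_le_iff)
    moreover have "(\<lambda>x. indicator (?J i) x * ?p (S x)) \<in> borel_measurable borel"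
      "(\<lambda>x. indicator (?J j) x * ?q (S x)) \<in> borel_measurable borel" by measurable
    ultimately show "integrable circ (\<lambda>x. indicator (?J i) x * ?p (S x))" "integrable circ (\<lambda>x. indicator (?J j) x * ?q (S x))"
      using integrable_circ_bounded[OF measurable_circ] by blast+
  qed
  have iv: "integrable circ (\<lambda>x. \<phi> (S x) * v x)"
    using \<phi>(3) by (intro integrable_mult_bounded[OF L1D(2)[OF vL], where b=1] measurable_circ) auto
  have iav: "integrable circ (\<lambda>x. \<bar>v x\<bar>)" using vL by (simp add: L1D)
  have "a / 4 * (2 / d) \<le> a / 4 * ((\<integral>x. indicator (?J i) x * ?p (S x) \<partial>circ) + (\<integral>x. indicator (?J j) x * ?q (S x) \<partial>circ))"
    using tot a by (intro mult_left_mono) auto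
  also have "\<dots> = (\<integral>x. a / 4 * (indicator (?J i) x * ?p (S x) + indicator (?J j) x * ?q (S x)) \<partial>circ)"
    using int by simp
  also have "\<dots> \<le> (\<integral>x. \<bar>v x\<bar> - \<phi> (S x) * v x \<partial>circ)"
  proof (rule integral_mono_AE)
    have "AE x in lborel. x \<noteq> real (Suc i) / real m" "AE x in lborel. x \<noteq> real (Suc j) / real m"
      by (rule AE_lborel_singleton)+
    then show "AE x in circ. a / 4 * (indicator (?J i) x * ?p (S x) + indicator (?J j) x * ?q (S x)) \<le> \<bar>v x\<bar> - \<phi> (S x) * v x"
      unfolding AE_circ
    proof (eventually_elim, intro impI)
      fix x :: real assume x: "x \<noteq> real (Suc i) / real m" "x \<noteq> real (Suc j) / real m"
      have ge: "\<phi> (S x) * v x \<le> \<bar>v x\<bar>"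
        using abs_le_D1[of "\<phi> (S x) * v x"] mult_right_mono[OF \<phi>(3)[of "S x"] abs_ge_zero[of "v x"]] by (simp add: abs_mult)
      have Ji: "x \<in> ?J i \<longleftrightarrow> x \<in> grid m i" and Jj: "x \<in> ?J j \<longleftrightarrow> x \<in> grid m j" using x by (auto simp: grid_def)
      consider "x \<in> grid m i" "x \<notin> grid m j" | "x \<notin> grid m i" "x \<in> grid m j" | "x \<notin> grid m i" "x \<notin> grid m j"
        using i(2)[of x] j(2)[of x] a by fastforce
      then show "a / 4 * (indicator (?J i) x * ?p (S x) + indicator (?J j) x * ?q (S x)) \<le> \<bar>v x\<bar> - \<phi> (S x) * v x"
      proof cases
        case 1
        have "a / 4 * ?p (S x) \<le> v x * ?p (S x)" using i(2)[OF 1(1)] \<phi>b by (intro mult_right_mono) auto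
        then show ?thesis using 1 i(2)[OF 1(1)] a Ji Jj by (simp add: algebra_simps)
      next
        case 2
        have "a / 4 * ?q (S x) \<le> - v x * ?q (S x)" using j(2)[OF 2(2)] \<phi>b[of "S x"] by (intro mult_right_mono) auto
        then show ?thesis using 2 j(2)[OF 2(2)] a Ji Jj by (simp add: algebra_simps)
      next
        case 3
        then show ?thesis using ge Ji Jj by simp
      qed
    qed
  qed (use int iv iav in auto)
  also have "\<dots> = a - (\<integral>x. \<phi> (S x) * v x \<partial>circ)" using iv iav by (simp add: a_def L1_norm_def)
  finally show ?thesis using d unfolding a_def[symmetric] by (simp add: field_simps)
qed

context coupled_family
begin

abbreviation LT :: "(real \<Rightarrow> real) \<Rightarrow> real \<Rightarrow> real" where "LT \<equiv> transfer_op T"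

lemma LL_zero: "LL \<epsilon> (\<lambda>_. 0) = LT"
  by (simp add: cmap_0)

lemma zero_le_eps0: "0 \<in> {0..\<epsilon>\<^sub>0}"
  using eps0 by simp

lemma LL_LY:
  assumes "\<epsilon> \<in> {0..\<epsilon>\<^sub>0}" "h \<in> Dens" "i \<in> {1..4}" "f \<in> W1 i"
  shows "LL \<epsilon> h f \<in> W1 i" "W1_norm i (LL \<epsilon> h f) \<le> lam ^ i * W1_norm i f + C_LY * W1_norm (i - 1) f"
proof -
  have main: "LL \<epsilon> h f \<in> W1 i \<and> W1_norm i (LL \<epsilon> h f) \<le> lam ^ i * W1_norm i f + C_LY * W1_norm (i - 1) f"
    if "\<epsilon> \<in> {0..\<epsilon>\<^sub>0}" "h \<in> D1" for \<epsilon> h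
  proof -
    have "coupled_comp T g \<epsilon> [h] = cmap \<epsilon> h" by (simp add: coupled_comp_def)
    then show ?thesis
      using LY(2)[unfolded Lasota_Yorke_def, rule_format, of \<epsilon> "[h]" i f] that assms by simp
  qed
  have "LL \<epsilon> h f \<in> W1 i \<and> W1_norm i (LL \<epsilon> h f) \<le> lam ^ i * W1_norm i f + C_LY * W1_norm (i - 1) f"
  proof (cases "h \<in> D1")
    case False
    then have "LL \<epsilon> h = LL 0 (\<lambda>_. 1)" using assms(2) by (simp add: Dens_def cmap_0)
    then show ?thesis using main[OF zero_le_eps0 const_D1] by simp
  qed (use main assms in blast)
  then show "LL \<epsilon> h f \<in> W1 i" "W1_norm i (LL \<epsilon> h f) \<le> lam ^ i * W1_norm i f + C_LY * W1_norm (i - 1) f" by auto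
qed

lemma T_C1_lift: "C1_lift T T1"
  using cmap_lift[OF zero_le_eps0 zero_Dens] by (simp add: cmap_0 coup1_def[abs_def])

lemma T1_ge: "1 / lam \<le> \<bar>T1 x\<bar>"
  using coup1_ge[OF zero_le_eps0 zero_Dens, of x] by (simp add: coup1_def)

fun iter_deriv :: "nat \<Rightarrow> real \<Rightarrow> real" where
  "iter_deriv 0 x = 1" | "iter_deriv (Suc n) x = T1 ((T ^^ n) x) * iter_deriv n x"

lemma funpow_lift: "C1_lift (T ^^ n) (iter_deriv n)" "(1 / lam) ^ n \<le> \<bar>iter_deriv n x\<bar>" "periodic1 (iter_deriv n)"
proof -
  have "C1_lift (T ^^ n) (iter_deriv n) \<and> (\<forall>x. (1 / lam) ^ n \<le> \<bar>iter_deriv n x\<bar>) \<and> periodic1 (iter_deriv n)"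
  proof (induction n)
    case 0
    have "C1_lift (\<lambda>x. x) (\<lambda>_. 1)" unfolding C1_lift_def by (auto intro!: exI[of _ 1] derivative_eq_intros)
    then show ?case by (simp add: periodic1_def id_def)
  next
    case (Suc n)
    then have IH: "C1_lift (T ^^ n) (iter_deriv n)" "\<And>x. (1 / lam) ^ n \<le> \<bar>iter_deriv n x\<bar>" "periodic1 (iter_deriv n)" by auto
    obtain d :: int where d: "\<And>x. T (x + 1) = T x + of_int d" using T_lift by (auto simp: circle_lift_def)
    have p1: "periodic1 (\<lambda>x. T1 ((T ^^ n) x))"
      by (rule periodic1_comp_lift[OF IH(1) per_C1D(1)[OF T_derivs(2)]])
    have pe: "\<exists>d::int. \<forall>x. (T ^^ Suc n) (x + 1) = (T ^^ Suc n) x + of_int d"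
    proof -
      obtain e :: int where e: "\<And>x. (T ^^ n) (x + 1) = (T ^^ n) x + of_int e" using IH(1) by (auto simp: C1_lift_def)
      have dd: "T (x + of_int k) = T x + of_int (d * k)" for x and k :: int
      proof -
        have "periodic1 (\<lambda>x. T x - of_int d * x)" using d by (simp add: periodic1_def algebra_simps)
        from periodic1_of_int[OF this, of x k] show ?thesis by (simp add: algebra_simps)
      qed
      show ?thesis by (intro exI[of _ "d * e"]) (simp only: funpow.simps o_apply e dd, blast)
    qed
    have D: "((T ^^ Suc n) has_real_derivative iter_deriv (Suc n) x) (at x)" for x
      using DERIV_chain2[OF T_derivs(1) C1_liftD(1)[OF IH(1)]] by (simp add: o_def)
    have c: "continuous_on UNIV (iter_deriv (Suc n))"
      using continuous_on_compose2[OF per_C1D(4)[OF T_derivs(2)] C1_liftD(4)[OF IH(1)]] C1_liftD(2)[OF IH(1)]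
      by (auto intro!: continuous_on_mult)
    have b: "(1 / lam) ^ Suc n \<le> \<bar>iter_deriv (Suc n) x\<bar>" for x
      using mult_mono[OF T1_ge[of "(T ^^ n) x"] IH(2)[of x]] lam by (simp add: abs_mult)
    have nz: "iter_deriv (Suc n) x \<noteq> 0" for x
      using b[of x] zero_less_power[of "1 / lam" "Suc n"] lam by (metis abs_zero divide_pos_pos not_le zero_less_one)
    show ?case using pe D c b nz p1 IH(3) unfolding C1_lift_def by (auto simp: periodic1_def)
  qed
  then show "C1_lift (T ^^ n) (iter_deriv n)" "(1 / lam) ^ n \<le> \<bar>iter_deriv n x\<bar>" "periodic1 (iter_deriv n)" by auto
qed

lemma iter_deriv_even_pos: "iter_deriv (2 * n) x > 0"
proof (induction n)
  case (Suc n)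
  have "T1 a * T1 b > 0" for a b
  proof (rule ccontr)
    assume neg: "\<not> ?thesis"
    have nz: "T1 x \<noteq> 0" for x using T1_ge[of x] lam by (auto simp: field_simps)
    then have "T1 a * T1 b < 0" using neg by (simp add: not_less less_le)
    moreover have "connected (range T1)" using per_C1D(4)[OF T_derivs(2)] by (intro connected_continuous_image) auto
    ultimately have "0 \<in> range T1"
      using connectedD_interval[of "range T1" "T1 a" "T1 b" 0] connectedD_interval[of "range T1" "T1 b" "T1 a" 0]
      by (auto simp: mult_less_0_iff less_imp_le)
    then show False using nz by auto
  qed
  then show ?case using Suc by (simp add: mult.assoc[symmetric])
qed simp

lemma LT_L1: "v \<in> L1 \<Longrightarrow> (LT ^^ n) v \<in> L1"
  by (induction n) (auto intro: transfer_op_L1[OF T_C1_lift])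

lemma LT_is_transfer:
  assumes "v \<in> L1"
  shows "is_transfer (T ^^ n) v ((LT ^^ n) v)"
proof (induction n)
  case 0
  show ?case using assms by (simp add: is_transfer_def)
next
  case (Suc n)
  show ?case
    using is_transfer_comp[OF T_C1_lift Suc transfer_op_is_transfer[OF T_C1_lift LT_L1[OF assms, of n]]] by (simp add: o_def)
qed

lemma LT_zero_mean: "v \<in> L1 \<Longrightarrow> (\<integral>x. v x \<partial>circ) = 0 \<Longrightarrow> (\<integral>x. (LT ^^ n) v x \<partial>circ) = 0"
  using is_transfer_integral[OF LT_is_transfer] by simp

lemma LT_W1: "v \<in> W1 1 \<Longrightarrow> (LT ^^ n) v \<in> W1 1"
  using LL_LY(1)[OF zero_le_eps0 zero_Dens, of 1] by (induction n) (auto simp: LL_zero)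

lemma LT_norm_mono: "v \<in> L1 \<Longrightarrow> L1_norm ((LT ^^ (n + k)) v) \<le> L1_norm ((LT ^^ n) v)"
proof (induction k)
  case (Suc k)
  have "L1_norm (LT ((LT ^^ (n + k)) v)) \<le> L1_norm ((LT ^^ (n + k)) v)"
    by (rule is_transfer_L1_norm[OF T_C1_lift LT_L1[OF Suc.prems] transfer_op_is_transfer[OF T_C1_lift LT_L1[OF Suc.prems]]])
  then show ?case using Suc by simp
qed simp

text \<open>Bounds all operator products, of any length, on \<open>W\<^sup>1\<^sup>,\<^sup>1\<close>: a geometric series of
  one-step Lasota-Yorke inequalities.\<close>

definition cW1 where "cW1 = 1 + C_LY / (1 - lam)"

lemma cW1_ge: "cW1 \<ge> 1"
  using LY(1) lam by (simp add: cW1_def)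

lemma LT_W1_norm:
  assumes v: "v \<in> W1 1"
  shows "W1_norm 1 ((LT ^^ n) v) \<le> cW1 * W1_norm 1 v"
proof -
  let ?b = "C_LY * L1_norm v"
  have vL: "v \<in> L1" using v by (rule W1_L1)
  have "W1_norm 1 ((LT ^^ n) v) \<le> lam ^ n * W1_norm 1 ((LT ^^ 0) v) + ?b / (1 - lam)"
  proof (rule affine_recursion)
    fix n
    have "W1_norm 1 (LT ((LT ^^ n) v)) \<le> lam ^ 1 * W1_norm 1 ((LT ^^ n) v) + C_LY * W1_norm (1 - 1) ((LT ^^ n) v)"
      using LL_LY(2)[OF zero_le_eps0 zero_Dens _ LT_W1[OF v], of n] by (simp add: LL_zero)
    moreover have "C_LY * L1_norm ((LT ^^ n) v) \<le> ?b"
      using LT_norm_mono[OF vL, of 0 n] LY(1) by (intro mult_left_mono) auto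
    ultimately show "W1_norm 1 ((LT ^^ Suc n) v) \<le> lam * W1_norm 1 ((LT ^^ n) v) + ?b" by simp
  qed (use lam LY(1) in auto)
  also have "\<dots> \<le> 1 * W1_norm 1 v + C_LY * W1_norm 1 v / (1 - lam)"
    using lam LY(1) L1_norm_le_W1_norm[of v 1] W1_norm_nonneg[of 1 v] power_le_one[of lam n]
    by (intro add_mono mult_mono divide_right_mono mult_left_mono) auto
  finally show ?thesis by (simp add: cW1_def algebra_simps)
qed

text \<open>Contraction in \<open>L\<^sup>1\<close> on a cone.  Fejer means reduce to smooth functions; an even number of steps
  makes the iterate orientation preserving.\<close>

lemma LT_contracts_cone:
  assumes "M \<ge> 0"
  obtains n c where "0 < c" "c \<le> 1"
    "\<And>v. v \<in> W1 1 \<Longrightarrow> (\<integral>x. v x \<partial>circ) = 0 \<Longrightarrow> W1_norm 1 v \<le> M * L1_norm v \<Longrightarrow>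
       L1_norm ((LT ^^ n) v) \<le> (1 - c) * L1_norm v"
proof -
  \<comment> \<open>Variation up to \<open>m/8\<close> is allowed on a grid of \<open>m\<close> cells; a factor 2 allows for the \<open>L\<^sup>1\<close> norm lost in the Fejer mean.\<close>
  obtain m :: nat where m: "16 * M < m" using reals_Archimedean2 by blast
  then have m1: "m \<ge> 1" using assms by (cases m) auto
  have "1 < (1 / lam)\<^sup>2" using lam by (intro one_less_power) auto
  then obtain k where k: "2 * real m < ((1 / lam)\<^sup>2) ^ k" using real_arch_pow by blast
  define n where "n = 2 * k"
  note S = funpow_lift[of n]
  have S1pos: "iter_deriv n x > 0" for x unfolding n_def by (rule iter_deriv_even_pos)
  obtain d0 where d0: "\<And>x. \<bar>iter_deriv n x\<bar> \<le> d0" using periodic1_cont_bounded[OF S(3) C1_liftD(2)[OF S(1)]] by blast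
  define d where "d = max 1 d0"
  have d: "d \<ge> 1" "\<And>x. iter_deriv n x \<le> d" using d0 by (auto simp: d_def abs_le_iff le_max_iff_disj)
  have cover: "(T ^^ n) (x + 1 / real m) - (T ^^ n) x \<ge> 2" for x
  proof -
    have "x < x + 1 / real m" using m1 by simp
    from MVT2[OF this] obtain \<xi> where "(T ^^ n) (x + 1 / real m) - (T ^^ n) x = (x + 1 / real m - x) * iter_deriv n \<xi>"
      using C1_liftD(1)[OF S(1)] by metis
    moreover have "2 * real m \<le> iter_deriv n \<xi>"
      using S(2)[of \<xi>] S1pos[of \<xi>] k by (simp add: n_def power_mult)
    moreover have "(x + 1 / real m - x) * iter_deriv n \<xi> = iter_deriv n \<xi> / real m" by simp
    ultimately show ?thesis using m1 by (simp add: le_divide_eq)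
  qed
  define c where "c = 1 / (2 * d)"
  show ?thesis
  proof (rule that[of c n])
    show c: "0 < c" "c \<le> 1" using d(1) by (auto simp: c_def field_simps)
    fix v assume v: "v \<in> W1 1" and z: "(\<integral>x. v x \<partial>circ) = 0" and vM: "W1_norm 1 v \<le> M * L1_norm v"
    obtain v' where v': "v \<in> L1" "is_weak_deriv 1 v v'" using v unfolding One_nat_def by (rule W1_SucE) auto
    have nv: "W1_norm 1 v = L1_norm v + L1_norm v'" unfolding One_nat_def W1_norm_Suc[OF v'] by simp
    have v'L: "v' \<in> L1" using v'(2) by (rule is_weak_deriv_L1)
    let ?u = "(LT ^^ n) v"
    have u: "?u \<in> L1" using v'(1) by (rule LT_L1)
    define \<phi> where "\<phi> x = sgn (?u x)" for x
    have \<phi>: "periodic1 \<phi>" "\<phi> \<in> borel_measurable borel" "\<And>x. \<bar>\<phi> x\<bar> \<le> 1"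
    proof -
      note [measurable] = L1D(4)[OF u]
      show "\<phi> \<in> borel_measurable borel" unfolding \<phi>_def[abs_def] by measurable
      show "periodic1 \<phi>" "\<bar>\<phi> x\<bar> \<le> 1" for x
        using L1D(1)[OF u] by (auto simp: \<phi>_def periodic1_def abs_sgn_eq)
    qed
    have \<phi>i: "\<phi> \<in> Linf" by (rule Linf_bounded[OF \<phi>])
    note \<phi>S = Linf_comp_lift[OF S(1) \<phi>i]
    have "L1_norm ?u = (\<integral>x. \<phi> x * ?u x \<partial>circ)"
      unfolding L1_norm_def \<phi>_def by (intro Bochner_Integration.integral_cong) (auto simp: sgn_if)
    also have "\<dots> = (\<integral>x. \<phi> ((T ^^ n) x) * v x \<partial>circ)"
      using is_transferD(2)[OF LT_is_transfer[OF v'(1)] \<phi>i] by simp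
    finally have nu: "L1_norm ?u = (\<integral>x. \<phi> ((T ^^ n) x) * v x \<partial>circ)" .
    have est: "L1_norm ?u \<le> (1 - c) * L1_norm v + 1 / sqrt N * L1_norm v'" if N: "N \<ge> 1" "1 / sqrt N * L1_norm v' \<le> L1_norm v / 2" for N :: nat
    proof -
      let ?w = "fejer_proj N v" and ?w' = "fejer_proj N v'"
      have w: "per_C1 ?w ?w'" by (rule fejer_weak_deriv[OF v'])
      have wL: "?w \<in> L1" "(\<lambda>x. ?w x - v x) \<in> L1" using v'(1) fejer_L1 by (auto intro: L1_diff)
      have wz: "(\<integral>x. ?w x \<partial>circ) = 0" using fejer_integral[OF N(1) v'(1)] z by simp
      have dist: "L1_norm (\<lambda>x. ?w x - v x) \<le> 1 / sqrt N * L1_norm v'" by (rule fejer_rate_L1[OF N(1) v'])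
      have "L1_norm v \<le> L1_norm ?w + L1_norm (\<lambda>x. ?w x - v x)"
        using L1_norm_triangle_diff[OF wL] by simp
      then have "L1_norm v / 2 \<le> L1_norm ?w" using dist N(2) by linarith
      then have "M * L1_norm v \<le> M * (2 * L1_norm ?w)" using assms by (intro mult_left_mono) auto
      also have "\<dots> \<le> real m / 8 * L1_norm ?w" using m mult_right_mono[of "2 * M" "real m / 8" "L1_norm ?w"] by simp
      finally have "L1_norm ?w' \<le> real m / 8 * L1_norm ?w"
        using fejer_L1_norm_le[OF N(1) v'L] vM nv L1_norm_nonneg[of v] by linarith
      from doeblin_smooth[OF C1_liftD(1,2)[OF S(1)] S1pos d(2) m1 cover \<phi> w wz this]
      have 1: "(\<integral>x. \<phi> ((T ^^ n) x) * ?w x \<partial>circ) \<le> (1 - c) * L1_norm ?w" by (simp add: c_def)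
      have "(1 - c) * L1_norm ?w \<le> (1 - c) * L1_norm v"
        using fejer_L1_norm_le[OF N(1) v'(1)] c by (intro mult_left_mono) auto
      moreover have "\<bar>\<integral>x. \<phi> ((T ^^ n) x) * (?w x - v x) \<partial>circ\<bar> \<le> 1 * L1_norm (\<lambda>x. ?w x - v x)"
        using \<phi>(3) by (intro abs_integral_mult_le wL LinfD(3)[OF \<phi>S]) auto
      moreover have "(\<integral>x. \<phi> ((T ^^ n) x) * (?w x - v x) \<partial>circ) = (\<integral>x. \<phi> ((T ^^ n) x) * ?w x \<partial>circ) - L1_norm ?u"
        unfolding nu right_diff_distrib using integrable_Linf_L1[OF \<phi>S] wL(1) v'(1) by simp
      ultimately show ?thesis using 1 dist by linarith
    qed
    show "L1_norm ?u \<le> (1 - c) * L1_norm v"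
    proof (cases "L1_norm v = 0")
      case True
      then show ?thesis using LT_norm_mono[OF v'(1), of 0 n] by simp
    next
      case False
      then have pos: "L1_norm v > 0" using L1_norm_nonneg[of v] by linarith
      have lim: "(\<lambda>N. 1 / sqrt (real N) * L1_norm v') \<longlonglongrightarrow> 0"
        by (intro tendsto_mult_left_zero tendsto_divide_0[OF tendsto_const] filterlim_at_top_imp_at_infinity
            filterlim_compose[OF sqrt_at_top filterlim_real_sequentially])
      have "\<forall>\<^sub>F N in sequentially. L1_norm ?u \<le> (1 - c) * L1_norm v + 1 / sqrt (real N) * L1_norm v'"
      proof -
        have "\<forall>\<^sub>F N in sequentially. 1 / sqrt (real N) * L1_norm v' < L1_norm v / 2"
          using order_tendstoD(2)[OF lim, of "L1_norm v / 2"] pos by simp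
        with eventually_ge_at_top[of 1] show ?thesis
          by eventually_elim (rule est; simp)
      qed
      moreover have "(\<lambda>N. (1 - c) * L1_norm v + 1 / sqrt (real N) * L1_norm v') \<longlonglongrightarrow> (1 - c) * L1_norm v + 0"
        by (intro tendsto_add tendsto_const lim)
      ultimately show ?thesis using tendsto_lowerbound by fastforce
    qed
  qed
qed

text \<open>As long as the \<open>L\<^sup>1\<close> norm has not dropped below \<open>\<delta>\<close> times the initial Sobolev norm, the
  orbit stays in one fixed cone, and there the \<open>L\<^sup>1\<close> norm decays geometrically.\<close>

lemma LT_mixing:
  assumes "\<delta> > 0"
  obtains n where "\<And>v. v \<in> W1 1 \<Longrightarrow> (\<integral>x. v x \<partial>circ) = 0 \<Longrightarrow> L1_norm ((LT ^^ n) v) \<le> \<delta> * W1_norm 1 v"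
proof -
  have "cW1 / \<delta> \<ge> 0" using cW1_ge assms by simp
  then obtain n1 c where c: "0 < c" "c \<le> 1"
    and con: "\<And>v. v \<in> W1 1 \<Longrightarrow> (\<integral>x. v x \<partial>circ) = 0 \<Longrightarrow> W1_norm 1 v \<le> cW1 / \<delta> * L1_norm v \<Longrightarrow>
       L1_norm ((LT ^^ n1) v) \<le> (1 - c) * L1_norm v"
    using LT_contracts_cone by metis
  obtain k where k: "(1 - c) ^ k < \<delta>" using real_arch_pow_inv[of \<delta> "1 - c"] assms c by auto
  show ?thesis
  proof (rule that[of "n1 * k"])
    fix v assume v: "v \<in> W1 1" and z: "(\<integral>x. v x \<partial>circ) = 0"
    have vL: "v \<in> L1" using v by (rule W1_L1)
    show "L1_norm ((LT ^^ (n1 * k)) v) \<le> \<delta> * W1_norm 1 v"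
    proof (rule ccontr)
      assume neg: "\<not> ?thesis"
      have big: "\<delta> * W1_norm 1 v < L1_norm ((LT ^^ (n1 * i)) v)" if "i \<le> k" for i
      proof -
        have "n1 * k = n1 * i + n1 * (k - i)" using that by (simp add: add_mult_distrib2[symmetric])
        then show ?thesis using LT_norm_mono[OF vL, of "n1 * i" "n1 * (k - i)"] neg by simp
      qed
      have dec: "L1_norm ((LT ^^ (n1 * i)) v) \<le> (1 - c) ^ i * L1_norm v" if "i \<le> k" for i
        using that
      proof (induction i)
        case (Suc i)
        let ?w = "(LT ^^ (n1 * i)) v"
        have "W1_norm 1 ?w \<le> cW1 * W1_norm 1 v" by (rule LT_W1_norm[OF v])
        also have "\<dots> = cW1 / \<delta> * (\<delta> * W1_norm 1 v)" using assms by simp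
        also have "\<dots> \<le> cW1 / \<delta> * L1_norm ?w"
          using big[of i] Suc.prems cW1_ge assms by (intro mult_left_mono) auto
        finally have "L1_norm ((LT ^^ n1) ?w) \<le> (1 - c) * L1_norm ?w"
          by (intro con LT_W1[OF v] LT_zero_mean[OF vL z])
        also have "\<dots> \<le> (1 - c) * ((1 - c) ^ i * L1_norm v)"
          using Suc c by (intro mult_left_mono) auto
        finally show ?case by (simp add: funpow_add[symmetric, THEN fun_cong, unfolded o_apply] mult.assoc)
      qed simp
      have "L1_norm ((LT ^^ (n1 * k)) v) \<le> (1 - c) ^ k * L1_norm v" using dec by simp
      also have "\<dots> \<le> \<delta> * W1_norm 1 v"
        using k c L1_norm_le_W1_norm[of v 1] assms by (intro mult_mono) auto
      finally show False using neg by simp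
    qed
  qed
qed

end

section \<open>Cocycles of discretised transfer operators\<close>

lemma perturbed_recursion:
  fixes a :: "nat \<Rightarrow> real"
  assumes "\<And>n. a (Suc n) \<le> b * a n + e" "a 0 \<le> 0" "1 \<le> b" "0 \<le> e"
  shows "a n \<le> real n * b ^ n * e"
proof (induction n)
  case (Suc n)
  have "a (Suc n) \<le> b * (real n * b ^ n * e) + e"
    using assms(1)[of n] mult_left_mono[OF Suc, of b] assms(3) by linarith
  also have "\<dots> \<le> b * (real n * b ^ n * e) + b ^ Suc n * e"
    using mult_right_mono[OF one_le_power[OF assms(3), of "Suc n"] assms(4)] by simp
  also have "\<dots> = real (Suc n) * b ^ Suc n * e" by (simp add: algebra_simps)
  finally show ?case .
qed (use assms in simp)

lemma inverse_sqrt_small: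
  assumes "x \<ge> 0" "e > (0::real)"
  obtains N0 :: nat where "N0 \<ge> 1" "\<And>N. N \<ge> N0 \<Longrightarrow> x * (1 / sqrt (real N)) \<le> e"
proof -
  obtain m :: nat where m: "(x / e)\<^sup>2 < m" using reals_Archimedean2 by blast
  show ?thesis
  proof (rule that[of "max 1 m"])
    fix N assume N: "N \<ge> max 1 m"
    then have "(x / e)\<^sup>2 \<le> N" using m by linarith
    then have "x / e \<le> sqrt N" using assms by (intro real_le_rsqrt)
    then have "x \<le> e * sqrt N" using assms by (simp add: field_simps)
    moreover have "sqrt N > 0" using N by simp
    ultimately show "x * (1 / sqrt N) \<le> e" by (simp add: field_simps)
  qed simp
qed

lemma power_small:
  assumes "0 < r" "r < 1" "e > (0::real)" "x \<ge> 0"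
  obtains k :: nat where "k \<ge> 1" "\<And>n. n \<ge> k \<Longrightarrow> r ^ n * x \<le> e"
proof -
  obtain k where k: "r ^ k < e / (x + 1)" using real_arch_pow_inv[of "e / (x + 1)" r] assms by auto
  show ?thesis
  proof (rule that[of "Suc k"])
    fix n assume "n \<ge> Suc k"
    then have "r ^ n \<le> r ^ k" using assms by (intro power_decreasing) auto
    then have "r ^ n \<le> e / (x + 1)" using k by linarith
    then have "r ^ n * x \<le> e / (x + 1) * (x + 1)" using assms by (intro mult_mono) auto
    then show "r ^ n * x \<le> e" using assms by simp
  qed simp
qed

context coupled_family
begin

text \<open>One step of the discretised dynamics, linear in \<open>f\<close>, with the map frozen at the density \<open>h\<close>.\<close>

definition step :: "real \<Rightarrow> nat \<Rightarrow> (real \<Rightarrow> real) \<Rightarrow> (real \<Rightarrow> real) \<Rightarrow> real \<Rightarrow> real" where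
  "step \<epsilon> N h f = fejer_proj N (LL \<epsilon> h f)"

primrec cocycle :: "real \<Rightarrow> nat \<Rightarrow> (nat \<Rightarrow> real \<Rightarrow> real) \<Rightarrow> nat \<Rightarrow> (real \<Rightarrow> real) \<Rightarrow> real \<Rightarrow> real" where
  "cocycle \<epsilon> N hs 0 f = f"
| "cocycle \<epsilon> N hs (Suc n) f = step \<epsilon> N (hs n) (cocycle \<epsilon> N hs n f)"

text \<open>The Fejer operator vanishes for \<open>N = 0\<close>, so it preserves integrals only from \<open>N = 1\<close> on.\<close>

definition adm :: "real \<Rightarrow> nat \<Rightarrow> bool" where
  "adm \<epsilon> N \<longleftrightarrow> \<epsilon> \<in> {0..\<epsilon>\<^sub>0} \<and> N \<ge> 1"

lemma admD: "adm \<epsilon> N \<Longrightarrow> \<epsilon> \<in> {0..\<epsilon>\<^sub>0}" "adm \<epsilon> N \<Longrightarrow> N \<ge> 1" "adm \<epsilon> N \<Longrightarrow> 0 \<le> \<epsilon>" "adm \<epsilon> N \<Longrightarrow> \<epsilon> \<le> \<epsilon>\<^sub>0"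
  by (auto simp: adm_def)

lemma LL_L1: "adm \<epsilon> N \<Longrightarrow> h \<in> Dens \<Longrightarrow> f \<in> L1 \<Longrightarrow> LL \<epsilon> h f \<in> L1"
  using transfer_op_L1[OF cmap_lift] admD by blast

lemma LL_is_transfer: "adm \<epsilon> N \<Longrightarrow> h \<in> Dens \<Longrightarrow> f \<in> L1 \<Longrightarrow> is_transfer (cmap \<epsilon> h) f (LL \<epsilon> h f)"
  using transfer_op_is_transfer[OF cmap_lift] admD by blast

lemma LL_norm: "adm \<epsilon> N \<Longrightarrow> h \<in> Dens \<Longrightarrow> f \<in> L1 \<Longrightarrow> L1_norm (LL \<epsilon> h f) \<le> L1_norm f"
  using is_transfer_L1_norm[OF cmap_lift _ LL_is_transfer] admD by blast

lemma LL_diff_AE: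
  assumes "adm \<epsilon> N" "h \<in> Dens" "f \<in> L1" "k \<in> L1"
  shows "AE x in circ. LL \<epsilon> h (\<lambda>x. f x - k x) x = LL \<epsilon> h f x - LL \<epsilon> h k x"
  using transfer_op_linear_AE[OF cmap_lift[OF admD(1)[OF assms(1)] assms(2)] assms(3,4), of 1 "-1"] by simp

lemma step_L1: "adm \<epsilon> N \<Longrightarrow> h \<in> Dens \<Longrightarrow> f \<in> L1 \<Longrightarrow> step \<epsilon> N h f \<in> L1"
  unfolding step_def by (intro fejer_L1 LL_L1)

lemma step_norm: "adm \<epsilon> N \<Longrightarrow> h \<in> Dens \<Longrightarrow> f \<in> L1 \<Longrightarrow> L1_norm (step \<epsilon> N h f) \<le> L1_norm f"
  unfolding step_def using fejer_L1_norm_le[OF admD(2) LL_L1] LL_norm order_trans by blast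

lemma step_integral: "adm \<epsilon> N \<Longrightarrow> h \<in> Dens \<Longrightarrow> f \<in> L1 \<Longrightarrow> (\<integral>x. step \<epsilon> N h f x \<partial>circ) = (\<integral>x. f x \<partial>circ)"
  unfolding step_def using fejer_integral[OF admD(2) LL_L1] is_transfer_integral[OF LL_is_transfer] by simp

lemma step_D1:
  assumes "adm \<epsilon> N" "h \<in> Dens" "f \<in> D1"
  shows "step \<epsilon> N h f \<in> D1" "0 \<le> step \<epsilon> N h f x"
proof -
  have fL: "f \<in> L1" using assms(3) by (simp add: D1_def)
  have "LL \<epsilon> h f \<in> D1"
    by (rule is_transfer_D1[OF cmap_lift[OF admD(1)[OF assms(1)] assms(2)] assms(3) LL_is_transfer[OF assms(1,2) fL]])
  then have "AE x in circ. 0 \<le> LL \<epsilon> h f x" by (simp add: D1_def)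
  then show pos: "0 \<le> step \<epsilon> N h f x" for x unfolding step_def by (rule fejer_nonneg[OF admD(2)[OF assms(1)]])
  show "step \<epsilon> N h f \<in> D1"
    using step_L1[OF assms(1,2) fL] step_integral[OF assms(1,2) fL] pos assms(3) by (simp add: D1_def)
qed

lemma step_diff:
  assumes "adm \<epsilon> N" "h \<in> Dens" "f \<in> L1" "k \<in> L1"
  shows "step \<epsilon> N h (\<lambda>x. f x - k x) = (\<lambda>x. step \<epsilon> N h f x - step \<epsilon> N h k x)"
proof
  fix x
  have "step \<epsilon> N h (\<lambda>x. f x - k x) = fejer_proj N (\<lambda>x. LL \<epsilon> h f x - LL \<epsilon> h k x)"
    unfolding step_def using assms by (intro fejer_cong_AE LL_diff_AE L1_diff LL_L1)
  then show "step \<epsilon> N h (\<lambda>x. f x - k x) x = step \<epsilon> N h f x - step \<epsilon> N h k x"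
    unfolding step_def using fejer_diff[OF LL_L1 LL_L1] assms by simp
qed

lemma step_W1:
  assumes "adm \<epsilon> N" "h \<in> Dens" "i \<in> {1..4}" "f \<in> W1 i"
  shows "step \<epsilon> N h f \<in> W1 i" "W1_norm i (step \<epsilon> N h f) \<le> lam ^ i * W1_norm i f + C_LY * W1_norm (i - 1) f"
  unfolding step_def
  using fejer_W1[OF admD(2)[OF assms(1)] LL_LY(1)[OF admD(1)[OF assms(1)] assms(2-4)]]
    LL_LY(2)[OF admD(1)[OF assms(1)] assms(2-4)] by auto

lemma step_W1_crude:
  assumes "adm \<epsilon> N" "h \<in> Dens" "i \<in> {1..4}" "f \<in> W1 i"
  shows "W1_norm i (step \<epsilon> N h f) \<le> (1 + C_LY) * W1_norm i f"
proof -
  have "W1_norm (i - 1) f \<le> W1_norm i f" using W1_norm_mono[of "i - 1" f] assms(3) by simp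
  then have "C_LY * W1_norm (i - 1) f \<le> C_LY * W1_norm i f" using LY(1) by (intro mult_left_mono) auto
  moreover have "lam ^ i * W1_norm i f \<le> 1 * W1_norm i f" using lam by (intro mult_right_mono) (auto intro: power_le_one)
  ultimately show ?thesis using step_W1(2)[OF assms] by (simp add: algebra_simps)
qed

lemma cocycle_L1:
  assumes "adm \<epsilon> N" "\<And>i. hs i \<in> Dens" "f \<in> L1"
  shows "cocycle \<epsilon> N hs n f \<in> L1" "L1_norm (cocycle \<epsilon> N hs n f) \<le> L1_norm f"
    "(\<integral>x. cocycle \<epsilon> N hs n f x \<partial>circ) = (\<integral>x. f x \<partial>circ)"
proof -
  have "cocycle \<epsilon> N hs n f \<in> L1 \<and> L1_norm (cocycle \<epsilon> N hs n f) \<le> L1_norm f \<and>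
      (\<integral>x. cocycle \<epsilon> N hs n f x \<partial>circ) = (\<integral>x. f x \<partial>circ)"
  proof (induction n)
    case (Suc n)
    then show ?case
      using step_L1[OF assms(1,2)] order_trans[OF step_norm[OF assms(1,2)]] step_integral[OF assms(1,2)] by simp
  qed (use assms in simp)
  then show "cocycle \<epsilon> N hs n f \<in> L1" "L1_norm (cocycle \<epsilon> N hs n f) \<le> L1_norm f"
    "(\<integral>x. cocycle \<epsilon> N hs n f x \<partial>circ) = (\<integral>x. f x \<partial>circ)" by auto
qed

lemma cocycle_W1:
  assumes "adm \<epsilon> N" "\<And>i. hs i \<in> Dens" "i \<in> {1..4}" "f \<in> W1 i"
  shows "cocycle \<epsilon> N hs n f \<in> W1 i"
  using assms(4) step_W1(1)[OF assms(1,2,3)] by (induction n) auto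

lemma cocycle_add: "cocycle \<epsilon> N hs (n + k) f = cocycle \<epsilon> N (\<lambda>i. hs (n + i)) k (cocycle \<epsilon> N hs n f)"
  by (induction k) auto

lemma cocycle_diff:
  assumes "adm \<epsilon> N" "\<And>i. hs i \<in> Dens" "f \<in> L1" "k \<in> L1"
  shows "cocycle \<epsilon> N hs n (\<lambda>x. f x - k x) = (\<lambda>x. cocycle \<epsilon> N hs n f x - cocycle \<epsilon> N hs n k x)"
  using step_diff[OF assms(1,2) cocycle_L1(1)[OF assms(1-3)] cocycle_L1(1)[OF assms(1,2,4)]]
  by (induction n) auto

lemma cocycle_W1_norm:
  assumes "adm \<epsilon> N" "\<And>i. hs i \<in> Dens" "f \<in> W1 1"
  shows "W1_norm 1 (cocycle \<epsilon> N hs n f) \<le> lam ^ n * W1_norm 1 f + cW1 * L1_norm f"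
    "W1_norm 1 (cocycle \<epsilon> N hs n f) \<le> cW1 * W1_norm 1 f"
proof -
  have fL: "f \<in> L1" using assms(3) by (rule W1_L1)
  let ?b = "C_LY * L1_norm f"
  have "W1_norm 1 (cocycle \<epsilon> N hs n f) \<le> lam ^ n * W1_norm 1 (cocycle \<epsilon> N hs 0 f) + ?b / (1 - lam)"
  proof (rule affine_recursion)
    fix n
    have "W1_norm 1 (cocycle \<epsilon> N hs (Suc n) f) \<le> lam ^ 1 * W1_norm 1 (cocycle \<epsilon> N hs n f) + C_LY * W1_norm (1 - 1) (cocycle \<epsilon> N hs n f)"
      using step_W1(2)[where i=1 and h="hs n", OF assms(1,2) _ cocycle_W1[where hs=hs and n=n, OF assms(1,2) _ assms(3)]] by simp
    moreover have "C_LY * L1_norm (cocycle \<epsilon> N hs n f) \<le> ?b"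
      using cocycle_L1(2)[OF assms(1,2) fL] LY(1) by (intro mult_left_mono) auto
    ultimately show "W1_norm 1 (cocycle \<epsilon> N hs (Suc n) f) \<le> lam * W1_norm 1 (cocycle \<epsilon> N hs n f) + ?b" by simp
  qed (use lam LY(1) in auto)
  then have main: "W1_norm 1 (cocycle \<epsilon> N hs n f) \<le> lam ^ n * W1_norm 1 f + C_LY / (1 - lam) * L1_norm f" by simp
  have C: "0 \<le> C_LY / (1 - lam)" using LY(1) lam by simp
  have "C_LY / (1 - lam) * L1_norm f \<le> cW1 * L1_norm f" by (intro mult_right_mono) (auto simp: cW1_def)
  then show "W1_norm 1 (cocycle \<epsilon> N hs n f) \<le> lam ^ n * W1_norm 1 f + cW1 * L1_norm f" using main by linarith
  have "lam ^ n * W1_norm 1 f \<le> 1 * W1_norm 1 f" using lam by (intro mult_right_mono) (auto intro: power_le_one)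
  moreover have "C_LY / (1 - lam) * L1_norm f \<le> C_LY / (1 - lam) * W1_norm 1 f"
    using C L1_norm_le_W1_norm by (intro mult_left_mono) auto
  moreover have "cW1 * W1_norm 1 f = 1 * W1_norm 1 f + C_LY / (1 - lam) * W1_norm 1 f" by (simp add: cW1_def algebra_simps)
  ultimately show "W1_norm 1 (cocycle \<epsilon> N hs n f) \<le> cW1 * W1_norm 1 f" using main by linarith
qed

definition cW2 where "cW2 = C_LY / (1 - lam\<^sup>2) * cW1"

lemma lam2: "0 < lam\<^sup>2" "lam\<^sup>2 < 1"
  using lam by (auto simp: power_less_one_iff)

lemma cW2_nonneg: "0 \<le> cW2"
  using LY(1) lam2 cW1_ge by (simp add: cW2_def)

lemma cocycle_W2_norm:
  assumes "adm \<epsilon> N" "\<And>i. hs i \<in> Dens" "f \<in> W1 2"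
  shows "W1_norm 2 (cocycle \<epsilon> N hs n f) \<le> (lam\<^sup>2) ^ n * W1_norm 2 f + cW2 * W1_norm 1 f"
proof -
  have f1: "f \<in> W1 1" using assms(3) W1_mono[of f 1] by (simp add: numeral_2_eq_2)
  let ?b = "C_LY * (cW1 * W1_norm 1 f)"
  have "W1_norm 2 (cocycle \<epsilon> N hs n f) \<le> (lam\<^sup>2) ^ n * W1_norm 2 (cocycle \<epsilon> N hs 0 f) + ?b / (1 - lam\<^sup>2)"
  proof (rule affine_recursion)
    fix n
    have "W1_norm 2 (cocycle \<epsilon> N hs (Suc n) f) \<le> lam ^ 2 * W1_norm 2 (cocycle \<epsilon> N hs n f) + C_LY * W1_norm (2 - 1) (cocycle \<epsilon> N hs n f)"
      using step_W1(2)[where i=2 and h="hs n", OF assms(1,2) _ cocycle_W1[where hs=hs and n=n, OF assms(1,2) _ assms(3)]] by simp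
    moreover have "C_LY * W1_norm 1 (cocycle \<epsilon> N hs n f) \<le> ?b"
      using cocycle_W1_norm(2)[OF assms(1,2) f1] LY(1) by (intro mult_left_mono) auto
    ultimately show "W1_norm 2 (cocycle \<epsilon> N hs (Suc n) f) \<le> lam\<^sup>2 * W1_norm 2 (cocycle \<epsilon> N hs n f) + ?b" by simp
  qed (use lam2 LY(1) cW1_ge in auto)
  then show ?thesis by (simp add: cW2_def)
qed

text \<open>Along finitely many steps the cocycle is a small perturbation, from the Sobolev norm to the
  \<open>L\<^sup>1\<close> norm, of the powers of the uncoupled operator.\<close>

lemma cocycle_close:
  obtains A where "A \<ge> 0"
    "\<And>\<epsilon> N (hs :: nat \<Rightarrow> real \<Rightarrow> real) v n. adm \<epsilon> N \<Longrightarrow> (\<And>i. hs i \<in> Dens) \<Longrightarrow> v \<in> W1 1 \<Longrightarrow>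
      L1_norm (\<lambda>x. cocycle \<epsilon> N hs n v x - (LT ^^ n) v x) \<le> real n * (A * (1 / sqrt N) + A * \<epsilon>) * W1_norm 1 v"
proof -
  obtain A0 where A0: "A0 \<ge> 0"
    and lip: "\<And>\<epsilon> h k f. \<epsilon> \<in> {0..\<epsilon>\<^sub>0} \<Longrightarrow> h \<in> Dens \<Longrightarrow> k \<in> Dens \<Longrightarrow> f \<in> W1 1 \<Longrightarrow>
       L1_norm (\<lambda>x. LL \<epsilon> h f x - LL \<epsilon> k f x) \<le> A0 * \<epsilon> * L1_norm (\<lambda>x. h x - k x) * W1_norm 1 f"
    by (rule LL_Lipschitz) blast
  define A where "A = (1 + C_LY + A0) * cW1"
  have A: "A \<ge> 0" using A0 LY(1) cW1_ge by (simp add: A_def)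
  show ?thesis
  proof (rule that[OF A])
    fix \<epsilon> N and hs :: "nat \<Rightarrow> real \<Rightarrow> real" and v n assume ad: "adm \<epsilon> N" and hs: "\<And>i. hs i \<in> Dens" and v: "v \<in> W1 1"
    note \<epsilon> = admD(1)[OF ad] admD(3)[OF ad] and N = admD(2)[OF ad]
    have vL: "v \<in> L1" using v by (rule W1_L1)
    let ?r = "(A * (1 / sqrt N) + A * \<epsilon>) * W1_norm 1 v"
    show "L1_norm (\<lambda>x. cocycle \<epsilon> N hs n v x - (LT ^^ n) v x) \<le> real n * (A * (1 / sqrt N) + A * \<epsilon>) * W1_norm 1 v"
    proof (induction n)
      case 0
      then show ?case by simp
    next
      case (Suc n)
      let ?f = "cocycle \<epsilon> N hs n v" and ?l = "(LT ^^ n) v" and ?h = "hs n"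
      have f: "?f \<in> W1 1" "?f \<in> L1" using cocycle_W1[OF ad hs _ v] cocycle_L1[OF ad hs vL] by auto
      have l: "?l \<in> L1" using vL by (rule LT_L1)
      have Wf: "W1_norm 1 ?f \<le> cW1 * W1_norm 1 v" by (rule cocycle_W1_norm(2)[OF ad hs v])
      have Lf: "LL \<epsilon> ?h ?f \<in> W1 1" "LL \<epsilon> ?h ?f \<in> L1" "W1_norm 1 (LL \<epsilon> ?h ?f) \<le> (1 + C_LY) * W1_norm 1 ?f"
      proof -
        show 1: "LL \<epsilon> ?h ?f \<in> W1 1" using LL_LY(1)[OF \<epsilon>(1) hs _ f(1)] by simp
        show "LL \<epsilon> ?h ?f \<in> L1" using 1 by (rule W1_L1)
        have "W1_norm 1 (LL \<epsilon> ?h ?f) \<le> lam * W1_norm 1 ?f + C_LY * L1_norm ?f"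
          using LL_LY(2)[OF \<epsilon>(1) hs _ f(1), of n] by simp
        also have "\<dots> \<le> 1 * W1_norm 1 ?f + C_LY * W1_norm 1 ?f"
          using lam LY(1) L1_norm_le_W1_norm by (intro add_mono mult_mono) auto
        finally show "W1_norm 1 (LL \<epsilon> ?h ?f) \<le> (1 + C_LY) * W1_norm 1 ?f" by (simp add: algebra_simps)
      qed
      have LTf: "LT ?f \<in> L1" "LT ?l \<in> L1" using f l transfer_op_L1[OF T_C1_lift] by auto
      have 1: "L1_norm (\<lambda>x. step \<epsilon> N ?h ?f x - LL \<epsilon> ?h ?f x) \<le> 1 / sqrt N * ((1 + C_LY) * W1_norm 1 ?f)"
      proof -
        have "LL \<epsilon> ?h ?f \<in> W1 (Suc 0)" using Lf(1) by simp
        from fejer_rate(2)[OF N this]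
        have "L1_norm (\<lambda>x. step \<epsilon> N ?h ?f x - LL \<epsilon> ?h ?f x) \<le> 1 / sqrt N * W1_norm 1 (LL \<epsilon> ?h ?f)" by (simp add: step_def)
        also have "\<dots> \<le> 1 / sqrt N * ((1 + C_LY) * W1_norm 1 ?f)" by (rule mult_left_mono[OF Lf(3)]) simp
        finally show ?thesis .
      qed
      have 2: "L1_norm (\<lambda>x. LL \<epsilon> ?h ?f x - LT ?f x) \<le> A0 * \<epsilon> * W1_norm 1 ?f"
      proof -
        have "L1_norm (\<lambda>x. LL \<epsilon> ?h ?f x - LL \<epsilon> (\<lambda>_. 0) ?f x) \<le> A0 * \<epsilon> * L1_norm (\<lambda>x. ?h x - 0) * W1_norm 1 ?f"
          by (rule lip[OF \<epsilon>(1) hs zero_Dens f(1)])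
        also have "\<dots> \<le> A0 * \<epsilon> * 1 * W1_norm 1 ?f"
          using Dens_L1(2)[OF hs, of n] A0 \<epsilon> by (intro mult_right_mono mult_left_mono) auto
        finally show ?thesis by (simp add: LL_zero)
      qed
      have 3: "L1_norm (\<lambda>x. LT ?f x - LT ?l x) \<le> L1_norm (\<lambda>x. ?f x - ?l x)"
      proof -
        have "AE x in circ. LT (\<lambda>x. ?f x - ?l x) x = LT ?f x - LT ?l x"
          using transfer_op_linear_AE[OF T_C1_lift f(2) l, of 1 "-1"] by simp
        then have "L1_norm (LT (\<lambda>x. ?f x - ?l x)) = L1_norm (\<lambda>x. LT ?f x - LT ?l x)"
          using f l LTf by (intro L1_norm_cong_AE transfer_op_L1[OF T_C1_lift] L1_diff)
        moreover have "L1_norm (LT (\<lambda>x. ?f x - ?l x)) \<le> L1_norm (\<lambda>x. ?f x - ?l x)"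
          using f l by (intro is_transfer_L1_norm[OF T_C1_lift] transfer_op_is_transfer[OF T_C1_lift] L1_diff)
        ultimately show ?thesis by simp
      qed
      have sL: "step \<epsilon> N ?h ?f \<in> L1" by (rule step_L1[OF ad hs f(2)])
      have 4: "L1_norm (\<lambda>x. step \<epsilon> N ?h ?f x - LT ?l x) \<le> L1_norm (\<lambda>x. step \<epsilon> N ?h ?f x - LL \<epsilon> ?h ?f x)
          + (L1_norm (\<lambda>x. LL \<epsilon> ?h ?f x - LT ?f x) + L1_norm (\<lambda>x. LT ?f x - LT ?l x))"
      proof -
        have a: "L1_norm (\<lambda>x. LL \<epsilon> ?h ?f x - LT ?l x) \<le> L1_norm (\<lambda>x. LL \<epsilon> ?h ?f x - LT ?f x) + L1_norm (\<lambda>x. LT ?f x - LT ?l x)"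
          using L1_norm_triangle[OF L1_diff[OF Lf(2) LTf(1)] L1_diff[OF LTf]] by simp
        have b: "L1_norm (\<lambda>x. step \<epsilon> N ?h ?f x - LT ?l x) \<le> L1_norm (\<lambda>x. step \<epsilon> N ?h ?f x - LL \<epsilon> ?h ?f x) + L1_norm (\<lambda>x. LL \<epsilon> ?h ?f x - LT ?l x)"
          using L1_norm_triangle[OF L1_diff[OF sL Lf(2)] L1_diff[OF Lf(2) LTf(2)]] by simp
        show ?thesis using a b by linarith
      qed
      have 5: "1 / sqrt N * ((1 + C_LY) * W1_norm 1 ?f) + A0 * \<epsilon> * W1_norm 1 ?f \<le> ?r"
      proof -
        have "1 / sqrt N * ((1 + C_LY) * W1_norm 1 ?f) + A0 * \<epsilon> * W1_norm 1 ?f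
            = ((1 + C_LY) * (1 / sqrt N) + A0 * \<epsilon>) * W1_norm 1 ?f" by (simp add: algebra_simps add_divide_distrib)
        also have "\<dots> \<le> ((1 + C_LY + A0) * (1 / sqrt N) + (1 + C_LY + A0) * \<epsilon>) * (cW1 * W1_norm 1 v)"
        proof (rule mult_mono[OF add_mono Wf])
          show "(1 + C_LY) * (1 / sqrt N) \<le> (1 + C_LY + A0) * (1 / sqrt N)" using A0 by (intro mult_right_mono) auto
          show "A0 * \<epsilon> \<le> (1 + C_LY + A0) * \<epsilon>" using LY(1) \<epsilon> by (intro mult_right_mono) auto
        qed (use A0 LY(1) \<epsilon> in auto)
        also have "\<dots> = ?r" by (simp add: A_def algebra_simps add_divide_distrib)
        finally show ?thesis .
      qed
      have "L1_norm (\<lambda>x. cocycle \<epsilon> N hs (Suc n) v x - (LT ^^ Suc n) v x) \<le> ?r + real n * (A * (1 / sqrt N) + A * \<epsilon>) * W1_norm 1 v"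
        using 1 2 3 4 5 Suc by simp
      then show ?case by (simp add: algebra_simps add_divide_distrib)
    qed
  qed
qed

text \<open>After \<open>m\<close> steps the \<open>L\<^sup>1\<close> norm is small, by mixing of \<open>T\<close> and closeness to its powers; after \<open>k\<close> more
  steps the Lasota-Yorke inequality has made the Sobolev norm small as well.\<close>

lemma cocycle_mixing:
  assumes \<delta>: "\<delta> > 0"
  obtains n \<epsilon>1 N1 where "n \<ge> 1" "0 < \<epsilon>1" "\<epsilon>1 \<le> \<epsilon>\<^sub>0" "N1 \<ge> 1"
    "\<And>\<epsilon> N (hs :: nat \<Rightarrow> real \<Rightarrow> real) v. \<epsilon> \<in> {0..\<epsilon>1} \<Longrightarrow> N \<ge> N1 \<Longrightarrow> (\<And>i. hs i \<in> Dens) \<Longrightarrow> v \<in> W1 1 \<Longrightarrow> (\<integral>x. v x \<partial>circ) = 0 \<Longrightarrow>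
       W1_norm 1 (cocycle \<epsilon> N hs n v) \<le> \<delta> * W1_norm 1 v"
proof -
  obtain A where A: "A \<ge> 0"
    and close: "\<And>\<epsilon> N (hs :: nat \<Rightarrow> real \<Rightarrow> real) v n. adm \<epsilon> N \<Longrightarrow> (\<And>i. hs i \<in> Dens) \<Longrightarrow> v \<in> W1 1 \<Longrightarrow>
      L1_norm (\<lambda>x. cocycle \<epsilon> N hs n v x - (LT ^^ n) v x) \<le> real n * (A * (1 / sqrt N) + A * \<epsilon>) * W1_norm 1 v"
    using cocycle_close by blast
  define \<eta> where "\<eta> = \<delta> / (4 * cW1)"
  have \<eta>: "\<eta> > 0" using \<delta> cW1_ge by (simp add: \<eta>_def)
  obtain m where m: "\<And>v. v \<in> W1 1 \<Longrightarrow> (\<integral>x. v x \<partial>circ) = 0 \<Longrightarrow> L1_norm ((LT ^^ m) v) \<le> \<eta> * W1_norm 1 v"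
    using LT_mixing[OF \<eta>] by blast
  obtain k where k: "k \<ge> 1" "\<And>n. n \<ge> k \<Longrightarrow> lam ^ n * cW1 \<le> \<delta> / 4"
    using power_small[OF lam, of "\<delta> / 4" cW1] \<delta> cW1_ge by auto
  have mA: "0 \<le> real m * A" using A by simp
  obtain N1 where N1: "N1 \<ge> 1" "\<And>N. N \<ge> N1 \<Longrightarrow> real m * A * (1 / sqrt (real N)) \<le> \<eta>"
    using inverse_sqrt_small[OF mA \<eta>] by metis
  define \<epsilon>1 where "\<epsilon>1 = min \<epsilon>\<^sub>0 (\<eta> / (real m * A + 1))"
  have \<epsilon>1: "0 < \<epsilon>1" "\<epsilon>1 \<le> \<epsilon>\<^sub>0" using eps0 \<eta> mA by (auto simp: \<epsilon>1_def intro!: divide_pos_pos)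
  show ?thesis
  proof (rule that[of "m + k" \<epsilon>1 N1])
    show "m + k \<ge> 1" using k by simp
    fix \<epsilon> N and hs :: "nat \<Rightarrow> real \<Rightarrow> real" and v
    assume \<epsilon>: "\<epsilon> \<in> {0..\<epsilon>1}" and N: "N \<ge> N1" and hs: "\<And>i. hs i \<in> Dens" and v: "v \<in> W1 1" and z: "(\<integral>x. v x \<partial>circ) = 0"
    have ad: "adm \<epsilon> N" using \<epsilon> \<epsilon>1 N N1 by (auto simp: adm_def)
    have vL: "v \<in> L1" using v by (rule W1_L1)
    let ?f = "cocycle \<epsilon> N hs m v" and ?W = "W1_norm 1 v"
    have f: "?f \<in> W1 1" "?f \<in> L1" using cocycle_W1[OF ad hs _ v] cocycle_L1[OF ad hs vL] by auto
    have "real m * A * \<epsilon> \<le> \<eta>"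
    proof -
      have "\<epsilon> \<le> \<eta> / (real m * A + 1)" using \<epsilon> by (simp add: \<epsilon>1_def)
      then have "(real m * A + 1) * \<epsilon> \<le> \<eta>" using mA by (simp add: field_simps)
      then show ?thesis using \<epsilon> by (simp add: algebra_simps)
    qed
    with N1(2)[OF N] have "real m * (A * (1 / sqrt N) + A * \<epsilon>) \<le> 2 * \<eta>" by (simp add: algebra_simps)
    then have "real m * (A * (1 / sqrt N) + A * \<epsilon>) * ?W \<le> 2 * \<eta> * ?W" by (rule mult_right_mono) simp
    then have "L1_norm (\<lambda>x. ?f x - (LT ^^ m) v x) \<le> 2 * \<eta> * ?W" using close[where hs=hs and n=m, OF ad hs v] by linarith
    moreover have "L1_norm ?f \<le> L1_norm (\<lambda>x. ?f x - (LT ^^ m) v x) + L1_norm ((LT ^^ m) v)"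
      using L1_norm_triangle[OF L1_diff[OF f(2) LT_L1[OF vL, of m]] LT_L1[OF vL, of m]] by simp
    ultimately have "L1_norm ?f \<le> 3 * \<eta> * ?W" using m[OF v z] by simp
    then have "cW1 * L1_norm ?f \<le> cW1 * (3 * \<eta> * ?W)" using cW1_ge by (intro mult_left_mono) auto
    also have "\<dots> = 3 * \<delta> / 4 * ?W" using cW1_ge by (simp add: \<eta>_def)
    finally have 1: "cW1 * L1_norm ?f \<le> 3 * \<delta> / 4 * ?W" .
    have "lam ^ k * W1_norm 1 ?f \<le> lam ^ k * (cW1 * ?W)"
      using cocycle_W1_norm(2)[OF ad hs v] lam by (intro mult_left_mono) auto
    also have "\<dots> \<le> \<delta> / 4 * ?W" using mult_right_mono[OF k(2)[OF order_refl], of ?W] by (simp add: mult.assoc)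
    finally have 2: "lam ^ k * W1_norm 1 ?f \<le> \<delta> / 4 * ?W" .
    have "W1_norm 1 (cocycle \<epsilon> N hs (m + k) v) \<le> lam ^ k * W1_norm 1 ?f + cW1 * L1_norm ?f"
      unfolding cocycle_add by (rule cocycle_W1_norm(1)[OF ad _ f(1)]) (rule hs)
    also have "\<dots> \<le> \<delta> / 4 * ?W + 3 * \<delta> / 4 * ?W" using 1 2 by linarith
    also have "\<dots> = \<delta> * ?W" by (simp add: field_simps)
    finally show "W1_norm 1 (cocycle \<epsilon> N hs (m + k) v) \<le> \<delta> * ?W" .
  qed (use \<epsilon>1 N1 in auto)
qed

end

section \<open>The nonlinear operator\<close>

context coupled_family
begin

lemma const_W1_1: "(\<lambda>_. 1) \<in> W1 i" "W1_norm i (\<lambda>_. 1) = 1"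
  using W1_const[of 1 i] by auto

text \<open>Testing the Lasota-Yorke inequality on the constant function.\<close>

lemma LL_funpow:
  assumes "adm \<epsilon> N" "h \<in> D1" "i \<in> {1..4}"
  shows "(LL \<epsilon> h ^^ n) (\<lambda>_. 1) \<in> W1 i" "W1_norm i ((LL \<epsilon> h ^^ n) (\<lambda>_. 1)) \<le> lam ^ (i * n) + C_LY"
proof -
  note h = D1_Dens[OF assms(2)]
  note C = cmap_lift[OF admD(1)[OF assms(1)] h]
  let ?S = "\<lambda>n. coupled_comp T g \<epsilon> (replicate n h)" and ?e = "\<lambda>n. (LL \<epsilon> h ^^ n) (\<lambda>_. 1)"
  have S: "?S (Suc n) = cmap \<epsilon> h \<circ> ?S n" for n
  proof -
    have "?S (Suc n) = coupled_comp T g \<epsilon> (replicate n h @ [h])" by (simp only: replicate_append_same replicate_Suc)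
    then show ?thesis unfolding coupled_comp_def fold_append by simp
  qed
  have L: "?e n \<in> L1" for n by (induction n) (auto intro: transfer_op_L1[OF C])
  have tr: "is_transfer (?S n) (\<lambda>_. 1) (?e n)"
  proof (induction n)
    case 0
    show ?case by (simp add: is_transfer_def coupled_comp_def)
  next
    case (Suc n)
    show ?case unfolding S using is_transfer_comp[OF C Suc transfer_op_is_transfer[OF C L]] by (simp add: o_def)
  qed
  let ?u = "transfer_op (?S n) (\<lambda>_. 1)"
  have "is_transfer (?S n) (\<lambda>_. 1) ?u"
    unfolding transfer_op_def by (rule someI[of "is_transfer (?S n) (\<lambda>_. 1)", OF tr])
  from is_transfer_unique[OF this tr] have eq: "AE x in circ. ?u x = ?e n x" .
  have "set (replicate n h) \<subseteq> D1" using assms(2) by auto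
  with LY(2) admD(1)[OF assms(1)] assms(3) const_W1_1(1)
  have ly: "?u \<in> W1 i" "W1_norm i ?u \<le> lam ^ (i * n) * 1 + C_LY * 1"
    unfolding Lasota_Yorke_def by (metis length_replicate const_W1_1(2))+
  show "?e n \<in> W1 i" "W1_norm i (?e n) \<le> lam ^ (i * n) + C_LY"
    using W1_cong_AE[OF ly(1) L eq] ly(2) by auto
qed

text \<open>The discretised self-consistent operator, with its map frozen at the argument itself.\<close>

definition F :: "real \<Rightarrow> nat \<Rightarrow> (real \<Rightarrow> real) \<Rightarrow> real \<Rightarrow> real" where
  "F \<epsilon> N h = step \<epsilon> N h h"

lemma F_discrete: "F \<epsilon> N = discrete_op T g \<epsilon> N"
  by (simp add: fun_eq_iff F_def step_def discrete_op_def self_consistent_op_def)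

text \<open>The coupled map is determined by an integral against the density, so the operator does not see changes
  on a null set, and equality after one application is pointwise.\<close>

lemma F_cong:
  assumes "adm \<epsilon> N" "h \<in> D1" "k \<in> D1" "AE x in circ. h x = k x"
  shows "F \<epsilon> N h = F \<epsilon> N k"
proof -
  have L: "h \<in> L1" "k \<in> L1" using assms by (auto simp: D1_def)
  have "mean_field g 0 h = mean_field g 0 k"
    unfolding mean_field_def
    by (rule ext, rule integral_mult_cong_AE[OF L assms(4)])
       (use section_props(2)[of 0] in \<open>auto intro!: measurable_circ borel_measurable_continuous_onI\<close>)
  then have c: "cmap \<epsilon> h = cmap \<epsilon> k" by (simp add: fun_eq_iff cmap_eq)
  show ?thesis
    unfolding F_def step_def c
    using transfer_op_cong[OF cmap_lift[OF admD(1)[OF assms(1)] D1_Dens[OF assms(3)]] L assms(4)] by simp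
qed

end

locale discretised_family = coupled_family +
  fixes K :: real
  assumes K: "K \<ge> C_LY / (1 - lam\<^sup>2)"
begin

lemma K_pos: "0 < K"
  using K LY(1) lam2 by (smt (verit) divide_pos_pos)

definition R1 where "R1 = K + 1 + C_LY / (1 - lam)"
definition R2 where "R2 = R1 + C_LY * R1 / (1 - lam\<^sup>2)"

lemma R_pos: "R1 \<ge> 1" "R2 \<ge> R1" "R1 \<ge> K" "C_LY \<le> (1 - lam) * R1" "C_LY * R1 \<le> (1 - lam\<^sup>2) * R2"
proof -
  have a: "0 \<le> C_LY / (1 - lam)" using LY(1) lam by simp
  show 1: "R1 \<ge> 1" "R1 \<ge> K" unfolding R1_def using a K_pos by auto
  have b: "0 \<le> C_LY * R1 / (1 - lam\<^sup>2)" using LY(1) lam2 1 by simp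
  then show "R2 \<ge> R1" by (simp add: R2_def)
  have "C_LY / (1 - lam) \<le> R1" using K_pos by (simp add: R1_def)
  then show "C_LY \<le> (1 - lam) * R1" using lam by (simp add: pos_divide_le_eq mult.commute)
  have "C_LY * R1 / (1 - lam\<^sup>2) \<le> R2" using 1 by (simp add: R2_def)
  then show "C_LY * R1 \<le> (1 - lam\<^sup>2) * R2" using lam2 by (simp add: pos_divide_le_eq mult.commute)
qed

text \<open>The ball \<open>B K\<close> is mapped into this larger set, which is invariant because its two radii are adapted to
  the two Lasota-Yorke inequalities; \<open>B K\<close> itself need not be invariant.\<close>

definition inv_ball :: "(real \<Rightarrow> real) set" where
  "inv_ball = {h \<in> D1 \<inter> W1 2. W1_norm 1 h \<le> R1 \<and> W1_norm 2 h \<le> R2}"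

lemma inv_ballD: "h \<in> inv_ball \<Longrightarrow> h \<in> D1" "h \<in> inv_ball \<Longrightarrow> h \<in> Dens" "h \<in> inv_ball \<Longrightarrow> h \<in> L1" "h \<in> inv_ball \<Longrightarrow> h \<in> W1 1"
  "h \<in> inv_ball \<Longrightarrow> h \<in> W1 2" "h \<in> inv_ball \<Longrightarrow> W1_norm 1 h \<le> R1" "h \<in> inv_ball \<Longrightarrow> W1_norm 2 h \<le> R2"
  using W1_mono[of h 1] by (auto simp: inv_ball_def D1_Dens D1_def numeral_2_eq_2)

lemma B_subset_inv_ball: "B K \<subseteq> inv_ball"
proof
  fix h assume "h \<in> B K"
  then have "h \<in> D1" "h \<in> W1 2" "W1_norm 2 h \<le> K" by (auto simp: B_def)
  moreover have "W1_norm 1 h \<le> W1_norm 2 h" using W1_norm_mono[of 1 h] by (simp add: numeral_2_eq_2)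
  ultimately show "h \<in> inv_ball" using R_pos by (auto simp: inv_ball_def)
qed

lemma one_in_inv_ball: "(\<lambda>_. 1) \<in> inv_ball"
  using R_pos const_W1_1 const_D1 by (auto simp: inv_ball_def)

lemma F_inv_ball:
  assumes ad: "adm \<epsilon> N" and h: "h \<in> inv_ball"
  shows "F \<epsilon> N h \<in> inv_ball"
proof -
  note H = inv_ballD[OF h]
  have 1: "F \<epsilon> N h \<in> D1" unfolding F_def by (rule step_D1(1)[OF ad H(2,1)])
  have 2: "F \<epsilon> N h \<in> W1 2" unfolding F_def using step_W1(1)[OF ad H(2) _ H(5)] by simp
  have "W1_norm 1 (F \<epsilon> N h) \<le> lam * W1_norm 1 h + C_LY * 1"
    unfolding F_def using step_W1(2)[OF ad H(2) _ H(4)] D1_norm[OF H(1)] by simp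
  also have "\<dots> \<le> lam * R1 + (1 - lam) * R1" using H(6) R_pos(4) lam by (intro add_mono mult_left_mono) auto
  finally have 3: "W1_norm 1 (F \<epsilon> N h) \<le> R1" by (simp add: algebra_simps)
  have "W1_norm 2 (F \<epsilon> N h) \<le> lam\<^sup>2 * W1_norm 2 h + C_LY * W1_norm 1 h"
    unfolding F_def using step_W1(2)[OF ad H(2) _ H(5)] by simp
  also have "\<dots> \<le> lam\<^sup>2 * R2 + C_LY * R1" using H(6,7) LY(1) by (intro add_mono mult_left_mono) auto
  also have "\<dots> \<le> lam\<^sup>2 * R2 + (1 - lam\<^sup>2) * R2" using R_pos(5) by simp
  finally have "W1_norm 2 (F \<epsilon> N h) \<le> R2" by (simp add: algebra_simps)
  then show ?thesis using 1 2 3 by (simp add: inv_ball_def)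
qed

lemma F_iter_inv_ball: "adm \<epsilon> N \<Longrightarrow> h \<in> inv_ball \<Longrightarrow> (F \<epsilon> N ^^ n) h \<in> inv_ball"
  by (induction n) (auto intro: F_inv_ball)

text \<open>The distance of two orbits follows the linear cocycle along the first of them, up to an error that
  is linear in the distance with a factor \<open>\<epsilon>\<close>.\<close>

lemma F_contracts:
  obtains \<epsilon>1 N1 n c where "0 < \<epsilon>1" "\<epsilon>1 \<le> \<epsilon>\<^sub>0" "N1 \<ge> 1" "n \<ge> 1" "c \<ge> 1"
    "\<And>\<epsilon> N h k. \<epsilon> \<in> {0..\<epsilon>1} \<Longrightarrow> N \<ge> N1 \<Longrightarrow> h \<in> inv_ball \<Longrightarrow> k \<in> inv_ball \<Longrightarrow>
      W1_norm 1 (\<lambda>x. (F \<epsilon> N ^^ n) h x - (F \<epsilon> N ^^ n) k x) \<le> 1/2 * W1_norm 1 (\<lambda>x. h x - k x)"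
    "\<And>\<epsilon> N h k j. \<epsilon> \<in> {0..\<epsilon>1} \<Longrightarrow> N \<ge> N1 \<Longrightarrow> h \<in> inv_ball \<Longrightarrow> k \<in> inv_ball \<Longrightarrow> j \<le> n \<Longrightarrow>
      W1_norm 1 (\<lambda>x. (F \<epsilon> N ^^ j) h x - (F \<epsilon> N ^^ j) k x) \<le> c * W1_norm 1 (\<lambda>x. h x - k x)"
proof -
  obtain A where A: "A \<ge> 0"
    and lip: "\<And>\<epsilon> h k f. \<epsilon> \<in> {0..\<epsilon>\<^sub>0} \<Longrightarrow> h \<in> Dens \<Longrightarrow> k \<in> Dens \<Longrightarrow> f \<in> W1 2 \<Longrightarrow>
       (\<lambda>x. LL \<epsilon> h f x - LL \<epsilon> k f x) \<in> W1 1 \<and>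
       W1_norm 1 (\<lambda>x. LL \<epsilon> h f x - LL \<epsilon> k f x) \<le> A * \<epsilon> * L1_norm (\<lambda>x. h x - k x) * W1_norm 2 f"
    by (rule LL_Lipschitz) blast
  obtain n \<epsilon>1 N1 where n: "n \<ge> 1" and \<epsilon>1: "0 < \<epsilon>1" "\<epsilon>1 \<le> \<epsilon>\<^sub>0" and N1: "N1 \<ge> 1"
    and mix: "\<And>\<epsilon> N (hs :: nat \<Rightarrow> real \<Rightarrow> real) v. \<epsilon> \<in> {0..\<epsilon>1} \<Longrightarrow> N \<ge> N1 \<Longrightarrow> (\<And>i. hs i \<in> Dens) \<Longrightarrow> v \<in> W1 1 \<Longrightarrow>
       (\<integral>x. v x \<partial>circ) = 0 \<Longrightarrow> W1_norm 1 (cocycle \<epsilon> N hs n v) \<le> 1/4 * W1_norm 1 v"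
    by (rule cocycle_mixing[of "1/4"]) auto
  define q where "q = A * R2"
  define b where "b = 1 + C_LY + \<epsilon>\<^sub>0 * q"
  define s where "s = real n * b ^ n * (q * cW1)"
  have q0: "q \<ge> 0" using A R_pos by (simp add: q_def)
  have b1: "b \<ge> 1" using q0 LY(1) eps0 by (simp add: b_def)
  have s0: "s \<ge> 0" using b1 q0 cW1_ge by (simp add: s_def)
  define \<epsilon>2 where "\<epsilon>2 = min \<epsilon>1 (1 / (4 * (s + 1)))"
  have \<epsilon>2: "0 < \<epsilon>2" "\<epsilon>2 \<le> \<epsilon>1" using \<epsilon>1 s0 by (auto simp: \<epsilon>2_def)
  have main: "W1_norm 1 (\<lambda>x. (F \<epsilon> N ^^ j) h x - (F \<epsilon> N ^^ j) k x) \<le> W1_norm 1 (cocycle \<epsilon> N (\<lambda>i. (F \<epsilon> N ^^ i) h) j (\<lambda>x. h x - k x)) + 1/4 * W1_norm 1 (\<lambda>x. h x - k x)"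
    if \<epsilon>: "\<epsilon> \<in> {0..\<epsilon>2}" and N: "N \<ge> N1" and h: "h \<in> inv_ball" and k: "k \<in> inv_ball" and j: "j \<le> n" for \<epsilon> N h k j
  proof -
    have ad: "adm \<epsilon> N" using \<epsilon> \<epsilon>2 \<epsilon>1 N N1 by (auto simp: adm_def)
    note e = admD(1,3,4)[OF ad]
    define hs where "hs i = (F \<epsilon> N ^^ i) h" for i
    define ks where "ks i = (F \<epsilon> N ^^ i) k" for i
    have hb: "hs i \<in> inv_ball" and kb: "ks i \<in> inv_ball" for i using F_iter_inv_ball[OF ad] h k by (auto simp: hs_def ks_def)
    have hD: "hs i \<in> Dens" for i using hb by (rule inv_ballD)
    define v where "v = (\<lambda>x. h x - k x)"
    have v: "v \<in> W1 1" unfolding v_def using h k by (intro W1_diff inv_ballD)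
    define d where "d i = (\<lambda>x. hs i x - ks i x)" for i
    define E where "E i = (\<lambda>x. d i x - cocycle \<epsilon> N hs i v x)" for i
    have dW: "d i \<in> W1 1" for i unfolding d_def using hb kb by (intro W1_diff inv_ballD)
    have cW: "cocycle \<epsilon> N hs i v \<in> W1 1" for i using cocycle_W1[OF ad hD _ v] by simp
    have EW: "E i \<in> W1 1" for i unfolding E_def using dW cW by (rule W1_diff)
    have dE: "W1_norm 1 (d i) \<le> W1_norm 1 (cocycle \<epsilon> N hs i v) + W1_norm 1 (E i)" for i
      using W1_norm_triangle[OF cW EW, of i i] by (simp add: E_def)
    have rec: "W1_norm 1 (E (Suc i)) \<le> b * W1_norm 1 (E i) + \<epsilon> * (q * cW1 * W1_norm 1 v)" for i
    proof -
      let ?e = "fejer_proj N (\<lambda>x. LL \<epsilon> (hs i) (ks i) x - LL \<epsilon> (ks i) (ks i) x)"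
      note kB = inv_ballD[OF kb[of i]]
      have l: "(\<lambda>x. LL \<epsilon> (hs i) (ks i) x - LL \<epsilon> (ks i) (ks i) x) \<in> W1 1"
        "W1_norm 1 (\<lambda>x. LL \<epsilon> (hs i) (ks i) x - LL \<epsilon> (ks i) (ks i) x) \<le> A * \<epsilon> * L1_norm (d i) * W1_norm 2 (ks i)"
        using lip[OF e(1) hD kB(2) kB(5), of i] by (auto simp: d_def)
      have eW: "?e \<in> W1 1" "W1_norm 1 ?e \<le> A * \<epsilon> * L1_norm (d i) * W1_norm 2 (ks i)"
        using fejer_W1[OF admD(2)[OF ad] l(1)] l(2) by auto
      have e_eq: "?e x = step \<epsilon> N (hs i) (ks i) x - ks (Suc i) x" for x
        using fejer_diff[OF LL_L1[OF ad hD kB(3)] LL_L1[OF ad kB(2,3)]] by (simp add: ks_def F_def step_def)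
      have E_eq: "E (Suc i) = (\<lambda>x. step \<epsilon> N (hs i) (E i) x + ?e x)"
      proof
        fix x
        have dL: "d i \<in> L1" "cocycle \<epsilon> N hs i v \<in> L1" using dW cW by (auto intro: W1_L1)
        have "step \<epsilon> N (hs i) (E i) x = step \<epsilon> N (hs i) (d i) x - cocycle \<epsilon> N hs (Suc i) v x"
          unfolding E_def using step_diff[OF ad hD dL] by simp
        moreover have "step \<epsilon> N (hs i) (d i) x = hs (Suc i) x - step \<epsilon> N (hs i) (ks i) x"
          unfolding d_def using step_diff[OF ad hD inv_ballD(3)[OF hb[of i]] kB(3)] by (simp add: hs_def F_def)
        ultimately show "E (Suc i) x = step \<epsilon> N (hs i) (E i) x + ?e x"
          unfolding e_eq by (simp add: E_def d_def)
      qed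
      have "W1_norm 1 (E (Suc i)) \<le> W1_norm 1 (step \<epsilon> N (hs i) (E i)) + W1_norm 1 ?e"
        unfolding E_eq using step_W1(1)[OF ad hD _ EW] eW(1) by (intro W1_norm_triangle) auto
      also have "\<dots> \<le> (1 + C_LY) * W1_norm 1 (E i) + \<epsilon> * (q * W1_norm 1 (d i))"
      proof (rule add_mono)
        show "W1_norm 1 (step \<epsilon> N (hs i) (E i)) \<le> (1 + C_LY) * W1_norm 1 (E i)"
          using step_W1_crude[OF ad hD _ EW] by simp
        have "A * \<epsilon> * L1_norm (d i) * W1_norm 2 (ks i) \<le> A * \<epsilon> * W1_norm 1 (d i) * R2"
          using A e L1_norm_le_W1_norm kB(7) by (intro mult_mono mult_left_mono) auto
        then show "W1_norm 1 ?e \<le> \<epsilon> * (q * W1_norm 1 (d i))" using eW(2) by (simp add: q_def mult_ac)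
      qed
      also have "\<epsilon> * (q * W1_norm 1 (d i)) \<le> \<epsilon> * (q * (cW1 * W1_norm 1 v + W1_norm 1 (E i)))"
        using dE[of i] cocycle_W1_norm(2)[where hs=hs and n=i, OF ad hD v] q0 e by (intro mult_left_mono) auto
      also have "\<dots> \<le> \<epsilon>\<^sub>0 * q * W1_norm 1 (E i) + \<epsilon> * (q * cW1 * W1_norm 1 v)"
        using mult_right_mono[OF e(3), of "q * W1_norm 1 (E i)"] q0 by (simp add: algebra_simps)
      finally show ?thesis by (simp add: b_def algebra_simps)
    qed
    have E0: "W1_norm 1 (E 0) \<le> 0"
      using const_W1_1 W1_const[of 0 1] by (simp add: E_def d_def v_def hs_def ks_def)
    have "W1_norm 1 (E j) \<le> real j * b ^ j * (\<epsilon> * (q * cW1 * W1_norm 1 v))"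
      by (rule perturbed_recursion[OF rec E0 b1]) (use e q0 cW1_ge in auto)
    also have "\<dots> \<le> real n * b ^ n * (\<epsilon> * (q * cW1 * W1_norm 1 v))"
      using j b1 e q0 cW1_ge by (intro mult_right_mono mult_mono power_increasing) auto
    also have "\<dots> = \<epsilon> * s * W1_norm 1 v" by (simp add: s_def)
    also have "\<dots> \<le> 1/4 * W1_norm 1 v"
    proof (rule mult_right_mono)
      have "\<epsilon> \<le> 1 / (4 * (s + 1))" using \<epsilon> by (simp add: \<epsilon>2_def)
      then have "\<epsilon> * s \<le> 1 / (4 * (s + 1)) * (s + 1)" using s0 e by (intro mult_mono) auto
      also have "1 / (4 * (s + 1)) * (s + 1) = 1 / 4" using s0 by (simp add: divide_simps)
      finally show "\<epsilon> * s \<le> 1 / 4" .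
    qed simp
    finally have "W1_norm 1 (E j) \<le> 1/4 * W1_norm 1 v" .
    then show ?thesis using dE[of j] by (simp add: d_def v_def hs_def[abs_def] ks_def)
  qed
  have zero: "(\<integral>x. h x - k x \<partial>circ) = 0" if "h \<in> inv_ball" "k \<in> inv_ball" for h k
    using inv_ballD(1,3)[OF that(1)] inv_ballD(1,3)[OF that(2)] by (simp add: D1_def L1D)
  show ?thesis
  proof (rule that[of \<epsilon>2 N1 n "cW1 + 1/4"])
    show "\<epsilon>2 \<le> \<epsilon>\<^sub>0" using \<epsilon>2 \<epsilon>1 by simp
    show "cW1 + 1/4 \<ge> 1" using cW1_ge by simp
    fix \<epsilon> N h k
    assume \<epsilon>: "\<epsilon> \<in> {0..\<epsilon>2}" and N: "N \<ge> N1" and h: "h \<in> inv_ball" and k: "k \<in> inv_ball"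
    have ad: "adm \<epsilon> N" using \<epsilon> \<epsilon>2 \<epsilon>1 N N1 by (auto simp: adm_def)
    have hD: "(F \<epsilon> N ^^ i) h \<in> Dens" for i using F_iter_inv_ball[OF ad h] by (rule inv_ballD)
    have v: "(\<lambda>x. h x - k x) \<in> W1 1" using h k by (intro W1_diff inv_ballD)
    have "\<epsilon> \<in> {0..\<epsilon>1}" using \<epsilon> \<epsilon>2 by auto
    from mix[where hs="\<lambda>i. (F \<epsilon> N ^^ i) h", OF this N hD v zero[OF h k]] main[OF \<epsilon> N h k order_refl]
    show "W1_norm 1 (\<lambda>x. (F \<epsilon> N ^^ n) h x - (F \<epsilon> N ^^ n) k x) \<le> 1/2 * W1_norm 1 (\<lambda>x. h x - k x)" by linarith
    fix j assume j: "j \<le> n"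
    show "W1_norm 1 (\<lambda>x. (F \<epsilon> N ^^ j) h x - (F \<epsilon> N ^^ j) k x) \<le> (cW1 + 1/4) * W1_norm 1 (\<lambda>x. h x - k x)"
      using main[OF \<epsilon> N h k j] cocycle_W1_norm(2)[where hs="\<lambda>i. (F \<epsilon> N ^^ i) h" and n=j, OF ad hD v]
      by (simp add: algebra_simps)
  qed (use \<epsilon>2 N1 n in auto)
qed

lemma F_exponential:
  obtains \<epsilon>1 N1 c \<gamma> where "0 < \<epsilon>1" "\<epsilon>1 \<le> \<epsilon>\<^sub>0" "N1 \<ge> 1" "c > 0" "0 < \<gamma>" "\<gamma> < 1"
    "\<And>\<epsilon> N h k n. \<epsilon> \<in> {0..\<epsilon>1} \<Longrightarrow> N \<ge> N1 \<Longrightarrow> h \<in> inv_ball \<Longrightarrow> k \<in> inv_ball \<Longrightarrow>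
      W1_norm 1 (\<lambda>x. (F \<epsilon> N ^^ n) h x - (F \<epsilon> N ^^ n) k x) \<le> c * \<gamma> ^ n"
proof -
  obtain \<epsilon>1 N1 p c where *: "0 < \<epsilon>1" "\<epsilon>1 \<le> \<epsilon>\<^sub>0" "N1 \<ge> 1" and p: "p \<ge> 1" and c: "c \<ge> 1"
    and con: "\<And>\<epsilon> N h k. \<epsilon> \<in> {0..\<epsilon>1} \<Longrightarrow> N \<ge> N1 \<Longrightarrow> h \<in> inv_ball \<Longrightarrow> k \<in> inv_ball \<Longrightarrow>
      W1_norm 1 (\<lambda>x. (F \<epsilon> N ^^ p) h x - (F \<epsilon> N ^^ p) k x) \<le> 1/2 * W1_norm 1 (\<lambda>x. h x - k x)"
    and bd: "\<And>\<epsilon> N h k j. \<epsilon> \<in> {0..\<epsilon>1} \<Longrightarrow> N \<ge> N1 \<Longrightarrow> h \<in> inv_ball \<Longrightarrow> k \<in> inv_ball \<Longrightarrow> j \<le> p \<Longrightarrow>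
      W1_norm 1 (\<lambda>x. (F \<epsilon> N ^^ j) h x - (F \<epsilon> N ^^ j) k x) \<le> c * W1_norm 1 (\<lambda>x. h x - k x)"
    by (rule F_contracts) blast
  \<comment> \<open>A factor \<open>1/2\<close> every \<open>p\<close> steps.\<close>
  define \<gamma> where "\<gamma> = root p (1/2)"
  have \<gamma>: "0 < \<gamma>" "\<gamma> < 1" "\<gamma> ^ p = 1/2" using p by (auto simp: \<gamma>_def real_root_lt_1_iff)
  have R: "0 < R1" using R_pos(1) by linarith
  show ?thesis
  proof (rule that[OF * _ \<gamma>(1,2), of "4 * c * R1"])
    show "0 < 4 * c * R1" using c R by simp
    fix \<epsilon> N h k n
    assume \<epsilon>: "\<epsilon> \<in> {0..\<epsilon>1}" and N: "N \<ge> N1" and h: "h \<in> inv_ball" and k: "k \<in> inv_ball"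
    have ad: "adm \<epsilon> N" using \<epsilon> * N by (auto simp: adm_def)
    let ?D = "\<lambda>n. W1_norm 1 (\<lambda>x. (F \<epsilon> N ^^ n) h x - (F \<epsilon> N ^^ n) k x)"
    note it = F_iter_inv_ball[OF ad h] F_iter_inv_ball[OF ad k]
    have 0: "?D 0 \<le> 2 * R1"
      using W1_norm_triangle_diff[OF inv_ballD(4)[OF h] inv_ballD(4)[OF k]] inv_ballD(6)[OF h] inv_ballD(6)[OF k] by simp
    have q: "?D (p * i) \<le> (1/2) ^ i * ?D 0" for i
    proof (induction i)
      case (Suc i)
      have "?D (p * Suc i) \<le> 1/2 * ?D (p * i)"
        using con[OF \<epsilon> N it(1)[of "p * i"] it(2)[of "p * i"]] by (simp add: funpow_add)
      then show ?case using Suc by simp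
    qed simp
    define i r where "i = n div p" and "r = n mod p"
    have n: "n = r + p * i" and r: "r \<le> p" using p by (auto simp: i_def r_def less_imp_le)
    have "?D n \<le> c * ?D (p * i)"
      unfolding n using bd[OF \<epsilon> N it(1)[of "p * i"] it(2)[of "p * i"] r] by (simp add: funpow_add)
    also have "\<dots> \<le> c * ((1/2) ^ i * (2 * R1))"
      using q[of i] 0 c by (intro mult_left_mono) (auto intro: order_trans mult_left_mono)
    also have "(1/2) ^ i \<le> 2 * \<gamma> ^ n"
    proof -
      have "1/2 \<le> \<gamma> ^ r" unfolding \<gamma>(3)[symmetric] using \<gamma> r by (intro power_decreasing) auto
      then have "(1/2) ^ i * (1/2) \<le> (1/2) ^ i * \<gamma> ^ r" by (intro mult_left_mono) auto
      also have "\<dots> = \<gamma> ^ n" by (simp add: n power_add power_mult \<gamma>(3))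
      finally show ?thesis by simp
    qed
    then have "c * ((1/2) ^ i * (2 * R1)) \<le> c * (2 * \<gamma> ^ n * (2 * R1))"
      using c R by (intro mult_left_mono mult_right_mono) auto
    finally show "?D n \<le> 4 * c * R1 * \<gamma> ^ n" by (simp add: mult_ac)
  qed
qed

end

lemma le_of_geometric:
  fixes y :: real
  assumes "\<And>n. y \<le> z + Q * \<gamma> ^ n" "0 < \<gamma>" "\<gamma> < 1"
  shows "y \<le> z"
proof -
  have "(\<lambda>n. z + Q * \<gamma> ^ n) \<longlonglongrightarrow> z + Q * 0"
    using assms by (intro tendsto_intros LIMSEQ_power_zero) auto
  then show ?thesis using LIMSEQ_le_const[of _ z y] assms(1) by simp
qed

context discretised_family
begin

text \<open>The orbit of the constant density converges uniformly, because the discretised operator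
  is smoothing; one more application of the operator turns the limit into a fixed point with all
  the bounds of the orbit.\<close>

lemma F_fixed_point:
  assumes ad: "adm \<epsilon> N" and \<gamma>: "0 < \<gamma>" "\<gamma> < 1" and c: "c > 0"
    and con: "\<And>h k n. h \<in> inv_ball \<Longrightarrow> k \<in> inv_ball \<Longrightarrow> W1_norm 1 (\<lambda>x. (F \<epsilon> N ^^ n) h x - (F \<epsilon> N ^^ n) k x) \<le> c * \<gamma> ^ n"
  obtains p where "p \<in> inv_ball" "F \<epsilon> N p = p"
proof -
  note e = admD(1,3,4)[OF ad] and N = admD(2)[OF ad]
  obtain A where A: "A \<ge> 0"
    and lip: "\<And>\<epsilon> h k f. \<epsilon> \<in> {0..\<epsilon>\<^sub>0} \<Longrightarrow> h \<in> Dens \<Longrightarrow> k \<in> Dens \<Longrightarrow> f \<in> W1 1 \<Longrightarrow>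
       L1_norm (\<lambda>x. LL \<epsilon> h f x - LL \<epsilon> k f x) \<le> A * \<epsilon> * L1_norm (\<lambda>x. h x - k x) * W1_norm 1 f"
    by (rule LL_Lipschitz) blast
  obtain b where b: "b \<ge> 0" and bW: "\<And>f. f \<in> L1 \<Longrightarrow> fejer_proj N f \<in> W1 2"
    "\<And>f. f \<in> L1 \<Longrightarrow> W1_norm 2 (fejer_proj N f) \<le> b * L1_norm f"
    and bs: "\<And>f x. f \<in> L1 \<Longrightarrow> \<bar>fejer_proj N f x\<bar> \<le> b * L1_norm f"
    by (rule fejer_smoothing[of N 2]) blast
  define q where "q = 1 + A * \<epsilon> * R1"
  have q: "q \<ge> 1" using A e R_pos by (simp add: q_def)
  define G where "G x = LL \<epsilon> x x" for x
  have G_L1: "G x \<in> L1" if "x \<in> D1" for x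
    unfolding G_def using that by (intro LL_L1[OF ad] D1_Dens) (auto simp: D1_def)
  have FG: "F \<epsilon> N x = fejer_proj N (G x)" for x by (simp add: F_def step_def G_def)
  have G_lip: "L1_norm (\<lambda>y. G x y - G k y) \<le> q * L1_norm (\<lambda>y. x y - k y)" if x: "x \<in> D1" and k: "k \<in> inv_ball" for x k
  proof -
    note kB = inv_ballD[OF k] and xD = D1_Dens[OF x]
    have xL: "x \<in> L1" using x by (simp add: D1_def)
    have L: "LL \<epsilon> x x \<in> L1" "LL \<epsilon> x k \<in> L1" "LL \<epsilon> k k \<in> L1"
      using LL_L1[OF ad xD xL] LL_L1[OF ad xD kB(3)] LL_L1[OF ad kB(2,3)] by auto
    have "L1_norm (\<lambda>y. LL \<epsilon> x x y - LL \<epsilon> x k y) = L1_norm (LL \<epsilon> x (\<lambda>y. x y - k y))"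
      using LL_diff_AE[OF ad xD xL kB(3)] L by (intro L1_norm_cong_AE LL_L1[OF ad xD] L1_diff xL kB(3)) auto
    also have "\<dots> \<le> L1_norm (\<lambda>y. x y - k y)" by (rule LL_norm[OF ad xD L1_diff[OF xL kB(3)]])
    finally have 1: "L1_norm (\<lambda>y. LL \<epsilon> x x y - LL \<epsilon> x k y) \<le> L1_norm (\<lambda>y. x y - k y)" .
    have 2: "L1_norm (\<lambda>y. LL \<epsilon> x k y - LL \<epsilon> k k y) \<le> A * \<epsilon> * L1_norm (\<lambda>y. x y - k y) * R1"
      by (rule order_trans[OF lip[OF e(1) xD kB(2,4)] mult_left_mono[OF kB(6)]]) (use A e in simp)
    have "L1_norm (\<lambda>y. G x y - G k y) \<le> L1_norm (\<lambda>y. LL \<epsilon> x x y - LL \<epsilon> x k y) + L1_norm (\<lambda>y. LL \<epsilon> x k y - LL \<epsilon> k k y)"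
      unfolding G_def using L1_norm_triangle[OF L1_diff[OF L(1,2)] L1_diff[OF L(2,3)]] by simp
    then show ?thesis using 1 2 by (simp add: q_def algebra_simps)
  qed
  define h where "h n = (F \<epsilon> N ^^ n) (\<lambda>_. 1)" for n
  have hb: "h n \<in> inv_ball" for n unfolding h_def by (rule F_iter_inv_ball[OF ad one_in_inv_ball])
  note hB = inv_ballD[OF hb]
  have hS: "h (Suc n) = fejer_proj N (G (h n))" for n by (simp add: h_def FG)
  have h_dist: "L1_norm (\<lambda>x. h (n + m) x - h n x) \<le> c * \<gamma> ^ n" for n m
  proof -
    have "W1_norm 1 (\<lambda>x. (F \<epsilon> N ^^ n) (h m) x - (F \<epsilon> N ^^ n) (\<lambda>_. 1) x) \<le> c * \<gamma> ^ n"
      by (rule con[OF hb one_in_inv_ball])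
    then show ?thesis
      using L1_norm_le_W1_norm[of "\<lambda>x. h (n + m) x - h n x" 1] by (simp add: h_def funpow_add)
  qed
  define Q where "Q = b * (q * c)"
  have Q: "Q \<ge> 0" using b q c by (simp add: Q_def)
  have unif: "\<bar>h (Suc (n + m)) x - h (Suc n) x\<bar> \<le> Q * \<gamma> ^ n" for n m x
  proof -
    have L: "G (h (n + m)) \<in> L1" "G (h n) \<in> L1" using hB(1) G_L1 by auto
    have "\<bar>h (Suc (n + m)) x - h (Suc n) x\<bar> \<le> b * L1_norm (\<lambda>x. G (h (n + m)) x - G (h n) x)"
      unfolding hS fejer_diff[OF L, symmetric] by (rule bs[OF L1_diff[OF L]])
    also have "\<dots> \<le> b * (q * (c * \<gamma> ^ n))"
      using order_trans[OF G_lip[OF hB(1) hb] mult_left_mono[OF h_dist]] q b by (intro mult_left_mono) auto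
    finally show ?thesis by (simp add: Q_def)
  qed
  have "Cauchy (\<lambda>n. h (Suc n) x)" for x
  proof (rule metric_CauchyI)
    fix r :: real assume r: "r > 0"
    obtain M where M: "\<And>n. n \<ge> M \<Longrightarrow> \<gamma> ^ n * Q \<le> r / 4" using power_small[OF \<gamma>, of "r / 4" Q] Q r by auto
    show "\<exists>M. \<forall>m\<ge>M. \<forall>n\<ge>M. dist (h (Suc m) x) (h (Suc n) x) < r"
    proof (intro exI[of _ M] allI impI)
      fix m n assume "m \<ge> M" "n \<ge> M"
      then have "\<bar>h (Suc m) x - h (Suc M) x\<bar> \<le> r / 4" "\<bar>h (Suc n) x - h (Suc M) x\<bar> \<le> r / 4"
        using unif[of M "m - M" x] unif[of M "n - M" x] M[of M] by (auto simp: mult.commute)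
      then show "dist (h (Suc m) x) (h (Suc n) x) < r" using r unfolding dist_real_def by linarith
    qed
  qed
  then have "\<exists>l. (\<lambda>n. h (Suc n) x) \<longlonglongrightarrow> l" for x by (simp add: convergent_eq_Cauchy)
  then obtain hi where hi: "\<And>x. (\<lambda>n. h (Suc n) x) \<longlonglongrightarrow> hi x" by metis
  have hi_dist: "\<bar>hi x - h (Suc n) x\<bar> \<le> Q * \<gamma> ^ n" for n x
  proof (rule LIMSEQ_le_const2)
    show "(\<lambda>m. \<bar>h (Suc (n + m)) x - h (Suc n) x\<bar>) \<longlonglongrightarrow> \<bar>hi x - h (Suc n) x\<bar>"
      using LIMSEQ_ignore_initial_segment[OF hi[of x], of n] by (intro tendsto_intros) (simp add: add.commute)
    show "\<exists>M. \<forall>m\<ge>M. \<bar>h (Suc (n + m)) x - h (Suc n) x\<bar> \<le> Q * \<gamma> ^ n" using unif by blast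
  qed
  have hi_L1: "hi \<in> L1"
  proof -
    have p: "periodic1 hi"
      unfolding periodic1_def
    proof
      fix x
      have "(\<lambda>n. h (Suc n) (x + 1)) = (\<lambda>n. h (Suc n) x)"
        using L1D(1)[OF hB(3)] by (simp add: periodic1_def)
      then show "hi (x + 1) = hi x" using hi[of "x + 1"] hi[of x] LIMSEQ_unique by metis
    qed
    have m: "hi \<in> borel_measurable borel"
      by (rule borel_measurable_LIMSEQ_real[OF hi]) (rule L1D(4)[OF hB(3)])
    have "\<bar>hi x\<bar> \<le> Q + b * L1_norm (G (h 0))" for x
      using hi_dist[of x 0] bs[OF G_L1[OF hB(1)], of 0 x] hS[of 0] by simp
    then show ?thesis by (rule L1_bounded[OF p m])
  qed
  have hi_n: "L1_norm (\<lambda>x. hi x - h (Suc n) x) \<le> Q * \<gamma> ^ n" for n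
  proof -
    have "L1_norm (\<lambda>x. hi x - h (Suc n) x) \<le> (\<integral>x. Q * \<gamma> ^ n \<partial>circ)"
      unfolding L1_norm_def using hi_dist L1D(2)[OF L1_abs[OF L1_diff[OF hi_L1 hB(3)]]]
      by (intro integral_mono) auto
    then show ?thesis by simp
  qed
  have hi_D1: "hi \<in> D1"
  proof -
    have "0 \<le> h (Suc n) x" for n x
    proof -
      have "h (Suc n) = step \<epsilon> N (h n) (h n)" by (simp add: h_def F_def)
      then show ?thesis using step_D1(2)[OF ad hB(2,1)] by simp
    qed
    then have "0 \<le> hi x" for x by (intro LIMSEQ_le_const[OF hi]) auto
    moreover have "\<bar>(\<integral>x. hi x \<partial>circ) - 1\<bar> \<le> 0"
    proof (rule le_of_geometric[OF _ \<gamma>])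
      fix n
      have "(\<integral>x. hi x - h (Suc n) x \<partial>circ) = (\<integral>x. hi x \<partial>circ) - 1"
        using L1D(2)[OF hi_L1] L1D(2)[OF hB(3)] hB(1)[of "Suc n"] by (simp add: D1_def)
      then show "\<bar>(\<integral>x. hi x \<partial>circ) - 1\<bar> \<le> 0 + Q * \<gamma> ^ n"
        using abs_integral_le_L1_norm[of "\<lambda>x. hi x - h (Suc n) x"] hi_n[of n] by simp
    qed
    ultimately show ?thesis using hi_L1 by (simp add: D1_def)
  qed
  define p where "p = F \<epsilon> N hi"
  have p_D1: "p \<in> D1" unfolding p_def F_def by (rule step_D1(1)[OF ad D1_Dens[OF hi_D1] hi_D1])
  then have pL: "p \<in> L1" by (simp add: D1_def)
  define P where "P = b * (q * Q)"
  have pn: "(\<lambda>x. p x - h (Suc (Suc n)) x) \<in> W1 2 \<and> W1_norm 2 (\<lambda>x. p x - h (Suc (Suc n)) x) \<le> P * \<gamma> ^ n" for n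
  proof -
    have L: "G hi \<in> L1" "G (h (Suc n)) \<in> L1" using hB(1) hi_D1 G_L1 by auto
    have eq: "(\<lambda>x. p x - h (Suc (Suc n)) x) = fejer_proj N (\<lambda>x. G hi x - G (h (Suc n)) x)"
      unfolding p_def FG hS[of "Suc n"] using fejer_diff[OF L] by auto
    have "L1_norm (\<lambda>x. G hi x - G (h (Suc n)) x) \<le> q * (Q * \<gamma> ^ n)"
      using order_trans[OF G_lip[OF hi_D1 hb] mult_left_mono[OF hi_n]] q by auto
    from mult_left_mono[OF this b] show ?thesis
      unfolding eq using bW[OF L1_diff[OF L]] by (auto simp: P_def)
  qed
  have "L1_norm (\<lambda>x. p x - hi x) \<le> 0"
  proof (rule le_of_geometric[OF _ \<gamma>])
    fix n
    have Ls: "(\<lambda>x. p x - h (Suc (Suc n)) x) \<in> L1" "(\<lambda>x. hi x - h (Suc (Suc n)) x) \<in> L1"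
      using pL hi_L1 hB(3) by (auto intro: L1_diff)
    have "L1_norm (\<lambda>x. p x - hi x) \<le> L1_norm (\<lambda>x. p x - h (Suc (Suc n)) x) + L1_norm (\<lambda>x. hi x - h (Suc (Suc n)) x)"
      using L1_norm_triangle_diff[OF Ls] by simp
    also have "\<dots> \<le> P * \<gamma> ^ n + Q * \<gamma> ^ Suc n"
      using pn[of n] L1_norm_le_W1_norm[of "\<lambda>x. p x - h (Suc (Suc n)) x" 2] hi_n[of "Suc n"] by linarith
    finally show "L1_norm (\<lambda>x. p x - hi x) \<le> 0 + (P + Q * \<gamma>) * \<gamma> ^ n" by (simp add: algebra_simps)
  qed
  from L1_norm_eq_0[OF L1_diff[OF pL hi_L1] this] have "AE x in circ. p x = hi x" by simp
  then have fixp: "F \<epsilon> N p = p" using F_cong[OF ad p_D1 hi_D1] by (simp add: p_def)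
  have pW: "p \<in> W1 2" unfolding p_def FG using bW(1)[OF G_L1[OF hi_D1]] .
  have "W1_norm 2 p \<le> R2"
  proof (rule le_of_geometric[OF _ \<gamma>])
    fix n
    have "W1_norm 2 p \<le> W1_norm 2 (\<lambda>x. p x - h (Suc (Suc n)) x) + W1_norm 2 (h (Suc (Suc n)))"
      using W1_norm_triangle[OF conjunct1[OF pn[of n]] hB(5)[of "Suc (Suc n)"]] by simp
    then show "W1_norm 2 p \<le> R2 + P * \<gamma> ^ n" using pn[of n] hB(7)[of "Suc (Suc n)"] by linarith
  qed
  moreover have "W1_norm 1 p \<le> R1"
  proof (rule le_of_geometric[OF _ \<gamma>])
    fix n
    have 1: "(\<lambda>x. p x - h (Suc (Suc n)) x) \<in> W1 1" using pn[of n] W1_mono[of _ 1] by (simp add: numeral_2_eq_2)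
    have 2: "W1_norm 1 (\<lambda>x. p x - h (Suc (Suc n)) x) \<le> P * \<gamma> ^ n"
      using pn[of n] W1_norm_mono[of 1 "\<lambda>x. p x - h (Suc (Suc n)) x"] by (simp add: numeral_2_eq_2)
    have "W1_norm 1 p \<le> W1_norm 1 (\<lambda>x. p x - h (Suc (Suc n)) x) + W1_norm 1 (h (Suc (Suc n)))"
      using W1_norm_triangle[OF 1 hB(4)[of "Suc (Suc n)"]] by simp
    then show "W1_norm 1 p \<le> R1 + P * \<gamma> ^ n" using 2 hB(6)[of "Suc (Suc n)"] by linarith
  qed
  ultimately have "p \<in> inv_ball" using p_D1 pW by (simp add: inv_ball_def)
  then show ?thesis using that fixp by blast
qed

text \<open>A fixed point is the image of itself under many steps of its own cocycle.  Its zero-mean part has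
  then been contracted away, and the image of the constant density is, for large \<open>N\<close>, close to its image under the
  undiscretised composition, for which the Lasota-Yorke inequality gives a bound by nearly \<open>C_LY\<close>.  The strict
  inequality \<open>C_LY < K\<close> absorbs the errors.\<close>

lemma fixed_point_norm:
  obtains \<epsilon>1 N1 where "0 < \<epsilon>1" "\<epsilon>1 \<le> \<epsilon>\<^sub>0" "N1 \<ge> 1"
    "\<And>\<epsilon> N p. \<epsilon> \<in> {0..\<epsilon>1} \<Longrightarrow> N \<ge> N1 \<Longrightarrow> p \<in> inv_ball \<Longrightarrow> F \<epsilon> N p = p \<Longrightarrow> W1_norm 2 p \<le> K"
proof -
  \<comment> \<open>The room between \<open>C_LY\<close> and \<open>K\<close>, to be shared by four errors.\<close>
  define \<kappa> where "\<kappa> = C_LY * lam\<^sup>2 / (1 - lam\<^sup>2)"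
  have \<kappa>: "\<kappa> > 0" unfolding \<kappa>_def using LY(1) lam2 by (intro divide_pos_pos) auto
  have "C_LY + \<kappa> = C_LY / (1 - lam\<^sup>2)" using lam2 by (simp add: \<kappa>_def field_simps)
  then have K\<kappa>: "C_LY + \<kappa> \<le> K" using K by simp
  define X where "X = (R2 + 1) + cW2 * (R1 + 1)"
  have X: "X \<ge> 1" using R_pos cW2_nonneg by (simp add: X_def)
  obtain k where k: "\<And>n. n \<ge> k \<Longrightarrow> (lam\<^sup>2) ^ n * X \<le> \<kappa> / 4"
    using power_small[OF lam2, of "\<kappa> / 4" X] \<kappa> X by auto
  define Y where "Y = (cW2 + 1) * (R1 + 1)"
  have Y: "Y > 0" unfolding Y_def using cW2_nonneg R_pos by (intro mult_pos_pos) auto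
  define \<delta> where "\<delta> = \<kappa> / (4 * Y)"
  have \<delta>: "\<delta> > 0" unfolding \<delta>_def using \<kappa> Y by simp
  have \<delta>2: "cW2 * (\<delta> * (R1 + 1)) \<le> \<kappa> / 4"
  proof -
    have "cW2 * (\<delta> * (R1 + 1)) \<le> (cW2 + 1) * (\<delta> * (R1 + 1))" using \<delta> R_pos by (intro mult_right_mono) auto
    also have "\<dots> = \<delta> * Y" by (simp add: Y_def)
    also have "\<dots> = \<kappa> / 4" using Y by (simp add: \<delta>_def)
    finally show ?thesis .
  qed
  obtain n \<epsilon>1 N1 where \<epsilon>1: "0 < \<epsilon>1" "\<epsilon>1 \<le> \<epsilon>\<^sub>0" and N1: "N1 \<ge> 1"
    and mix: "\<And>\<epsilon> N (hs :: nat \<Rightarrow> real \<Rightarrow> real) v. \<epsilon> \<in> {0..\<epsilon>1} \<Longrightarrow> N \<ge> N1 \<Longrightarrow> (\<And>i. hs i \<in> Dens) \<Longrightarrow> v \<in> W1 1 \<Longrightarrow>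
       (\<integral>x. v x \<partial>circ) = 0 \<Longrightarrow> W1_norm 1 (cocycle \<epsilon> N hs n v) \<le> \<delta> * W1_norm 1 v"
    using cocycle_mixing[OF \<delta>] by metis
  define m where "m = n + k"
  define b where "b = 1 + C_LY"
  have b: "b \<ge> 1" using LY(1) by (simp add: b_def)
  have "0 \<le> real m * b ^ m * b" "0 < \<kappa> / 4" using b \<kappa> by auto
  then obtain N2 where N2: "N2 \<ge> 1" "\<And>N. N \<ge> N2 \<Longrightarrow> real m * b ^ m * b * (1 / sqrt (real N)) \<le> \<kappa> / 4"
    using inverse_sqrt_small by metis
  show ?thesis
  proof (rule that[OF \<epsilon>1, of "max N1 N2"])
    show "max N1 N2 \<ge> 1" using N1 by simp
    fix \<epsilon> N p assume \<epsilon>: "\<epsilon> \<in> {0..\<epsilon>1}" and N: "N \<ge> max N1 N2" and p: "p \<in> inv_ball" and fp: "F \<epsilon> N p = p"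
    have ad: "adm \<epsilon> N" using \<epsilon> \<epsilon>1 N N1 by (auto simp: adm_def)
    note pB = inv_ballD[OF p]
    define hs :: "nat \<Rightarrow> real \<Rightarrow> real" where "hs i = p" for i
    have hD: "hs i \<in> Dens" for i unfolding hs_def by (rule pB)
    let ?v = "\<lambda>x. p x - 1" and ?one = "\<lambda>_::real. 1::real"
    have inv: "cocycle \<epsilon> N hs j p = p" for j
      using fp by (induction j) (auto simp: hs_def F_def)
    have v: "?v \<in> W1 2" "?v \<in> W1 1" using pB(4,5) const_W1_1 by (auto intro: W1_diff)
    have vn: "W1_norm 2 ?v \<le> R2 + 1" "W1_norm 1 ?v \<le> R1 + 1"
      using W1_norm_triangle_diff[OF pB(5) const_W1_1(1)] W1_norm_triangle_diff[OF pB(4) const_W1_1(1)] pB(6,7) const_W1_1(2)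
      by fastforce+
    have vz: "(\<integral>x. ?v x \<partial>circ) = 0" using pB(1,3) by (simp add: D1_def L1D)
    have split: "p = (\<lambda>x. cocycle \<epsilon> N hs m ?v x + cocycle \<epsilon> N hs m ?one x)"
      using cocycle_diff[where hs=hs and n=m, OF ad hD pB(3) L1_const[of 1]] inv[of m] by (simp add: fun_eq_iff)
    have cW: "cocycle \<epsilon> N hs j f \<in> W1 i" if "f \<in> W1 i" "i \<in> {1..4}" for i j f using cocycle_W1[OF ad hD that(2,1)] .
    have part1: "W1_norm 2 (cocycle \<epsilon> N hs m ?v) \<le> \<kappa> / 4 + \<kappa> / 4"
    proof -
      let ?w = "cocycle \<epsilon> N hs n ?v"
      have w: "W1_norm 2 ?w \<le> X"
      proof -
        have "W1_norm 2 ?w \<le> (lam\<^sup>2) ^ n * W1_norm 2 ?v + cW2 * W1_norm 1 ?v" by (rule cocycle_W2_norm[OF ad hD v(1)])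
        also have "\<dots> \<le> 1 * (R2 + 1) + cW2 * (R1 + 1)"
          using vn lam2 cW2_nonneg by (intro add_mono mult_mono) (auto intro: power_le_one)
        finally show ?thesis by (simp add: X_def)
      qed
      have "\<epsilon> \<in> {0..\<epsilon>1}" "N \<ge> N1" using \<epsilon> N by auto
      from mix[where hs=hs, OF this hD v(2) vz] have w1: "W1_norm 1 ?w \<le> \<delta> * (R1 + 1)"
        using mult_left_mono[OF vn(2), of \<delta>] \<delta> by linarith
      have "cocycle \<epsilon> N hs m ?v = cocycle \<epsilon> N hs k ?w" unfolding m_def cocycle_add by (simp add: hs_def[abs_def])
      then have "W1_norm 2 (cocycle \<epsilon> N hs m ?v) \<le> (lam\<^sup>2) ^ k * W1_norm 2 ?w + cW2 * W1_norm 1 ?w"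
        using cocycle_W2_norm[where hs=hs and n=k, OF ad hD cW[OF v(1)]] by simp
      also have "\<dots> \<le> (lam\<^sup>2) ^ k * X + cW2 * (\<delta> * (R1 + 1))"
        using w w1 lam2 cW2_nonneg by (intro add_mono mult_left_mono) auto
      finally show ?thesis using k[OF order_refl] \<delta>2 by linarith
    qed
    let ?E = "\<lambda>j. (LL \<epsilon> p ^^ j) ?one"
    have E: "?E j \<in> W1 i" "W1_norm i (?E j) \<le> lam ^ (i * j) + C_LY" if "i \<in> {1..4}" for i j
      using LL_funpow[OF ad pB(1) that] by auto
    have part2: "W1_norm 2 (\<lambda>x. cocycle \<epsilon> N hs m ?one x - ?E m x) \<le> \<kappa> / 4"
    proof -
      let ?a = "\<lambda>j. W1_norm 2 (\<lambda>x. cocycle \<epsilon> N hs j ?one x - ?E j x)"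
      have "?a m \<le> real m * b ^ m * (1 / sqrt N * b)"
      proof (rule perturbed_recursion)
        fix j
        let ?f = "cocycle \<epsilon> N hs j ?one"
        have f2: "?f \<in> W1 2" by (rule cW[OF const_W1_1(1)]) simp
        have Ej: "?E j \<in> W1 2" "?E (Suc j) \<in> W1 (Suc 2)" "W1_norm (Suc 2) (?E (Suc j)) \<le> b"
        proof -
          show "?E j \<in> W1 2" "?E (Suc j) \<in> W1 (Suc 2)" using E(1)[of 2 j] E(1)[of "Suc 2" "Suc j"] by auto
          have "W1_norm (Suc 2) (?E (Suc j)) \<le> lam ^ (Suc 2 * Suc j) + C_LY" by (rule E(2)) simp
          also have "lam ^ (Suc 2 * Suc j) \<le> 1" using lam by (intro power_le_one) auto
          finally show "W1_norm (Suc 2) (?E (Suc j)) \<le> b" by (simp add: b_def)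
        qed
        have fL: "?f \<in> L1" "?E j \<in> L1" using f2 Ej by (auto intro: W1_L1)
        let ?r = "\<lambda>x. fejer_proj N (?E (Suc j)) x - ?E (Suc j) x"
        have r: "?r \<in> W1 2" "W1_norm 2 ?r \<le> 1 / sqrt N * b"
          using fejer_rate[OF admD(2)[OF ad] Ej(2)] mult_left_mono[OF Ej(3), of "1 / sqrt N"] by auto
        have s: "step \<epsilon> N p (\<lambda>x. ?f x - ?E j x) \<in> W1 2" "W1_norm 2 (step \<epsilon> N p (\<lambda>x. ?f x - ?E j x)) \<le> b * ?a j"
          using step_W1(1)[OF ad pB(2) _ W1_diff[OF f2 Ej(1)]] step_W1_crude[OF ad pB(2) _ W1_diff[OF f2 Ej(1)]]
          by (auto simp: b_def)
        have eq: "(\<lambda>x. cocycle \<epsilon> N hs (Suc j) ?one x - ?E (Suc j) x) = (\<lambda>x. step \<epsilon> N p (\<lambda>x. ?f x - ?E j x) x + ?r x)"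
          using step_diff[OF ad pB(2) fL] by (simp add: fun_eq_iff step_def hs_def)
        show "?a (Suc j) \<le> b * ?a j + 1 / sqrt N * b"
          unfolding eq using W1_norm_triangle[OF s(1) r(1)] s(2) r(2) by linarith
      next
        show "?a 0 \<le> 0" using W1_const[of 0 2] by simp
      qed (use b in auto)
      also have "\<dots> = real m * b ^ m * b * (1 / sqrt N)" by simp
      also have "\<dots> \<le> \<kappa> / 4" using N by (intro N2) simp
      finally show ?thesis .
    qed
    have part3: "W1_norm 2 (?E m) \<le> \<kappa> / 4 + C_LY"
    proof -
      have "(lam\<^sup>2) ^ m * 1 \<le> (lam\<^sup>2) ^ m * X" using X by (intro mult_left_mono) auto
      also have "\<dots> \<le> \<kappa> / 4" by (rule k) (simp add: m_def)
      finally have "lam ^ (2 * m) \<le> \<kappa> / 4" by (simp add: power_mult)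
      then show ?thesis using E(2)[of 2 m] by simp
    qed
    have W: "cocycle \<epsilon> N hs m ?v \<in> W1 2" "cocycle \<epsilon> N hs m ?one \<in> W1 2" "?E m \<in> W1 2"
      using cW[OF v(1)] cW[OF const_W1_1(1), of 2] E(1)[of 2 m] by auto
    have "W1_norm 2 p \<le> W1_norm 2 (cocycle \<epsilon> N hs m ?v) + W1_norm 2 (cocycle \<epsilon> N hs m ?one)"
      by (subst split) (rule W1_norm_triangle[OF W(1,2)])
    moreover have "W1_norm 2 (cocycle \<epsilon> N hs m ?one) \<le> W1_norm 2 (\<lambda>x. cocycle \<epsilon> N hs m ?one x - ?E m x) + W1_norm 2 (?E m)"
      using W1_norm_triangle[OF W1_diff[OF W(2,3)] W(3)] by simp
    ultimately show "W1_norm 2 p \<le> K" using part1 part2 part3 K\<kappa> by linarith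
  qed
qed

end

section \<open>The theorem\<close>

theorem theorem2p2:
  fixes T :: "real \<Rightarrow> real" and g :: "real \<times> real \<Rightarrow> real"
    and \<epsilon>\<^sub>0 lam C\<^sub>0 C_LY K :: real
  assumes T_map: "circle_lift T" "class_C 5 T" "uniformly_expanding T"
    and g_smooth: "class_C 5 g"
    and g_periodic: "\<And>x y. g (x + 1, y) = g (x, y)" "\<And>x y. g (x, y + 1) = g (x, y)"
    and eps0: "0 < \<epsilon>\<^sub>0" and lam: "0 < lam" "lam < 1" and C0: "0 < C\<^sub>0"
    and expanding: "\<And>\<epsilon> f x. \<epsilon> \<in> {0..\<epsilon>\<^sub>0} \<Longrightarrow> f \<in> D1 \<Longrightarrow>
          deriv (coupled_map T g \<epsilon> f) x \<noteq> 0 \<and> 1 / \<bar>deriv (coupled_map T g \<epsilon> f) x\<bar> \<le> lam"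
    and C5_bound: "\<And>\<epsilon> f. \<epsilon> \<in> {0..\<epsilon>\<^sub>0} \<Longrightarrow> f \<in> D1 \<Longrightarrow> C_norm 5 (coupled_map T g \<epsilon> f) < C\<^sub>0"
    and LY: "0 < C_LY" "Lasota_Yorke T g \<epsilon>\<^sub>0 lam C_LY"
    and K: "K \<ge> C_LY / (1 - lam\<^sup>2)"
  shows "\<exists>\<epsilon>\<^sub>4 > 0. \<exists>N\<^sub>0 :: nat. \<exists>hstar :: real \<Rightarrow> nat \<Rightarrow> (real \<Rightarrow> real). \<epsilon>\<^sub>4 \<le> \<epsilon>\<^sub>0 \<and>
     (\<forall>\<epsilon>\<in>{0..\<epsilon>\<^sub>4}. \<forall>N\<ge>N\<^sub>0.
        hstar \<epsilon> N \<in> B K \<and>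
        (AE x in circ. discrete_op T g \<epsilon> N (hstar \<epsilon> N) x = hstar \<epsilon> N x) \<and>
        (\<forall>h\<in>B K. (AE x in circ. discrete_op T g \<epsilon> N h x = h x) \<longrightarrow>
                  (AE x in circ. h x = hstar \<epsilon> N x))) \<and>
     (\<exists>C_K > 0. \<exists>\<gamma>. 0 < \<gamma> \<and> \<gamma> < 1 \<and>
        (\<forall>\<epsilon>\<in>{0..\<epsilon>\<^sub>4}. \<forall>N\<ge>N\<^sub>0. \<forall>h0\<in>B K. \<forall>n.
           (\<lambda>x. (discrete_op T g \<epsilon> N ^^ n) h0 x - hstar \<epsilon> N x) \<in> W1 1 \<and>
           W1_norm 1 (\<lambda>x. (discrete_op T g \<epsilon> N ^^ n) h0 x - hstar \<epsilon> N x) \<le> C_K * \<gamma> ^ n \<and>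
           (\<forall>hN. hN 0 = h0 \<and>
              (\<forall>m\<ge>1. hN m =
                 fejer_proj N (transfer_op (coupled_map T g \<epsilon> (hN (m - 1))) (hN (m - 1)))) \<longrightarrow>
              W1_norm 1 (\<lambda>x.
                 fold (\<lambda>m f. fejer_proj N (transfer_op (coupled_map T g \<epsilon> (hN m)) f)) [0..<n] h0 x
                   - hstar \<epsilon> N x) \<le> C_K * \<gamma> ^ n)))"
proof -
  interpret discretised_family g T \<epsilon>\<^sub>0 lam C_LY K
  proof
    show "biperiodic g" using g_periodic by (simp add: biperiodic_def)
  qed (fact g_smooth T_map(1) T_map(2) eps0 lam LY K expanding)+
  obtain \<epsilon>1 N1 c \<gamma> where 1: "0 < \<epsilon>1" "\<epsilon>1 \<le> \<epsilon>\<^sub>0" "N1 \<ge> 1" and c: "c > 0" and \<gamma>: "0 < \<gamma>" "\<gamma> < 1"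
    and con: "\<And>\<epsilon> N h k n. \<epsilon> \<in> {0..\<epsilon>1} \<Longrightarrow> N \<ge> N1 \<Longrightarrow> h \<in> inv_ball \<Longrightarrow> k \<in> inv_ball \<Longrightarrow>
      W1_norm 1 (\<lambda>x. (F \<epsilon> N ^^ n) h x - (F \<epsilon> N ^^ n) k x) \<le> c * \<gamma> ^ n"
    by (rule F_exponential) blast
  obtain \<epsilon>2 N2 where 2: "0 < \<epsilon>2" "\<epsilon>2 \<le> \<epsilon>\<^sub>0" "N2 \<ge> 1"
    and small: "\<And>\<epsilon> N p. \<epsilon> \<in> {0..\<epsilon>2} \<Longrightarrow> N \<ge> N2 \<Longrightarrow> p \<in> inv_ball \<Longrightarrow> F \<epsilon> N p = p \<Longrightarrow> W1_norm 2 p \<le> K"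
    by (rule fixed_point_norm) blast
  define \<epsilon>\<^sub>4 where "\<epsilon>\<^sub>4 = min \<epsilon>1 \<epsilon>2"
  define N\<^sub>0 where "N\<^sub>0 = max N1 N2"
  have ad: "adm \<epsilon> N" if "\<epsilon> \<in> {0..\<epsilon>\<^sub>4}" "N \<ge> N\<^sub>0" for \<epsilon> N
    using that 1 2 by (auto simp: adm_def \<epsilon>\<^sub>4_def N\<^sub>0_def)
  have con4: "W1_norm 1 (\<lambda>x. (F \<epsilon> N ^^ n) h x - (F \<epsilon> N ^^ n) k x) \<le> c * \<gamma> ^ n"
    if "\<epsilon> \<in> {0..\<epsilon>\<^sub>4}" "N \<ge> N\<^sub>0" "h \<in> inv_ball" "k \<in> inv_ball" for \<epsilon> N h k n
    using that by (intro con) (auto simp: \<epsilon>\<^sub>4_def N\<^sub>0_def)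
  have "\<exists>p. p \<in> inv_ball \<and> F \<epsilon> N p = p \<and> W1_norm 2 p \<le> K" if \<epsilon>: "\<epsilon> \<in> {0..\<epsilon>\<^sub>4}" and N: "N \<ge> N\<^sub>0" for \<epsilon> N
  proof -
    obtain p where p: "p \<in> inv_ball" "F \<epsilon> N p = p" using F_fixed_point[OF ad[OF \<epsilon> N] \<gamma> c con4[OF \<epsilon> N]] by blast
    moreover have "W1_norm 2 p \<le> K" using \<epsilon> N by (intro small[OF _ _ p]) (auto simp: \<epsilon>\<^sub>4_def N\<^sub>0_def)
    ultimately show ?thesis by blast
  qed
  then obtain hstar where hstar: "\<And>\<epsilon> N. \<epsilon> \<in> {0..\<epsilon>\<^sub>4} \<Longrightarrow> N \<ge> N\<^sub>0 \<Longrightarrow>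
      hstar \<epsilon> N \<in> inv_ball \<and> F \<epsilon> N (hstar \<epsilon> N) = hstar \<epsilon> N \<and> W1_norm 2 (hstar \<epsilon> N) \<le> K" by metis
  have iter: "(F \<epsilon> N ^^ n) (hstar \<epsilon> N) = hstar \<epsilon> N" if "\<epsilon> \<in> {0..\<epsilon>\<^sub>4}" "N \<ge> N\<^sub>0" for \<epsilon> N n
    using hstar[OF that] by (induction n) auto
  have conv: "W1_norm 1 (\<lambda>x. (F \<epsilon> N ^^ n) h x - hstar \<epsilon> N x) \<le> c * \<gamma> ^ n"
    if "\<epsilon> \<in> {0..\<epsilon>\<^sub>4}" "N \<ge> N\<^sub>0" "h \<in> B K" for \<epsilon> N h n
    using con4[OF that(1,2), of h "hstar \<epsilon> N" n] hstar[OF that(1,2)] iter[OF that(1,2)] B_subset_inv_ball that(3) by auto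
  have pos: "0 < \<epsilon>\<^sub>4" "\<epsilon>\<^sub>4 \<le> \<epsilon>\<^sub>0" using 1 2 by (auto simp: \<epsilon>\<^sub>4_def)
  have fixed: "\<forall>\<epsilon>\<in>{0..\<epsilon>\<^sub>4}. \<forall>N\<ge>N\<^sub>0.
        hstar \<epsilon> N \<in> B K \<and>
        (AE x in circ. F \<epsilon> N (hstar \<epsilon> N) x = hstar \<epsilon> N x) \<and>
        (\<forall>h\<in>B K. (AE x in circ. F \<epsilon> N h x = h x) \<longrightarrow> (AE x in circ. h x = hstar \<epsilon> N x))"
  proof (intro conjI ballI allI impI)
    fix \<epsilon> N assume \<epsilon>: "\<epsilon> \<in> {0..\<epsilon>\<^sub>4}" and N: "N\<^sub>0 \<le> N"
    note S = hstar[OF \<epsilon> N]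
    show "hstar \<epsilon> N \<in> B K" using S by (auto simp: B_def inv_ball_def)
    show "AE x in circ. F \<epsilon> N (hstar \<epsilon> N) x = hstar \<epsilon> N x" using S by simp
    fix h assume h: "h \<in> B K" and fp: "AE x in circ. F \<epsilon> N h x = h x"
    have hb: "h \<in> inv_ball" using B_subset_inv_ball h by blast
    have FF: "F \<epsilon> N (F \<epsilon> N h) = F \<epsilon> N h"
      by (rule F_cong[OF ad[OF \<epsilon> N] inv_ballD(1)[OF F_inv_ball[OF ad[OF \<epsilon> N] hb]] inv_ballD(1)[OF hb] fp])
    have Fn: "(F \<epsilon> N ^^ Suc n) h = F \<epsilon> N h" for n by (induction n) (use FF in auto)
    have L: "F \<epsilon> N h \<in> L1" "hstar \<epsilon> N \<in> L1"
      using inv_ballD(3)[OF F_inv_ball[OF ad[OF \<epsilon> N] hb]] S inv_ballD(3) by auto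
    have "L1_norm (\<lambda>x. F \<epsilon> N h x - hstar \<epsilon> N x) \<le> 0"
    proof (rule le_of_geometric[OF _ \<gamma>])
      fix n
      show "L1_norm (\<lambda>x. F \<epsilon> N h x - hstar \<epsilon> N x) \<le> 0 + (c * \<gamma>) * \<gamma> ^ n"
        using conv[OF \<epsilon> N h, of "Suc n"] L1_norm_le_W1_norm[of "\<lambda>x. F \<epsilon> N h x - hstar \<epsilon> N x" 1]
        unfolding Fn by (simp add: mult_ac)
    qed
    from L1_norm_eq_0[OF L1_diff[OF L] this] fp
    show "AE x in circ. h x = hstar \<epsilon> N x" by eventually_elim simp
  qed
  have attracting: "\<forall>\<epsilon>\<in>{0..\<epsilon>\<^sub>4}. \<forall>N\<ge>N\<^sub>0. \<forall>h0\<in>B K. \<forall>n.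
           (\<lambda>x. (F \<epsilon> N ^^ n) h0 x - hstar \<epsilon> N x) \<in> W1 1 \<and>
           W1_norm 1 (\<lambda>x. (F \<epsilon> N ^^ n) h0 x - hstar \<epsilon> N x) \<le> c * \<gamma> ^ n \<and>
           (\<forall>hN. hN 0 = h0 \<and>
              (\<forall>m\<ge>1. hN m =
                 fejer_proj N (transfer_op (coupled_map T g \<epsilon> (hN (m - 1))) (hN (m - 1)))) \<longrightarrow>
              W1_norm 1 (\<lambda>x.
                 fold (\<lambda>m f. fejer_proj N (transfer_op (coupled_map T g \<epsilon> (hN m)) f)) [0..<n] h0 x
                   - hstar \<epsilon> N x) \<le> c * \<gamma> ^ n)"
  proof (intro conjI ballI allI impI)
    fix \<epsilon> N h0 n assume \<epsilon>: "\<epsilon> \<in> {0..\<epsilon>\<^sub>4}" and N: "N\<^sub>0 \<le> N" and h0: "h0 \<in> B K"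
    have "h0 \<in> inv_ball" using B_subset_inv_ball h0 by blast
    then show "(\<lambda>x. (F \<epsilon> N ^^ n) h0 x - hstar \<epsilon> N x) \<in> W1 1"
      using F_iter_inv_ball[OF ad[OF \<epsilon> N]] hstar[OF \<epsilon> N] by (intro W1_diff inv_ballD(4)) auto
    show "W1_norm 1 (\<lambda>x. (F \<epsilon> N ^^ n) h0 x - hstar \<epsilon> N x) \<le> c * \<gamma> ^ n" by (rule conv[OF \<epsilon> N h0])
    fix hN :: "nat \<Rightarrow> real \<Rightarrow> real" assume hN: "hN 0 = h0 \<and> (\<forall>m\<ge>1. hN m =
                 fejer_proj N (transfer_op (coupled_map T g \<epsilon> (hN (m - 1))) (hN (m - 1))))"
    have it: "hN m = (F \<epsilon> N ^^ m) h0" for m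
    proof (induction m)
      case (Suc m)
      have "hN (Suc m) = F \<epsilon> N (hN m)" using hN[THEN conjunct2, rule_format, of "Suc m"] by (simp add: F_def step_def)
      then show ?case using Suc by simp
    qed (use hN in simp)
    have "fold (\<lambda>m f. fejer_proj N (transfer_op (coupled_map T g \<epsilon> (hN m)) f)) [0..<n] h0 = (F \<epsilon> N ^^ n) h0"
    proof (induction n)
      case (Suc n)
      have "fejer_proj N (LL \<epsilon> f f) = F \<epsilon> N f" for f by (simp add: F_def step_def)
      from this[of "(F \<epsilon> N ^^ n) h0"] show ?case using Suc it[of n] by simp
    qed simp
    then show "W1_norm 1 (\<lambda>x.
                 fold (\<lambda>m f. fejer_proj N (transfer_op (coupled_map T g \<epsilon> (hN m)) f)) [0..<n] h0 x
                   - hstar \<epsilon> N x) \<le> c * \<gamma> ^ n"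
      using conv[OF \<epsilon> N h0, of n] by simp
  qed
  show ?thesis
    unfolding F_discrete[symmetric]
    by (rule exI[of _ \<epsilon>\<^sub>4], rule conjI[OF pos(1)], rule exI[of _ N\<^sub>0], rule exI[of _ hstar], rule conjI[OF pos(2)],
        rule conjI[OF fixed], rule exI[of _ c], rule conjI[OF c], rule exI[of _ \<gamma>],
        rule conjI[OF \<gamma>(1)], rule conjI[OF \<gamma>(2) attracting])
qed

end
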